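(* For every member $V$ of the family $V^a$ (that is, every smooth prime Fano threefold $V$ over $\mathbb{C}$ of genus $12$ such that the identity component of $\mathrm{Aut}(V)$ is isomorphic to $\mathbb{C}^{*}$) one has $$\mathrm{lct}(V,\mathbb{C}^{*})\le \tfrac12 ,$$ where $\mathrm{lct}(V,\mathbb{C}^* )$ is the global $\mathbb{C}^{*}$-invariant log canonical threshold for $\mathbb{C}^*=\mathrm{Aut}^0(V)$.
   Context: A compact complex manifold $X$ is Fano if $-K_X$ is ample. A Fano threefold is prime if its Picard group is generated by $-K_X$; its genus is $g=\frac12(-K_X)^3+1$. Prime Fano threefolds of genus $12$ are called Mukai threefolds. The family $V^a$ consists of the Mukai threefolds whose automorphism group has identity component isomorphic to $\mathbb{C}^{*}$. For a linear system $\mathcal D$ on $X$ and $c>0$, the pair $(X,c\,\mathcal D)$ is log canonical if for every $0<\varepsilon<1$ and every point $z\in X$ the function $\big(\sum_i|f_i|^2\big)^{-(1-\varepsilon)c}$ is integrable near $z$, where the $f_i$ are local holomorphic equations of divisors spanning $\mathcal D$; for a single divisor $D=\{f=0\}$ this says that $|f|^{-2(1-\varepsilon)c}$ is locally integrable. For a Fano manifold $X$ and a subgroup $G\subset \mathrm{Aut}(X)$, $$\mathrm{lct}(X,G)=\sup\{\lambda\in\mathbb{Q}: (X,\tfrac{\lambda}{n}\mathcal D)\text{ is log canonical for every } n\in\mathbb{N}\text{ and every } G\text{-invariant linear subsystem }\mathcal D\subset|-nK_X|\}.$$ *)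

theory Defs
  imports "HOL-Analysis.Analysis" "HOL-Algebra.Bij" "HOL-Library.Function_Algebras"
begin

section \<open>Holomorphic functions and complex manifolds\<close>

definition holo_on :: "(complex^'n::finite) set \<Rightarrow> (complex^'n \<Rightarrow> complex) \<Rightarrow> bool" where
  "holo_on S f \<longleftrightarrow> (\<forall>z\<in>S. \<exists>f'. (f has_derivative f') (at z) \<and> (\<forall>a v. f' (a *s v) = a * f' v))"

text \<open>A chart is a coordinate domain together with its coordinate map.\<close>

type_synonym ('a, 'n) chart = "'a set \<times> ('a \<Rightarrow> complex^'n)"

definition cinv :: "('a, 'n::finite) chart \<Rightarrow> complex^'n \<Rightarrow> 'a" where
  "cinv c = inv_into (fst c) (snd c)"

text \<open>The expression of \<open>f\<close> in the chart \<open>c\<close> at the source and \<open>c'\<close> at the target;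
  \<open>f = (\<lambda>p. p)\<close> gives the coordinate change from \<open>c\<close> to \<open>c'\<close>.\<close>

definition local_rep :: "('a, 'n::finite) chart \<Rightarrow> ('a, 'n) chart \<Rightarrow> ('a \<Rightarrow> 'a) \<Rightarrow> complex^'n \<Rightarrow> complex^'n" where
  "local_rep c c' f = (\<lambda>z. snd c' (f (cinv c z)))"

definition chart_holo :: "('a, 'n::finite) chart \<Rightarrow> ('a, 'n) chart \<Rightarrow> ('a \<Rightarrow> 'a) \<Rightarrow> bool" where
  "chart_holo c c' f \<longleftrightarrow>
     (\<forall>j. holo_on (snd c ` {p \<in> fst c. f p \<in> fst c'}) (\<lambda>z. local_rep c c' f z $ j))"

definition complex_atlas :: "'a topology \<Rightarrow> ('a, 'n::finite) chart set \<Rightarrow> bool" where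
  "complex_atlas X A \<longleftrightarrow>
     (\<forall>c\<in>A. openin X (fst c) \<and> open (snd c ` fst c) \<and>
        homeomorphic_map (subtopology X (fst c)) (top_of_set (snd c ` fst c)) (snd c)) \<and>
     (\<Union>c\<in>A. fst c) = topspace X \<and>
     (\<forall>c\<in>A. \<forall>c'\<in>A. chart_holo c c' (\<lambda>p. p))"

text \<open>Manifolds are understood to be connected; second countability follows from compactness.\<close>

definition compact_complex_manifold :: "'a topology \<Rightarrow> ('a, 'n::finite) chart set \<Rightarrow> bool" where
  "compact_complex_manifold X A \<longleftrightarrow>
     topspace X \<noteq> {} \<and> Hausdorff_space X \<and> compact_space X \<and> connected_space X \<and> complex_atlas X A"

definition holo_fun :: "('a, 'n::finite) chart set \<Rightarrow> 'a set \<Rightarrow> ('a \<Rightarrow> complex) \<Rightarrow> bool" where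
  "holo_fun A S f \<longleftrightarrow> (\<forall>c\<in>A. holo_on (snd c ` (fst c \<inter> S)) (\<lambda>z. f (cinv c z)))"

section \<open>Automorphisms\<close>

definition holo_map :: "'a topology \<Rightarrow> ('a, 'n::finite) chart set \<Rightarrow> ('a \<Rightarrow> 'a) \<Rightarrow> bool" where
  "holo_map X A f \<longleftrightarrow> continuous_map X X f \<and> (\<forall>c\<in>A. \<forall>c'\<in>A. chart_holo c c' f)"

definition Aut :: "'a topology \<Rightarrow> ('a, 'n::finite) chart set \<Rightarrow> ('a \<Rightarrow> 'a) set" where
  "Aut X A = {f \<in> Bij (topspace X). holo_map X A f \<and> holo_map X A (inv_into (topspace X) f)}"

text \<open>The topology of \<open>Aut X A\<close> is the compact-open topology, which for a compact complex manifold
  underlies its structure of a complex Lie group.\<close>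

definition Aut_top :: "'a topology \<Rightarrow> ('a, 'n::finite) chart set \<Rightarrow> ('a \<Rightarrow> 'a) topology" where
  "Aut_top X A = topology_generated_by
     {{f \<in> Aut X A. f ` K \<subseteq> U} | K U. compactin X K \<and> openin X U}"

definition Aut0 :: "'a topology \<Rightarrow> ('a, 'n::finite) chart set \<Rightarrow> ('a \<Rightarrow> 'a) set" where
  "Aut0 X A = connected_component_of_set (Aut_top X A) (\<lambda>p\<in>topspace X. p)"

definition Aut0_group :: "'a topology \<Rightarrow> ('a, 'n::finite) chart set \<Rightarrow> ('a \<Rightarrow> 'a) monoid" where
  "Aut0_group X A = (BijGroup (topspace X))\<lparr>carrier := Aut0 X A\<rparr>"

definition Cstar :: "complex monoid" where
  "Cstar = \<lparr>carrier = - {0}, mult = (*), one = 1\<rparr>"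

text \<open>The complex structure of \<open>Aut X A\<close> is the one for which a map \<open>\<rho>\<close> from a complex manifold \<open>M\<close>
  is holomorphic iff \<open>(t, p) \<mapsto> \<rho> t p\<close> is holomorphic on \<open>M \<times> X\<close>. A point \<open>w\<close> of
  \<open>complex^('n option)\<close> stands for the pair of \<open>t = w $ None\<close> and the coordinates
  \<open>z $ j = w $ Some j\<close> of \<open>p\<close>.\<close>

definition holo_action :: "('a, 'n::finite) chart set \<Rightarrow> (complex \<Rightarrow> 'a \<Rightarrow> 'a) \<Rightarrow> bool" where
  "holo_action A \<rho> \<longleftrightarrow> (\<forall>c\<in>A. \<forall>c'\<in>A. \<forall>k.
     holo_on {w :: complex^('n option). w $ None \<noteq> 0 \<and> (\<chi> j. w $ Some j) \<in> snd c ` fst c \<and>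
                \<rho> (w $ None) (cinv c (\<chi> j. w $ Some j)) \<in> fst c'}
       (\<lambda>w. local_rep c c' (\<rho> (w $ None)) (\<chi> j. w $ Some j) $ k))"

definition Aut0_is_Cstar :: "'a topology \<Rightarrow> ('a, 'n::finite) chart set \<Rightarrow> bool" where
  "Aut0_is_Cstar X A \<longleftrightarrow> (\<exists>\<rho>. \<rho> \<in> iso Cstar (Aut0_group X A) \<and>
     homeomorphic_map (top_of_set (- {0})) (subtopology (Aut_top X A) (Aut0 X A)) \<rho> \<and>
     holo_action A \<rho>)"

section \<open>Pluri-anticanonical sections\<close>

definition jac :: "('a, 'n::finite) chart \<Rightarrow> ('a, 'n) chart \<Rightarrow> ('a \<Rightarrow> 'a) \<Rightarrow> 'a \<Rightarrow> complex" where
  "jac c c' f p = det (matrix (frechet_derivative (local_rep c c' f) (at (snd c p))))"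

text \<open>A section of \<open>-nK\<close> is given by its coefficients: \<open>s c\<close> is the coefficient, as a function on the
  domain of \<open>c\<close>, with respect to the \<open>n\<close>-th power of the frame
  \<open>\<partial>/\<partial>z\<^sub>1 \<and> \<dots> \<and> \<partial>/\<partial>z\<^sub>d\<close>; it is set to \<open>0\<close> elsewhere. The differential of \<open>f\<close> maps the frame of
  \<open>c\<close> at \<open>p\<close> to \<open>jac c c' f p\<close> times the frame of \<open>c'\<close> at \<open>f p\<close>.\<close>

type_synonym ('a, 'n) antican_sec = "('a, 'n) chart \<Rightarrow> 'a \<Rightarrow> complex"

text \<open>\<open>is_pullback A n f s t\<close> says that \<open>t\<close> is the pullback of \<open>s\<close> along \<open>f\<close>.\<close>

definition is_pullback :: "('a, 'n::finite) chart set \<Rightarrow> nat \<Rightarrow> ('a \<Rightarrow> 'a) \<Rightarrow>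
    ('a, 'n) antican_sec \<Rightarrow> ('a, 'n) antican_sec \<Rightarrow> bool" where
  "is_pullback A n f s t \<longleftrightarrow> (\<forall>c\<in>A. \<forall>c'\<in>A. \<forall>p\<in>fst c. f p \<in> fst c' \<longrightarrow>
     s c' (f p) = jac c c' f p ^ n * t c p)"

definition antican_sections :: "('a, 'n::finite) chart set \<Rightarrow> nat \<Rightarrow> ('a, 'n) antican_sec set" where
  "antican_sections A n = {s.
     (\<forall>c p. c \<notin> A \<or> p \<notin> fst c \<longrightarrow> s c p = 0) \<and>
     (\<forall>c\<in>A. holo_on (snd c ` fst c) (\<lambda>z. s c (cinv c z))) \<and>
     is_pullback A n (\<lambda>p. p) s s}"

definition sec_scale :: "complex \<Rightarrow> ('a, 'n) antican_sec \<Rightarrow> ('a, 'n) antican_sec" where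
  "sec_scale a s = (\<lambda>c p. a * s c p)"

interpretation sec: vector_space sec_scale
  by unfold_locales (auto simp: sec_scale_def fun_eq_iff algebra_simps)

section \<open>Fano manifolds\<close>

text \<open>\<open>-mK\<close> is very ample: sections \<open>s 0, \<dots>, s N\<close> without common zeros define a map
  \<open>[s 0 : \<dots> : s N]\<close> to projective space which is injective and immersive, hence an embedding of
  the compact manifold.\<close>

definition antican_very_ample :: "('a, 'n::finite) chart set \<Rightarrow> nat \<Rightarrow> bool" where
  "antican_very_ample A m \<longleftrightarrow> (\<exists>N s. (\<forall>i\<le>N::nat. s i \<in> antican_sections A m) \<and>
     (\<forall>c\<in>A. \<forall>p\<in>fst c. \<exists>i\<le>N. s i c p \<noteq> 0) \<and>
     (\<forall>c\<in>A. \<forall>c'\<in>A. \<forall>p\<in>fst c. \<forall>q\<in>fst c'. p \<noteq> q \<longrightarrow>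
        \<not> (\<exists>a. \<forall>i\<le>N. s i c' q = a * s i c p)) \<and>
     (\<forall>c\<in>A. \<forall>p\<in>fst c. \<forall>v. v \<noteq> 0 \<longrightarrow>
        \<not> (\<exists>a. \<forall>i\<le>N. frechet_derivative (\<lambda>z. s i c (cinv c z)) (at (snd c p)) v = a * s i c p)))"

definition antican_ample :: "('a, 'n::finite) chart set \<Rightarrow> bool" where
  "antican_ample A \<longleftrightarrow> (\<exists>m\<ge>1. antican_very_ample A m)"

definition fano_manifold :: "'a topology \<Rightarrow> ('a, 'n::finite) chart set \<Rightarrow> bool" where
  "fano_manifold X A \<longleftrightarrow> compact_complex_manifold X A \<and> antican_ample A"

text \<open>Line bundles are given by transition functions, \<open>g i j\<close> taking coefficients with respect to
  the frame over \<open>U j\<close> to those with respect to the frame over \<open>U i\<close>.\<close>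

definition line_bundle :: "'a topology \<Rightarrow> ('a, 'n::finite) chart set \<Rightarrow>
    'i set \<Rightarrow> ('i \<Rightarrow> 'a set) \<Rightarrow> ('i \<Rightarrow> 'i \<Rightarrow> 'a \<Rightarrow> complex) \<Rightarrow> bool" where
  "line_bundle X A I U g \<longleftrightarrow>
     (\<forall>i\<in>I. openin X (U i)) \<and> (\<Union>i\<in>I. U i) = topspace X \<and>
     (\<forall>i\<in>I. \<forall>j\<in>I. holo_fun A (U i \<inter> U j) (g i j) \<and> (\<forall>p\<in>U i \<inter> U j. g i j p \<noteq> 0)) \<and>
     (\<forall>i\<in>I. \<forall>j\<in>I. \<forall>k\<in>I. \<forall>p\<in>U i \<inter> U j \<inter> U k. g i j p * g j k p = g i k p)"

definition line_bundle_iso :: "('a, 'n::finite) chart set \<Rightarrow>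
    'i set \<Rightarrow> ('i \<Rightarrow> 'a set) \<Rightarrow> ('i \<Rightarrow> 'i \<Rightarrow> 'a \<Rightarrow> complex) \<Rightarrow>
    'j set \<Rightarrow> ('j \<Rightarrow> 'a set) \<Rightarrow> ('j \<Rightarrow> 'j \<Rightarrow> 'a \<Rightarrow> complex) \<Rightarrow> bool" where
  "line_bundle_iso A I U g J V k \<longleftrightarrow> (\<exists>h.
     (\<forall>i\<in>I. \<forall>j\<in>J. holo_fun A (U i \<inter> V j) (h i j) \<and> (\<forall>p\<in>U i \<inter> V j. h i j p \<noteq> 0)) \<and>
     (\<forall>i\<in>I. \<forall>i'\<in>I. \<forall>j\<in>J. \<forall>j'\<in>J. \<forall>p\<in>U i \<inter> U i' \<inter> V j \<inter> V j'.
        h i' j' p * k j' j p = g i' i p * h i j p))"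

definition antican_cocycle :: "int \<Rightarrow> ('a, 'n::finite) chart \<Rightarrow> ('a, 'n) chart \<Rightarrow> 'a \<Rightarrow> complex" where
  "antican_cocycle m c' c p = jac c c' (\<lambda>p. p) p powi m"

text \<open>Covers indexed by points suffice: choose a trivialising neighbourhood of every point.\<close>

definition Pic_generated_by_antican :: "'a topology \<Rightarrow> ('a, 'n::finite) chart set \<Rightarrow> bool" where
  "Pic_generated_by_antican X A \<longleftrightarrow>
     (\<forall>(I :: 'a set) U g. line_bundle X A I U g \<longrightarrow>
        (\<exists>m. line_bundle_iso A I U g A fst (antican_cocycle m)))"

section \<open>The degree of the anticanonical class\<close>

text \<open>For open \<open>S\<close>, \<open>Ck k S u\<close> says that \<open>u\<close> has continuous partial derivatives up to order \<open>k\<close>.\<close>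

primrec Ck :: "nat \<Rightarrow> 'b::real_normed_vector set \<Rightarrow> ('b \<Rightarrow> real) \<Rightarrow> bool" where
  "Ck 0 S u \<longleftrightarrow> continuous_on S u"
| "Ck (Suc k) S u \<longleftrightarrow> (\<forall>z\<in>S. u differentiable (at z)) \<and>
     (\<forall>v. Ck k S (\<lambda>z. frechet_derivative u (at z) v))"

definition dir2 :: "('b::real_normed_vector \<Rightarrow> real) \<Rightarrow> 'b \<Rightarrow> 'b \<Rightarrow> 'b \<Rightarrow> real" where
  "dir2 u z v w = frechet_derivative (\<lambda>x. frechet_derivative u (at x) w) (at z) v"

text \<open>\<open>\<partial>\<^sup>2u / \<partial>z\<^sub>j \<partial>(conj z\<^sub>k)\<close>, from \<open>\<partial>/\<partial>z = (\<partial>/\<partial>x - \<i> \<partial>/\<partial>y)/2\<close> and its conjugate.\<close>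

definition levi :: "(complex^'n::finite \<Rightarrow> real) \<Rightarrow> complex^'n \<Rightarrow> complex^'n^'n" where
  "levi u z = (\<chi> j k.
     (of_real (dir2 u z (axis j 1) (axis k 1) + dir2 u z (axis j \<i>) (axis k \<i>)) +
      \<i> * of_real (dir2 u z (axis j 1) (axis k \<i>) - dir2 u z (axis j \<i>) (axis k 1))) / 4)"

text \<open>\<open>h c\<close> is the squared norm of the frame \<open>\<partial>/\<partial>z\<^sub>1 \<and> \<dots> \<and> \<partial>/\<partial>z\<^sub>d\<close> of \<open>-K\<close> over \<open>c\<close>.\<close>

definition antican_metric :: "('a, 'n::finite) chart set \<Rightarrow> (('a, 'n) chart \<Rightarrow> 'a \<Rightarrow> real) \<Rightarrow> bool" where
  "antican_metric A h \<longleftrightarrow>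
     (\<forall>c\<in>A. \<forall>p\<in>fst c. h c p > 0) \<and>
     (\<forall>c\<in>A. \<forall>k. Ck k (snd c ` fst c) (\<lambda>z. h c (cinv c z))) \<and>
     (\<forall>c\<in>A. \<forall>c'\<in>A. \<forall>p\<in>fst c \<inter> fst c'. h c p = (cmod (jac c c' (\<lambda>p. p) p))\<^sup>2 * h c' p)"

text \<open>The Chern form of \<open>h\<close> is \<open>(\<i>/2\<pi>) \<Sum> a\<^sub>j\<^sub>k dz\<^sub>j \<and> d(conj z\<^sub>k)\<close> with \<open>a = - levi (ln h)\<close>, and
  \<open>\<i> dz \<and> d(conj z) = 2 dx \<and> dy\<close>, so that with respect to Lebesgue measure its \<open>d\<close>-th exterior power has
  the following density.\<close>

definition chern_density :: "(('a, 'n::finite) chart \<Rightarrow> 'a \<Rightarrow> real) \<Rightarrow> ('a, 'n) chart \<Rightarrow> complex^'n \<Rightarrow> real" where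
  "chern_density h c z =
     fact CARD('n) / pi ^ CARD('n) * Re (det (- levi (\<lambda>w. ln (h c (cinv c w))) z))"

text \<open>The integral over \<open>X\<close> of the top degree form with density \<open>\<delta> c\<close> in the chart \<open>c\<close>, computed by
  cutting \<open>X\<close> into finitely many Borel pieces \<open>B i\<close>, each contained in a chart \<open>c i\<close>.\<close>

definition has_form_integral :: "'a topology \<Rightarrow> ('a, 'n::finite) chart set \<Rightarrow>
    (('a, 'n) chart \<Rightarrow> complex^'n \<Rightarrow> real) \<Rightarrow> real \<Rightarrow> bool" where
  "has_form_integral X A \<delta> r \<longleftrightarrow> (\<exists>(N::nat) B c.
     (\<forall>i<N. c i \<in> A \<and> B i \<subseteq> fst (c i) \<and> snd (c i) ` B i \<in> sets borel \<and>
        set_integrable lborel (snd (c i) ` B i) (\<delta> (c i))) \<and>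
     disjoint_family_on B {..<N} \<and> (\<Union>i<N. B i) = topspace X \<and>
     r = (\<Sum>i<N. set_lebesgue_integral lborel (snd (c i) ` B i) (\<delta> (c i))))"

text \<open>\<open>(-K)\<^sup>d\<close> for \<open>d = dim X\<close>: the integral of the \<open>d\<close>-th power of the first Chern form of \<open>-K\<close>,
  which does not depend on the metric.\<close>

definition antican_degree :: "'a topology \<Rightarrow> ('a, 'n::finite) chart set \<Rightarrow> real" where
  "antican_degree X A = (THE r. \<exists>h. antican_metric A h \<and> has_form_integral X A (chern_density h) r)"

section \<open>Mukai threefolds\<close>

definition prime_fano_threefold :: "'a topology \<Rightarrow> ('a, 3) chart set \<Rightarrow> bool" where
  "prime_fano_threefold X A \<longleftrightarrow> fano_manifold X A \<and> Pic_generated_by_antican X A"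

definition genus :: "'a topology \<Rightarrow> ('a, 3) chart set \<Rightarrow> real" where
  "genus X A = antican_degree X A / 2 + 1"

definition mukai_threefold :: "'a topology \<Rightarrow> ('a, 3) chart set \<Rightarrow> bool" where
  "mukai_threefold X A \<longleftrightarrow> prime_fano_threefold X A \<and> genus X A = 12"

definition family_Va :: "'a topology \<Rightarrow> ('a, 3) chart set \<Rightarrow> bool" where
  "family_Va X A \<longleftrightarrow> mukai_threefold X A \<and> Aut0_is_Cstar X A"

section \<open>The global log canonical threshold\<close>

text \<open>A linear subsystem of \<open>|-nK|\<close> is given by the non-zero vector space \<open>W\<close> of sections defining
  its members.\<close>

definition invariant_system :: "('a, 'n::finite) chart set \<Rightarrow> ('a \<Rightarrow> 'a) set \<Rightarrow> nat \<Rightarrow>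
    ('a, 'n) antican_sec set \<Rightarrow> bool" where
  "invariant_system A G n W \<longleftrightarrow> W \<subseteq> antican_sections A n \<and> sec.subspace W \<and> W \<noteq> {0} \<and>
     (\<forall>g\<in>G. \<forall>s\<in>W. \<exists>t\<in>W. is_pullback A n g s t)"

text \<open>On the base locus the integrand takes the value \<open>0\<close> instead of infinity, by the convention
  for \<open>0 powr a\<close>; the base locus has measure zero.\<close>

definition lc_system :: "('a, 'n::finite) chart set \<Rightarrow> real \<Rightarrow> ('a, 'n) antican_sec set \<Rightarrow> bool" where
  "lc_system A b W \<longleftrightarrow> (\<exists>F. finite F \<and> sec.span F = W \<and>
     (\<forall>\<epsilon>. 0 < \<epsilon> \<and> \<epsilon> < 1 \<longrightarrow> (\<forall>c\<in>A. \<forall>p\<in>fst c. \<exists>S. open S \<and> snd c p \<in> S \<and> S \<subseteq> snd c ` fst c \<and>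
        set_integrable lborel S
          (\<lambda>z. (\<Sum>s\<in>F. (cmod (s c (cinv c z)))\<^sup>2) powr (- ((1 - \<epsilon>) * b))))))"

text \<open>The value is an extended real because the set of admissible \<open>q\<close> can be unbounded.\<close>

definition lct :: "('a, 'n::finite) chart set \<Rightarrow> ('a \<Rightarrow> 'a) set \<Rightarrow> ereal" where
  "lct A G = Sup {ereal (of_rat q) | q :: rat. \<forall>n\<ge>1. \<forall>W.
     invariant_system A G n W \<longrightarrow> lc_system A (of_rat q / real n) W}"

end

theory Submission
  imports Defs "HOL-Complex_Analysis.Complex_Analysis"
begin

text \<open>The only facts used about \<open>V\<close> are that some \<open>-mK\<close> is very ample and that \<open>\<complex>\<^sup>*\<close> acts
  non-trivially. Expanding the pullbacks of sections of \<open>-mK\<close> into Laurent series in \<open>t \<in> \<complex>\<^sup>*\<close> gives finitely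
  many semi-invariant sections without common zeros and not all of the same weight. Let \<open>s\<^sub>a\<close> and \<open>s\<^sub>b\<close> be
  those of extreme weights. Then \<open>|s\<^sub>a s\<^sub>b|\<^sup>-\<^sup>1\<^sup>/\<^sup>m\<close> is the density of a measure on \<open>V\<close>, which \<open>t\<close> multiplies
  by a power of \<open>|t|\<close>. In one of the two directions \<open>t \<rightarrow> 0\<close>, \<open>t \<rightarrow> \<infinity>\<close> it does not decrease, and then
  the disjoint translates of a small open set have infinite total mass. They stay in a compact set on which
  one of the two sections, say \<open>s\<^sub>a\<close>, has no zeros, because it has the dominating weight. Hence
  \<open>|s\<^sub>b|\<^sup>-\<^sup>1\<^sup>/\<^sup>m\<close> is not locally integrable, and the invariant system spanned by \<open>s\<^sub>b\<close> shows that the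
  threshold is at most \<open>1/2\<close>.\<close>

section \<open>Laurent coefficients on the punctured plane\<close>

text \<open>The constant 1/2 comes from sharing a volume form between two sections. For one section
  \<open>s\<close> of -mK the expression |s|^(-2/m) already transforms like a density, so each of
  two sections receives the exponent -1/m, and this is the integrand that log canonicity with
  coefficient (1/2)/m tests. A threshold above 1/2 leaves exactly the room that the factor 1 -
  \<epsilon> in the definition takes away. Two sections are used because one of them must have no
  zeros on the compact set which the translates never leave: its factor is then bounded there and
  the divergence falls on the other one. Which of the two this is depends on the sign of the sum of
  their weights, so both extremes are kept until the end. The weights are extreme within a finite
  family obtained from compactness of the space, not within the space of all sections. Disjointness
  of the translates comes from the ratio |\<open>s\<^sub>b\<close>| / |\<open>s\<^sub>a\<close>|, a
  genuine function where \<open>s\<^sub>a\<close> is non-zero, which shrinks by a fixed factor at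
  each step.\<close>

definition circle_mean :: "(complex \<Rightarrow> complex) \<Rightarrow> complex \<Rightarrow> complex" where
  "circle_mean \<phi> u = integral {0..1} (\<lambda>\<theta>. \<phi> (u * cis (2 * pi * \<theta>)))"

lemma continuous_on_circle:
  assumes "continuous_on (- {0}) \<phi>" "u \<noteq> 0"
  shows "continuous_on S (\<lambda>\<theta>. \<phi> (u * cis (2 * pi * \<theta>)))"
  by (rule continuous_on_compose2[OF assms(1)]) (auto intro!: continuous_intros simp: assms)

lemma circle_integrable:
  assumes "\<phi> holomorphic_on - {0}" "u \<noteq> 0"
  shows "(\<lambda>\<theta>. \<phi> (u * cis (2 * pi * \<theta>))) integrable_on {0..1}"
  by (intro integrable_continuous_real continuous_on_circle holomorphic_on_imp_continuous_on assms)

text \<open>The derivative in the radius is, up to a factor, the integral of the derivative in the angle.\<close>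

lemma circle_mean_eq:
  assumes hol: "\<phi> holomorphic_on - {0}" and u: "u \<noteq> 0"
  shows "circle_mean \<phi> u = circle_mean \<phi> 1"
proof -
  let ?e = "\<lambda>\<theta>. cis (2 * pi * \<theta>)"
  have op: "open (- {0::complex})" by auto
  have dhol: "deriv \<phi> holomorphic_on - {0}"
    by (rule holomorphic_deriv[OF hol op])
  have D\<phi>: "(\<phi> has_field_derivative deriv \<phi> z) (at z)" if "z \<noteq> 0" for z
    using holomorphic_derivI[OF hol op] that by simp
  have D0: "(circle_mean \<phi> has_field_derivative 0) (at v)" if v: "v \<noteq> 0" for v
  proof -
    obtain r where r: "r > 0" "ball v r \<subseteq> - {0}"
      using op v by (metis ComplI openE singletonD)
    let ?U = "ball v r"
    have ne: "x \<noteq> 0" if "x \<in> ?U" for x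
      using that r(2) by blast
    then have ne': "x * ?e t \<noteq> 0" if "x \<in> ?U" for x t
      using that by simp
    have "(circle_mean \<phi> has_field_derivative
        integral (cbox 0 1) (\<lambda>\<theta>. deriv \<phi> (v * ?e \<theta>) * ?e \<theta>)) (at v within ?U)"
      unfolding circle_mean_def cbox_interval[symmetric]
    proof (rule leibniz_rule_field_derivative)
      fix x \<theta> assume x: "x \<in> ?U"
      show "((\<lambda>x. \<phi> (x * ?e \<theta>)) has_field_derivative deriv \<phi> (x * ?e \<theta>) * ?e \<theta>) (at x within ?U)"
        by (rule DERIV_chain2[where f = \<phi> and g = "\<lambda>x. x * ?e \<theta>", OF D\<phi>[OF ne'[OF x]]]) (auto intro!: derivative_eq_intros)
    next
      fix x assume "x \<in> ?U"
      then show "(\<lambda>\<theta>. \<phi> (x * ?e \<theta>)) integrable_on cbox 0 1"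
        using circle_integrable[OF hol] ne unfolding cbox_interval by blast
    next
      have "continuous_on (?U \<times> cbox 0 1) (\<lambda>p. deriv \<phi> (fst p * ?e (snd p)) * ?e (snd p))"
        by (intro continuous_intros continuous_on_compose2[OF holomorphic_on_imp_continuous_on[OF dhol]])
          (use ne' in force)+
      then show "continuous_on (?U \<times> cbox 0 1) (\<lambda>(x, \<theta>). deriv \<phi> (x * ?e \<theta>) * ?e \<theta>)"
        by (simp add: case_prod_unfold)
    qed (use r in auto)
    \<comment> \<open>The primitive is
      \<open>\<phi> (v * ?e \<theta>) / (2 * pi * \<i> * v)\<close>; its end values agree because
      the circle closes up.\<close>
    moreover have "((\<lambda>\<theta>. deriv \<phi> (v * ?e \<theta>) * ?e \<theta>) has_integral
        \<phi> (v * ?e 1) / (2 * pi * \<i> * v) - \<phi> (v * ?e 0) / (2 * pi * \<i> * v)) {0..1}"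
    proof (rule fundamental_theorem_of_calculus)
      fix \<theta> :: real
      have e: "(?e has_vector_derivative (2 * pi * \<i>) * ?e \<theta>) (at \<theta> within {0..1})"
        using exp_scaleR_has_vector_derivative_right[of "2 * pi * \<i>" \<theta> "{0..1}"]
        by (simp add: cis_conv_exp scaleR_conv_of_real mult_ac)
      have "((\<lambda>\<theta>. \<phi> (v * ?e \<theta>)) has_vector_derivative (v * ((2 * pi * \<i>) * ?e \<theta>)) * deriv \<phi> (v * ?e \<theta>))
          (at \<theta> within {0..1})"
        by (rule field_vector_diff_chain_within[unfolded o_def, OF has_vector_derivative_mult_right[OF e]])
           (use D\<phi>[of "v * ?e \<theta>"] v in \<open>auto intro: has_field_derivative_at_within\<close>)
      from has_vector_derivative_divide[OF this, of "2 * pi * \<i> * v"]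
      show "((\<lambda>\<theta>. \<phi> (v * ?e \<theta>) / (2 * pi * \<i> * v)) has_vector_derivative deriv \<phi> (v * ?e \<theta>) * ?e \<theta>)
          (at \<theta> within {0..1})"
        using v by (simp add: field_simps)
    qed auto
    then have "integral {0..1} (\<lambda>\<theta>. deriv \<phi> (v * ?e \<theta>) * ?e \<theta>) = 0"
      by (simp add: integral_unique)
    ultimately have "(circle_mean \<phi> has_field_derivative 0) (at v within ?U)"
      by simp
    then show ?thesis
      using r by (simp add: at_within_open[of v ?U])
  qed
  have "\<exists>c. \<forall>z\<in>- {0}. circle_mean \<phi> z = c"
  proof (rule DERIV_zero_connected_constant[where K = "{}"])
    show "connected (- {0::complex})"
      by (simp add: connected_punctured_universe)
    show "continuous_on (- {0}) (circle_mean \<phi>)"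
      using D0 by (intro DERIV_continuous_on[of _ _ "\<lambda>_. 0"]) (auto intro: has_field_derivative_at_within)
  qed (use D0 in auto)
  then show ?thesis
    using u by fastforce
qed

lemma circle_mean_diff:
  assumes "\<phi> holomorphic_on - {0}" "\<psi> holomorphic_on - {0}" "u \<noteq> 0"
  shows "circle_mean (\<lambda>t. \<phi> t - \<psi> t) u = circle_mean \<phi> u - circle_mean \<psi> u"
  unfolding circle_mean_def by (intro Henstock_Kurzweil_Integration.integral_diff circle_integrable assms)

lemma circle_mean_mult_left: "circle_mean (\<lambda>t. a * \<phi> t) u = a * circle_mean \<phi> u"
  unfolding circle_mean_def by simp

lemma powi_holomorphic: "(\<lambda>t. t powi k) holomorphic_on - {0}"
  by (intro holomorphic_intros) auto

text \<open>Homogeneity replaces the evaluation of the integral: the mean over the circle of radius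
  2 is \<open>2 powi k\<close> times the mean over the unit circle, yet
  \<open>circle_mean_eq\<close> makes the two equal.\<close>

lemma circle_mean_powi: "circle_mean (\<lambda>t. t powi k) 1 = (if k = 0 then 1 else 0)"
proof (cases "k = 0")
  case False
  have "circle_mean (\<lambda>t. t powi k) 2 = 2 powi k * circle_mean (\<lambda>t. t powi k) 1"
    by (simp add: circle_mean_def power_int_mult_distrib)
  then have "(2 powi k - 1) * circle_mean (\<lambda>t. t powi k) 1 = 0"
    using circle_mean_eq[OF powi_holomorphic, of 2 k] by (simp add: algebra_simps)
  moreover have "(2::complex) powi k \<noteq> 1"
  proof
    assume "(2::complex) powi k = 1"
    then have "norm ((2::complex) powi k) = 1" by simp
    then have "(2::real) powi k = 1" by (simp add: norm_power_int)
    then show False using False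
      using power_int_strict_increasing[of 0 k "2::real"] power_int_strict_increasing[of k 0 "2::real"]
      by (cases "k < 0") auto
  qed
  ultimately show ?thesis using False by simp
qed (simp add: circle_mean_def)

lemma norm_circle_mean_le:
  assumes "\<phi> holomorphic_on - {0}" "u \<noteq> 0" "\<And>t. norm t = norm u \<Longrightarrow> norm (\<phi> t) \<le> B"
  shows "norm (circle_mean \<phi> u) \<le> B"
proof -
  have "norm (circle_mean \<phi> u) \<le> B * (1 - 0)"
    unfolding circle_mean_def
    by (rule integral_bound) (auto intro!: assms(3) continuous_on_circle holomorphic_on_imp_continuous_on assms simp: norm_mult)
  then show ?thesis by simp
qed

text \<open>Dividing by \<open>t - 1\<close> turns the claim into Cauchy estimates. The quotient
  \<open>\<phi>\<close> is holomorphic on the punctured plane, and its moments \<open>c k\<close>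
  (the Laurent coefficients of index \<open>- k\<close>) are constant for \<open>k \<le> 0\<close>
  and for \<open>k \<ge> 1\<close>, with jump \<open>- F 1\<close> in between. Radius 2 forces the
  first constant to be 0 and radius 1/2 the second.\<close>

lemma laurent_unique_at_1:
  assumes hol: "F holomorphic_on - {0}" and coeff: "\<And>k::int. circle_mean (\<lambda>t. F t * t powi k) 1 = 0"
  shows "F 1 = 0"
proof -
  define \<phi> where "\<phi> t = (if t = 1 then deriv F 1 else (F t - F 1) / (t - 1))" for t
  have h\<phi>: "\<phi> holomorphic_on - {0}"
    unfolding \<phi>_def by (rule pole_lemma[OF hol]) (simp add: interior_open open_Compl)
  define c where "c k = circle_mean (\<lambda>t. \<phi> t * t powi k) 1" for k :: int
  have h\<phi>k: "(\<lambda>t. \<phi> t * t powi k) holomorphic_on - {0}" for k :: int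
    by (intro holomorphic_intros h\<phi>) auto
  have step: "c (k + 1) - c k = (if k = 0 then - F 1 else 0)" for k
  proof -
    have "circle_mean (\<lambda>t. \<phi> t * t powi (k + 1) - \<phi> t * t powi k) 1
        = circle_mean (\<lambda>t. F t * t powi k - F 1 * t powi k) 1"
      unfolding circle_mean_def
    proof (rule integral_cong)
      fix \<theta> :: real
      let ?t = "1 * cis (2 * pi * \<theta>)"
      have "\<phi> ?t * (?t - 1) = F ?t - F 1" by (simp add: \<phi>_def)
      then have "\<phi> ?t * (?t - 1) * ?t powi k = (F ?t - F 1) * ?t powi k" by simp
      then show "\<phi> ?t * ?t powi (k + 1) - \<phi> ?t * ?t powi k = F ?t * ?t powi k - F 1 * ?t powi k"
        by (simp add: power_int_add algebra_simps)
    qed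
    moreover have "(\<lambda>t. F t * t powi k) holomorphic_on - {0}" "(\<lambda>t. F 1 * t powi k) holomorphic_on - {0}"
      by (intro holomorphic_intros hol; simp)+
    ultimately show ?thesis
      unfolding c_def using h\<phi>k[of k] h\<phi>k[of "k + 1"] coeff[of k]
      by (simp add: circle_mean_diff circle_mean_mult_left circle_mean_powi)
  qed
  have c_pos: "c (int (Suc m)) = c 0 - F 1" for m
  proof (induction m)
    case 0 then show ?case using step[of 0] by (simp add: algebra_simps)
  next
    case (Suc m) then show ?case using step[of "int (Suc m)"] by (simp add: algebra_simps)
  qed
  have c_neg: "c (- int m) = c 0" for m
  proof (induction m)
    case (Suc m) then show ?case using step[of "- int (Suc m)"] by (simp add: algebra_simps)
  qed simp
  have bound: "\<exists>B. \<forall>k. norm (c k) \<le> B * norm R powi k" if R: "R \<noteq> 0" for R :: complex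
  proof -
    have "continuous_on (sphere 0 (norm R)) \<phi>"
      by (rule continuous_on_subset[OF holomorphic_on_imp_continuous_on[OF h\<phi>]]) (use R in auto)
    then have "bounded (\<phi> ` sphere 0 (norm R))"
      by (intro compact_imp_bounded compact_continuous_image) auto
    then obtain B where "\<And>t. norm t = norm R \<Longrightarrow> norm (\<phi> t) \<le> B"
      unfolding bounded_iff by (metis imageI mem_sphere_0)
    then have "norm (circle_mean (\<lambda>t. \<phi> t * t powi k) R) \<le> B * norm R powi k" for k
      by (intro norm_circle_mean_le h\<phi>k R) (auto simp: norm_mult norm_power_int intro!: mult_right_mono)
    moreover have "circle_mean (\<lambda>t. \<phi> t * t powi k) R = c k" for k
      unfolding c_def by (rule circle_mean_eq[OF h\<phi>k R])
    ultimately show ?thesis by metis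
  qed
  have "c 0 = 0"
  proof -
    obtain B where B: "\<And>k. norm (c k) \<le> B * norm (2::complex) powi k" using bound[of 2] by auto
    have "norm (c 0) \<le> B * (1 / 2) ^ m" for m
      using B[of "- int m"] by (simp add: c_neg power_int_minus power_one_over field_simps)
    moreover have "(\<lambda>m. B * (1 / 2) ^ m) \<longlonglongrightarrow> B * 0"
      by (intro tendsto_intros LIMSEQ_power_zero) auto
    ultimately have "norm (c 0) \<le> B * 0"
      by (intro LIMSEQ_le_const) auto
    then show ?thesis by simp
  qed
  moreover have "c 0 - F 1 = 0"
  proof -
    obtain B where B: "\<And>k. norm (c k) \<le> B * norm (1 / 2::complex) powi k" using bound[of "1 / 2"] by auto
    have "norm (c 0 - F 1) \<le> B * (1 / 2) ^ Suc m" for m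
      using B[of "int (Suc m)"] by (simp only: c_pos power_int_of_nat) simp
    moreover have "(\<lambda>m. B * (1 / 2) ^ Suc m) \<longlonglongrightarrow> B * 0"
      by (intro tendsto_intros LIMSEQ_Suc LIMSEQ_power_zero) auto
    ultimately have "norm (c 0 - F 1) \<le> B * 0"
      by (intro LIMSEQ_le_const) blast+
    then show ?thesis by simp
  qed
  ultimately show ?thesis by simp
qed

text \<open>Rescaling moves \<open>u\<close> to 1: substituting \<open>u * t\<close> multiplies each
  moment by a power of \<open>u\<close>, and the moments do not depend on the radius.\<close>

lemma laurent_unique:
  assumes hol: "F holomorphic_on - {0}" and coeff: "\<And>k::int. circle_mean (\<lambda>t. F t * t powi k) 1 = 0"
    and u: "u \<noteq> 0"
  shows "F u = 0"
proof -
  have "circle_mean (\<lambda>t. F (u * t) * t powi k) 1 = 0" for k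
  proof -
    have "(\<lambda>t. F t * t powi k) holomorphic_on - {0}"
      by (intro holomorphic_intros hol) auto
    from circle_mean_eq[OF this u] have "circle_mean (\<lambda>t. F t * t powi k) u = 0"
      by (simp add: coeff)
    also have "circle_mean (\<lambda>t. F t * t powi k) u = circle_mean (\<lambda>t. u powi k * (F (u * t) * t powi k)) 1"
      by (simp add: circle_mean_def power_int_mult_distrib mult_ac)
    finally show ?thesis
      using u by (simp add: circle_mean_mult_left)
  qed
  moreover have "(\<lambda>t. F (u * t)) holomorphic_on - {0}"
    by (rule holomorphic_on_compose_gen[OF _ hol, unfolded o_def]) (use u in \<open>auto intro: holomorphic_intros\<close>)
  ultimately show ?thesis
    using laurent_unique_at_1[of "\<lambda>t. F (u * t)"] by simp
qed

section \<open>Holomorphic functions of several variables\<close>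

lemma norm_vector_smult: "norm (a *s (v :: complex^'n::finite)) = norm a * norm v"
  by (simp add: norm_vec_def norm_mult L2_set_right_distrib)

lemma bounded_linear_vector_smult: "bounded_linear (\<lambda>a. a *s (v :: complex^'n::finite))"
  by (rule bounded_linear_intro[where K = "norm v"])
    (auto simp: norm_vector_smult vec_eq_iff algebra_simps)

lemma continuous_on_vector_smult [continuous_intros]:
  fixes g :: "'b::topological_space \<Rightarrow> complex^'n::finite"
  shows "continuous_on S f \<Longrightarrow> continuous_on S g \<Longrightarrow> continuous_on S (\<lambda>x. f x *s g x)"
  unfolding vector_scalar_mult_def by (intro continuous_intros)

lemma has_derivative_vec_lambda:
  fixes f :: "'b::real_normed_vector \<Rightarrow> complex^'n::finite"
  assumes "\<And>i. ((\<lambda>x. f x $ i) has_derivative (\<lambda>h. f' h $ i)) (at x within S)"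
  shows "(f has_derivative f') (at x within S)"
proof -
  have "((\<lambda>x. f x \<bullet> b) has_derivative (\<lambda>h. f' h \<bullet> b)) (at x within S)" if "b \<in> Basis" for b
  proof -
    obtain i u where b: "b = axis i u" using \<open>b \<in> Basis\<close> by (auto simp: Basis_vec_def)
    have "((\<lambda>x. f x $ i \<bullet> u) has_derivative (\<lambda>h. f' h $ i \<bullet> u)) (at x within S)"
      by (rule bounded_linear.has_derivative[OF bounded_linear_inner_left assms])
    then show ?thesis by (simp add: b inner_axis)
  qed
  then show ?thesis
    by (subst has_derivative_componentwise_within) auto
qed

text \<open>Linearity over the complex field, for derivatives that are a priori only real linear; it
  makes the complex matrix calculus applicable to them.\<close>

definition C_linear :: "(complex^'m::finite \<Rightarrow> complex^'n::finite) \<Rightarrow> bool" where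
  "C_linear L \<longleftrightarrow> Vector_Spaces.linear (*s) (*s) L"

lemma holo_onD:
  assumes "holo_on S f" "z \<in> S"
  shows "(f has_derivative frechet_derivative f (at z)) (at z)"
    "frechet_derivative f (at z) (a *s v) = a * frechet_derivative f (at z) v"
proof -
  obtain f' where f': "(f has_derivative f') (at z)" "\<And>a v. f' (a *s v) = a * f' v"
    using assms unfolding holo_on_def by blast
  have "f' = frechet_derivative f (at z)" by (rule frechet_derivative_at[OF f'(1)])
  with f' show "(f has_derivative frechet_derivative f (at z)) (at z)"
    "frechet_derivative f (at z) (a *s v) = a * frechet_derivative f (at z) v" by auto
qed

section \<open>Closure properties of holomorphic functions\<close>

lemma holo_on_subset: "holo_on S f \<Longrightarrow> T \<subseteq> S \<Longrightarrow> holo_on T f"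
  by (auto simp: holo_on_def)

lemma holo_on_imp_continuous_on: "holo_on S f \<Longrightarrow> continuous_on S f"
  by (meson continuous_at_imp_continuous_on has_derivative_continuous holo_onD(1))

lemma holo_on_transform:
  assumes "holo_on S f" "open S" "\<And>z. z \<in> S \<Longrightarrow> f z = g z"
  shows "holo_on S g"
  using assms unfolding holo_on_def
  by (metis has_derivative_transform_within_open)

lemma holo_on_open_cover:
  assumes "\<And>z. z \<in> S \<Longrightarrow> \<exists>U. z \<in> U \<and> holo_on U f"
  shows "holo_on S f"
  using assms unfolding holo_on_def by blast

lemma holo_on_const: "holo_on S (\<lambda>_. a)"
  unfolding holo_on_def by (intro ballI exI[of _ "\<lambda>_. 0"]) auto

lemma holo_on_vec_nth: "holo_on S (\<lambda>z. z $ i)"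
  unfolding holo_on_def
  by (intro ballI exI[of _ "\<lambda>h. h $ i"]) (auto intro: bounded_linear_imp_has_derivative bounded_linear_vec_nth)

lemma holo_on_add:
  assumes "holo_on S f" "holo_on S g"
  shows "holo_on S (\<lambda>z. f z + g z)"
  unfolding holo_on_def
proof
  fix z assume z: "z \<in> S"
  note D = holo_onD[OF assms(1) z] holo_onD[OF assms(2) z]
  show "\<exists>f'. ((\<lambda>z. f z + g z) has_derivative f') (at z) \<and> (\<forall>a v. f' (a *s v) = a * f' v)"
    by (rule exI, rule conjI, rule has_derivative_add[OF D(1) D(3)]) (simp add: D(2,4) algebra_simps)
qed

lemma holo_on_mult:
  assumes "holo_on S f" "holo_on S g"
  shows "holo_on S (\<lambda>z. f z * g z)"
  unfolding holo_on_def
proof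
  fix z assume z: "z \<in> S"
  note D = holo_onD[OF assms(1) z] holo_onD[OF assms(2) z]
  show "\<exists>f'. ((\<lambda>z. f z * g z) has_derivative f') (at z) \<and> (\<forall>a v. f' (a *s v) = a * f' v)"
    by (rule exI, rule conjI, rule has_derivative_mult[OF D(1) D(3)]) (simp add: D(2,4) algebra_simps)
qed

lemma holo_on_inverse:
  assumes "holo_on S f" "\<And>z. z \<in> S \<Longrightarrow> f z \<noteq> 0"
  shows "holo_on S (\<lambda>z. inverse (f z))"
  unfolding holo_on_def
proof
  fix z assume z: "z \<in> S"
  note D = holo_onD[OF assms(1) z]
  show "\<exists>f'. ((\<lambda>z. inverse (f z)) has_derivative f') (at z) \<and> (\<forall>a v. f' (a *s v) = a * f' v)"
    by (rule exI, rule conjI, rule Deriv.has_derivative_inverse[OF assms(2)[OF z] D(1)]) (simp add: D(2) algebra_simps)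
qed

lemma holo_on_sum: "(\<And>i. i \<in> I \<Longrightarrow> holo_on S (f i)) \<Longrightarrow> holo_on S (\<lambda>z. \<Sum>i\<in>I. f i z)"
  by (induction I rule: infinite_finite_induct) (auto intro: holo_on_const holo_on_add)

lemma holo_on_prod: "(\<And>i. i \<in> I \<Longrightarrow> holo_on S (f i)) \<Longrightarrow> holo_on S (\<lambda>z. \<Prod>i\<in>I. f i z)"
  by (induction I rule: infinite_finite_induct) (auto intro: holo_on_const holo_on_mult)

lemma holo_on_power: "holo_on S f \<Longrightarrow> holo_on S (\<lambda>z. f z ^ n)"
  by (induction n) (auto intro: holo_on_const holo_on_mult)

lemma holo_on_divide:
  assumes "holo_on S f" "holo_on S g" "\<And>z. z \<in> S \<Longrightarrow> g z \<noteq> 0"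
  shows "holo_on S (\<lambda>z. f z / g z)"
  unfolding divide_inverse by (intro holo_on_mult holo_on_inverse assms)

lemma holo_on_det: "(\<And>i j. holo_on S (\<lambda>z. M z $ i $ j)) \<Longrightarrow> holo_on S (\<lambda>z. det (M z))"
  unfolding det_def by (intro holo_on_sum holo_on_mult holo_on_prod holo_on_const)

lemma holo_on_vec_derivative:
  fixes g :: "complex^'m::finite \<Rightarrow> complex^'n::finite"
  assumes "\<And>i. holo_on S (\<lambda>z. g z $ i)" "z \<in> S"
  shows "(g has_derivative frechet_derivative g (at z)) (at z)"
    "frechet_derivative g (at z) v $ i = frechet_derivative (\<lambda>z. g z $ i) (at z) v"
    "C_linear (frechet_derivative g (at z))"
proof -
  define L where "L v = (\<chi> i. frechet_derivative (\<lambda>z. g z $ i) (at z) v)" for v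
  have "(g has_derivative L) (at z)"
    by (rule has_derivative_vec_lambda) (use holo_onD(1)[OF assms(1) assms(2)] in \<open>simp add: L_def\<close>)
  moreover from this have L: "L = frechet_derivative g (at z)" by (rule frechet_derivative_at)
  ultimately show D: "(g has_derivative frechet_derivative g (at z)) (at z)" by simp
  show nth: "frechet_derivative g (at z) v $ i = frechet_derivative (\<lambda>z. g z $ i) (at z) v" for v i
    unfolding L[symmetric] by (simp add: L_def)
  have "linear (frechet_derivative g (at z))" by (rule has_derivative_linear[OF D])
  moreover have "frechet_derivative g (at z) (a *s v) = a *s frechet_derivative g (at z) v" for a v
    by (simp add: vec_eq_iff nth holo_onD(2)[OF assms(1) assms(2)])
  ultimately show "C_linear (frechet_derivative g (at z))"
    unfolding C_linear_def by unfold_locales (auto simp: linear_add vec_eq_iff algebra_simps)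
qed

lemma holo_on_compose:
  fixes g :: "complex^'m::finite \<Rightarrow> complex^'n::finite"
  assumes "holo_on T f" "\<And>i. holo_on S (\<lambda>z. g z $ i)" "g ` S \<subseteq> T"
  shows "holo_on S (\<lambda>z. f (g z))"
  unfolding holo_on_def
proof
  fix z assume z: "z \<in> S"
  note G = holo_on_vec_derivative[of S g, OF assms(2) z]
  have gz: "g z \<in> T" using assms(3) z by auto
  have "((\<lambda>z. f (g z)) has_derivative (\<lambda>v. frechet_derivative f (at (g z)) (frechet_derivative g (at z) v))) (at z)"
    by (rule has_derivative_compose[OF G(1) holo_onD(1)[OF assms(1) gz]])
  moreover have "frechet_derivative g (at z) (a *s v) = a *s frechet_derivative g (at z) v" for a v
    using G(3) by (simp add: C_linear_def Vector_Spaces.linear_iff)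
  ultimately show "\<exists>f'. ((\<lambda>z. f (g z)) has_derivative f') (at z) \<and> (\<forall>a v. f' (a *s v) = a * f' v)"
    using holo_onD(2)[OF assms(1) gz] by fastforce
qed

section \<open>Restriction to complex lines, Cauchy's formula and its consequences\<close>

lemma holo_on_affine: "holo_on S (\<lambda>z. (z + w) $ i)"
  by (simp add: holo_on_add holo_on_vec_nth holo_on_const)

lemma holo_on_line_derivative:
  assumes "holo_on S f" "z + \<zeta> *s v \<in> S"
  shows "((\<lambda>\<zeta>. f (z + \<zeta> *s v)) has_field_derivative frechet_derivative f (at (z + \<zeta> *s v)) v) (at \<zeta>)"
proof -
  have "((\<lambda>\<zeta>. z + \<zeta> *s v) has_derivative (\<lambda>h. h *s v)) (at \<zeta>)"
    by (auto intro!: derivative_eq_intros bounded_linear_imp_has_derivative bounded_linear_vector_smult)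
  from has_derivative_compose[OF this holo_onD(1)[OF assms]]
  show ?thesis
    unfolding has_field_derivative_def
    by (rule has_derivative_eq_rhs) (simp add: holo_onD(2)[OF assms] fun_eq_iff mult.commute)
qed

lemma holo_on_line:
  assumes "holo_on S f" "\<And>\<zeta>. \<zeta> \<in> T \<Longrightarrow> z + \<zeta> *s v \<in> S"
  shows "(\<lambda>\<zeta>. f (z + \<zeta> *s v)) holomorphic_on T"
  unfolding holomorphic_on_def field_differentiable_def
  using holo_on_line_derivative[OF assms(1) assms(2)] has_field_derivative_at_within by blast

text \<open>\<open>holo_on\<close> asks only for differentiability at each point. Cauchy's formula
  on the line through \<open>z\<close> in direction \<open>v\<close> writes the derivative as an
  average of values of \<open>f\<close>, from which continuity and holomorphy of derivatives are
  drawn below.\<close>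

lemma cauchy_directional_derivative:
  assumes f: "holo_on S f" and r: "r > 0" and S: "\<And>\<zeta>. norm \<zeta> \<le> r \<Longrightarrow> z + \<zeta> *s v \<in> S"
  shows "frechet_derivative f (at z) v
    = integral {0..1} (\<lambda>\<theta>. f (z + (r * cis (2 * pi * \<theta>)) *s v) * cis (- (2 * pi * \<theta>)) / r)"
proof -
  let ?h = "\<lambda>\<zeta>. f (z + \<zeta> *s v)"
  have hol: "?h holomorphic_on cball 0 r"
    by (rule holo_on_line[OF f]) (use S in auto)
  have eq: "?h (circlepath 0 r \<theta>) / (circlepath 0 r \<theta> - 0)\<^sup>2 * vector_derivative (circlepath 0 r) (at \<theta>)
        = 2 * of_real pi * \<i> * (?h (r * cis (2 * pi * \<theta>)) * cis (- (2 * pi * \<theta>)) / r)" for \<theta>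
  proof -
    define E where "E = cis (2 * pi * \<theta>)"
    have e: "exp (2 * complex_of_real pi * \<i> * \<theta>) = E"
      by (simp add: E_def cis_conv_exp mult_ac)
    have E: "E \<noteq> 0" "cis (- (2 * pi * \<theta>)) = inverse E" by (simp_all add: E_def)
    have c: "circlepath 0 r \<theta> = r * E" "vector_derivative (circlepath 0 r) (at \<theta>) = 2 * of_real pi * \<i> * r * E"
      by (simp_all only: vector_derivative_circlepath e) (simp_all add: circlepath e)
    show ?thesis
      unfolding c E E_def[symmetric] using r E(1) by (simp add: power2_eq_square field_simps)
  qed
  have "(?h has_field_derivative frechet_derivative f (at z) v) (at 0)"
    using holo_on_line_derivative[OF f S[of 0]] r by simp
  moreover have "(?h has_field_derivative (1 / (2 * of_real pi * \<i>) *
      contour_integral (circlepath 0 r) (\<lambda>u. ?h u / (u - 0)\<^sup>2))) (at 0)"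
    by (rule Cauchy_derivative_integral_circlepath)
      (use hol r in \<open>auto intro: holomorphic_on_imp_continuous_on holomorphic_on_subset\<close>)
  ultimately have "frechet_derivative f (at z) v
      = 1 / (2 * of_real pi * \<i>) * contour_integral (circlepath 0 r) (\<lambda>u. ?h u / (u - 0)\<^sup>2)"
    by (rule DERIV_unique)
  also have "\<dots> = 1 / (2 * of_real pi * \<i>) * integral {0..1} (\<lambda>\<theta>. 2 * of_real pi * \<i> *
      (?h (r * cis (2 * pi * \<theta>)) * cis (- (2 * pi * \<theta>)) / r))"
    by (simp only: contour_integral_integral eq)
  also have "\<dots> = integral {0..1} (\<lambda>\<theta>. ?h (r * cis (2 * pi * \<theta>)) * cis (- (2 * pi * \<theta>)) / r)"
    by (simp add: integral_mult_right)
  finally show ?thesis .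
qed

text \<open>Differentiation under the integral sign requires a derivative that is jointly continuous
  in \<open>z\<close> and \<open>\<theta>\<close>. This is drawn from the joint continuity of
  \<open>F\<close> itself through \<open>cauchy_directional_derivative\<close>.\<close>

lemma holo_on_integral:
  fixes F :: "complex^'n::finite \<Rightarrow> real \<Rightarrow> complex"
  assumes S: "open S" and cont: "continuous_on (S \<times> {0..1}) (\<lambda>(z, \<theta>). F z \<theta>)"
    and hol: "\<And>\<theta>. \<theta> \<in> {0..1} \<Longrightarrow> holo_on S (\<lambda>z. F z \<theta>)"
  shows "holo_on S (\<lambda>z. integral {0..1} (F z))"
  unfolding holo_on_def
proof
  fix z0 assume "z0 \<in> S"
  then obtain e where e: "e > 0" "ball z0 e \<subseteq> S" using S openE by blast
  define r where "r = e / 2"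
  have r: "r > 0" using e by (simp add: r_def)
  let ?U = "ball z0 r"
  have inS: "z + \<zeta> *s v \<in> S" if "z \<in> ?U" "norm \<zeta> \<le> r" "norm v = 1" for z \<zeta> v
  proof -
    have "dist z0 (z + \<zeta> *s v) \<le> dist z0 z + norm (\<zeta> *s v)"
      by (metis dist_triangle dist_add_cancel dist_0_norm add.right_neutral)
    also have "\<dots> < e" using that by (simp add: norm_vector_smult r_def)
    finally show ?thesis using e by auto
  qed
  have US: "?U \<subseteq> S" using e r by (auto simp: r_def)
  define D where "D z \<theta> = frechet_derivative (\<lambda>z. F z \<theta>) (at z)" for z \<theta>
  have D: "((\<lambda>z. F z \<theta>) has_derivative D z \<theta>) (at z)" "D z \<theta> (a *s v) = a * D z \<theta> v"
    if "z \<in> ?U" "\<theta> \<in> {0..1}" for z \<theta> a v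
    using holo_onD[OF hol[OF that(2)]] that US unfolding D_def by blast+
  define fx where "fx z \<theta> = Blinfun (D z \<theta>)" for z \<theta>
  have fx: "blinfun_apply (fx z \<theta>) = D z \<theta>" if "z \<in> ?U" "\<theta> \<in> {0..1}" for z \<theta>
    unfolding fx_def
    by (rule bounded_linear_Blinfun_apply) (rule has_derivative_bounded_linear[OF D(1)[OF that]])
  have contF: "continuous_on T (\<lambda>x. F (g x) (h x))"
    if "continuous_on T g" "continuous_on T h" "\<And>x. x \<in> T \<Longrightarrow> g x \<in> S \<and> h x \<in> {0..1}"
    for T :: "(((complex, 'n) vec \<times> real) \<times> real) set" and g h
    using continuous_on_compose2[OF cont continuous_on_Pair[OF that(1,2)]] that(3) by force
  have cont_fx: "continuous_on (?U \<times> {0..1}) (\<lambda>p. fx (fst p) (snd p))"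
  \<comment> \<open>Continuity in the operator norm can be tested on basis vectors. These have norm
    1, so circles of radius \<open>r\<close> around points of \<open>?U\<close> stay in
    \<open>S\<close>.\<close>
  proof (rule continuous_on_blinfun_componentwise)
    fix b :: "complex^'n" assume b: "b \<in> Basis"
    let ?G = "\<lambda>p \<phi>. F (fst p + (r * cis (2 * pi * \<phi>)) *s b) (snd p) * cis (- (2 * pi * \<phi>)) / r"
    have nz: "norm (r * cis (2 * pi * \<phi>)) \<le> r" for \<phi> using r by (simp add: norm_mult)
    have "continuous_on (?U \<times> {0..1}) (\<lambda>p. integral (cbox 0 1) (?G p))"
    proof (rule integral_continuous_on_param)
      have "continuous_on ((?U \<times> {0..1}) \<times> cbox 0 1) (\<lambda>q. ?G (fst q) (snd q))"
        by (intro continuous_intros contF) (use inS nz b r in \<open>auto\<close>)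
      then show "continuous_on ((?U \<times> {0..1}) \<times> cbox 0 1) (\<lambda>(p, \<phi>). ?G p \<phi>)"
        by (simp add: case_prod_unfold)
    qed
    then show "continuous_on (?U \<times> {0..1}) (\<lambda>p. blinfun_apply (fx (fst p) (snd p)) b)"
    proof (rule continuous_on_eq)
      fix p assume p: "p \<in> ?U \<times> {0..1::real}"
      then show "integral (cbox 0 1) (?G p) = blinfun_apply (fx (fst p) (snd p)) b"
        using cauchy_directional_derivative[OF hol r, of "snd p" "fst p" b] inS[of "fst p" _ b] b
        by (auto simp: fx D_def)
    qed
  qed
  have int_F: "F z integrable_on cbox 0 1" if "z \<in> ?U" for z
  proof (rule integrable_continuous)
    show "continuous_on (cbox 0 1) (F z)"
      using continuous_on_compose2[OF cont, of "cbox 0 1" "\<lambda>\<theta>. (z, \<theta>)"] that US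
      by (force intro!: continuous_intros)
  qed
  have der: "((\<lambda>z. integral (cbox 0 1) (F z)) has_derivative integral (cbox 0 1) (fx z0)) (at z0 within ?U)"
  proof (rule leibniz_rule)
    show "continuous_on (?U \<times> cbox 0 1) (\<lambda>(z, \<theta>). fx z \<theta>)"
      using cont_fx by (simp add: case_prod_unfold)
  qed (use int_F D fx r in \<open>auto intro: has_derivative_at_withinI\<close>)
  have "continuous_on {0..1} (fx z0)"
    using continuous_on_compose2[OF cont_fx, of "{0..1}" "\<lambda>\<theta>. (z0, \<theta>)"] r
    by (force intro!: continuous_intros)
  then have int_fx: "fx z0 integrable_on {0..1}" by (rule integrable_continuous_real)
  have app: "blinfun_apply (integral {0..1} (fx z0)) v = integral {0..1} (\<lambda>\<theta>. D z0 \<theta> v)" for v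
  proof -
    have "blinfun_apply (integral {0..1} (fx z0)) v = integral {0..1} (\<lambda>\<theta>. blinfun_apply (fx z0 \<theta>) v)"
      by (rule blinfun_apply_integral[OF int_fx])
    also have "\<dots> = integral {0..1} (\<lambda>\<theta>. D z0 \<theta> v)"
      by (rule integral_cong) (use r fx in auto)
    finally show ?thesis .
  qed
  have "blinfun_apply (integral {0..1} (fx z0)) (a *s v) = a * blinfun_apply (integral {0..1} (fx z0)) v" for a v
  proof -
    have "integral {0..1} (\<lambda>\<theta>. D z0 \<theta> (a *s v)) = integral {0..1} (\<lambda>\<theta>. a * D z0 \<theta> v)"
      by (rule integral_cong) (use r D(2) in auto)
    then show ?thesis unfolding app by simp
  qed
  moreover have "((\<lambda>z. integral {0..1} (F z)) has_derivative blinfun_apply (integral {0..1} (fx z0))) (at z0)"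
    using der r by (simp add: at_within_open[of z0 ?U])
  ultimately show "\<exists>f'. ((\<lambda>z. integral {0..1} (F z)) has_derivative f') (at z0) \<and> (\<forall>a v. f' (a *s v) = a * f' v)"
    by blast
qed

lemma holo_on_directional_derivative:
  fixes f :: "complex^'n::finite \<Rightarrow> complex"
  assumes S: "open S" and f: "holo_on S f"
  shows "holo_on S (\<lambda>z. frechet_derivative f (at z) v)"
proof (rule holo_on_open_cover)
  fix z0 assume "z0 \<in> S"
  then obtain e where e: "e > 0" "ball z0 e \<subseteq> S" using S openE by blast
  \<comment> \<open>The summand 1 keeps the denominator positive for \<open>v = 0\<close>; circles
    in direction \<open>v\<close> then move points by at most \<open>e / 2\<close>.\<close>
  define r where "r = e / (2 * (1 + norm v))"
  have n: "1 + norm v > 0" by (simp add: add_pos_nonneg)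
  have r: "r > 0" using e n by (simp add: r_def)
  let ?U = "ball z0 (e / 2)"
  have inS: "z + \<zeta> *s v \<in> S" if "z \<in> ?U" "norm \<zeta> \<le> r" for z \<zeta>
  proof -
    have "norm (\<zeta> *s v) \<le> r * (1 + norm v)"
      using that r by (auto simp: norm_vector_smult intro!: mult_mono)
    also have "\<dots> = e / 2" using n by (simp add: r_def field_simps)
    finally have "dist z0 (z + \<zeta> *s v) < e"
      using that dist_triangle[of z0 "z + \<zeta> *s v" z] by (simp add: dist_norm)
    then show ?thesis using e by auto
  qed
  let ?F = "\<lambda>z \<theta>. f (z + (r * cis (2 * pi * \<theta>)) *s v) * cis (- (2 * pi * \<theta>)) / r"
  have nz: "norm (r * cis (2 * pi * \<theta>)) \<le> r" for \<theta> using r by (simp add: norm_mult)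
  have "holo_on ?U (\<lambda>z. integral {0..1} (?F z))"
  proof (rule holo_on_integral)
    have "continuous_on (?U \<times> {0..1}) (\<lambda>p. ?F (fst p) (snd p))"
      by (intro continuous_intros continuous_on_compose2[OF holo_on_imp_continuous_on[OF f]])
        (use inS nz r in auto)
    then show "continuous_on (?U \<times> {0..1}) (\<lambda>(z, \<theta>). ?F z \<theta>)"
      by (simp add: case_prod_unfold)
    show "holo_on ?U (\<lambda>z. ?F z \<theta>)" for \<theta>
      by (intro holo_on_divide holo_on_mult holo_on_const holo_on_compose[OF f] holo_on_affine)
        (use inS nz r in auto)
  qed auto
  then have "holo_on ?U (\<lambda>z. frechet_derivative f (at z) v)"
    by (rule holo_on_transform) (use cauchy_directional_derivative[OF f r] inS in auto)
  then show "\<exists>U. z0 \<in> U \<and> holo_on U (\<lambda>z. frechet_derivative f (at z) v)"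
    using e by (intro exI[of _ ?U]) auto
qed

text \<open>The complex line through \<open>z1\<close> and \<open>z\<close> meets the ball in a
  convex, hence connected, set of parameters, so the one-variable identity theorem carries the
  vanishing from parameter 0 (the point \<open>z1\<close>) to parameter 1 (the point
  \<open>z\<close>).\<close>

lemma holo_on_ball_eq_0:
  assumes f: "holo_on (ball z0 r) f" and W: "open W" "z1 \<in> W" "z1 \<in> ball z0 r" "\<And>z. z \<in> W \<Longrightarrow> f z = 0"
    and z: "z \<in> ball z0 r"
  shows "f z = 0"
proof -
  let ?l = "\<lambda>\<zeta>. z1 + \<zeta> *s (z - z1)"
  let ?T = "?l -` ball z0 r"
  have cl: "continuous_on UNIV ?l" by (intro continuous_intros)
  have opT: "open ?T" using cl by (intro open_vimage) auto
  have "linear (\<lambda>\<zeta>. \<zeta> *s (z - z1))"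
    using bounded_linear_vector_smult bounded_linear.linear by blast
  then have "convex ((\<lambda>\<zeta>. \<zeta> *s (z - z1)) -` ((\<lambda>w. - z1 + w) ` ball z0 r))"
    by (intro convex_linear_vimage convex_translation) auto
  moreover have "?T = (\<lambda>\<zeta>. \<zeta> *s (z - z1)) -` ((\<lambda>w. - z1 + w) ` ball z0 r)"
    by (force simp: image_iff)
  ultimately have conn: "connected ?T" by (simp add: convex_connected)
  have hol: "(\<lambda>\<zeta>. f (?l \<zeta>)) holomorphic_on ?T"
    by (rule holo_on_line[OF f]) auto
  have "open (?l -` W \<inter> ?T)" using cl opT by (intro open_Int open_vimage W) auto
  have "(\<lambda>\<zeta>. f (?l \<zeta>)) 1 = 0"
  proof (rule analytic_continuation_open[where s = "?l -` W \<inter> ?T" and s' = ?T and g = "\<lambda>_. 0"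
        and f = "\<lambda>\<zeta>. f (?l \<zeta>)"])
    show "?l -` W \<inter> ?T \<noteq> {}" using W by (auto simp: set_eq_iff intro!: exI[of _ 0])
  qed (use W hol conn opT z \<open>open (?l -` W \<inter> ?T)\<close> in auto)
  then show ?thesis by simp
qed

section \<open>Change of variables for holomorphic maps\<close>

text \<open>The change of variables theorem is available for \<open>real^'m\<close> with a well-ordered index type, and
  the standard basis of \<open>complex^'n\<close> is in bijection with \<open>'n bit0\<close>.\<close>

definition basis_enum :: "'n::finite bit0 \<Rightarrow> complex^'n" where
  "basis_enum = (SOME \<beta>. bij_betw \<beta> UNIV Basis)"

definition to_C :: "real^('n::finite bit0) \<Rightarrow> complex^'n" where
  "to_C x = (\<Sum>i\<in>UNIV. x $ i *\<^sub>R basis_enum i)"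

definition from_C :: "complex^'n::finite \<Rightarrow> real^('n bit0)" where
  "from_C z = (\<chi> i. z \<bullet> basis_enum i)"

lemma bij_basis_enum: "bij_betw (basis_enum :: 'n::finite bit0 \<Rightarrow> complex^'n) UNIV Basis"
proof -
  have "card (UNIV :: 'n bit0 set) = card (Basis :: (complex^'n) set)" by simp
  then have "\<exists>\<beta>. bij_betw \<beta> (UNIV :: 'n bit0 set) (Basis :: (complex^'n) set)"
    by (intro finite_same_card_bij) auto
  then show ?thesis unfolding basis_enum_def by (rule someI_ex)
qed

lemma basis_enum_Basis: "basis_enum i \<in> Basis"
  using bij_basis_enum by (auto simp: bij_betw_def)

lemma basis_enum_inner: "basis_enum i \<bullet> basis_enum j = (if i = j then 1 else 0)"
  using bij_basis_enum by (auto simp: inner_Basis basis_enum_Basis bij_betw_def inj_on_def)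

lemma sum_basis_enum: "(\<Sum>i\<in>UNIV. F (basis_enum i)) = sum F Basis"
  by (rule sum.reindex_bij_betw[OF bij_basis_enum])

lemma from_C_to_C [simp]: "from_C (to_C x) = x"
  by (simp add: from_C_def to_C_def inner_sum_left basis_enum_inner vec_eq_iff if_distrib sum.delta cong: if_cong)

lemma to_C_from_C [simp]: "to_C (from_C z) = z"
  by (simp add: from_C_def to_C_def sum_basis_enum[where F = "\<lambda>b. (z \<bullet> b) *\<^sub>R b"] euclidean_representation)

lemma to_C_basis_enum: "to_C (axis i 1) = basis_enum i"
  by (simp add: to_C_def axis_def if_distrib[of "\<lambda>x. x *\<^sub>R _"] sum.delta cong: if_cong)

lemma linear_to_C: "linear to_C"
  by (rule linearI) (auto simp: to_C_def algebra_simps sum.distrib scaleR_sum_right)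

lemma linear_from_C: "linear from_C"
  by (rule linearI) (auto simp: from_C_def vec_eq_iff inner_add_left)

lemma to_C_inner_basis_enum: "to_C x \<bullet> basis_enum i = x $ i"
  by (metis from_C_def from_C_to_C vec_lambda_beta)

lemma norm_from_C: "norm (from_C z) = norm z"
proof -
  have "(norm (from_C z))\<^sup>2 = (\<Sum>i\<in>UNIV. (z \<bullet> basis_enum i)\<^sup>2)"
    by (simp add: norm_vec_def L2_set_def sum_nonneg from_C_def)
  also have "\<dots> = (norm z)\<^sup>2"
    unfolding sum_basis_enum[where F = "\<lambda>b. (z \<bullet> b)\<^sup>2"]
    by (subst power2_norm_eq_inner) (simp add: euclidean_inner[of z z] power2_eq_square)
  finally show ?thesis by simp
qed

lemma norm_to_C: "norm (to_C x) = norm x"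
  by (metis from_C_to_C norm_from_C)

lemma continuous_on_to_C: "continuous_on S to_C"
  using linear_to_C linear_continuous_on linear_conv_bounded_linear by blast

lemma borel_measurable_to_C [measurable]: "to_C \<in> borel_measurable borel"
  by (intro borel_measurable_continuous_onI continuous_on_to_C)

text \<open>Lebesgue measure is determined by the volumes of boxes, and boxes correspond to boxes
  with the same side lengths because the coordinates are merely renamed.\<close>

lemma distr_to_C: "distr lborel borel to_C = (lborel :: (complex^'n::finite) measure)"
proof (rule lborel_eqI[symmetric])
  fix l u :: "complex^'n" assume le: "\<And>b. b \<in> Basis \<Longrightarrow> l \<bullet> b \<le> u \<bullet> b"
  have "to_C x \<in> box l u \<longleftrightarrow> x \<in> box (from_C l) (from_C u)" for x
  proof -
    have "to_C x \<in> box l u \<longleftrightarrow> (\<forall>i. l \<bullet> basis_enum i < to_C x \<bullet> basis_enum i \<and> to_C x \<bullet> basis_enum i < u \<bullet> basis_enum i)"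
      unfolding mem_box using bij_basis_enum[where 'n = 'n]
      by (metis (no_types, lifting) basis_enum_Basis bij_betw_imp_surj_on imageE)
    then show ?thesis by (simp add: mem_box_cart to_C_inner_basis_enum from_C_def)
  qed
  then have "to_C -` box l u = box (from_C l) (from_C u)" by auto
  then have "emeasure (distr lborel borel to_C) (box l u) = emeasure lborel (box (from_C l) (from_C u))"
    by (simp add: emeasure_distr)
  also have "\<dots> = (\<Prod>b\<in>Basis. (from_C u - from_C l) \<bullet> b)"
    using le[OF basis_enum_Basis] by (intro emeasure_lborel_box) (auto simp: Basis_vec_def[where 'b = "'n bit0"] inner_axis from_C_def)
  also have "(\<Prod>b\<in>Basis. (from_C u - from_C l) \<bullet> b) = (\<Prod>i\<in>UNIV. (from_C u - from_C l) $ i)"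
    by (rule prod.reindex_bij_witness[of _ "\<lambda>i. axis i 1" "\<lambda>b. SOME i. b = axis i 1"])
      (auto simp: Basis_vec_def axis_eq_axis inner_axis intro: someI)
  also have "\<dots> = (\<Prod>b\<in>Basis. (u - l) \<bullet> b)"
    unfolding prod.reindex_bij_betw[OF bij_basis_enum, symmetric] by (simp add: from_C_def inner_diff_left)
  finally show "emeasure (distr lborel borel to_C) (box l u) = (\<Prod>b\<in>Basis. (u - l) \<bullet> b)" .
qed simp

section \<open>Multiplicative functions on complex matrices\<close>

definition shear :: "('n::finite \<Rightarrow> complex) \<Rightarrow> 'n \<Rightarrow> complex^'n^'n" where
  "shear v j = (\<chi> i k. (if k = i then 1 else 0) + (if k = j then v i else 0))"

definition diagm :: "('n::finite \<Rightarrow> complex) \<Rightarrow> complex^'n^'n" where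
  "diagm d = (\<chi> i k. if k = i then d i else 0)"

lemma shear_mult: "(shear v j ** M) $ i $ k = M $ i $ k + v i * M $ j $ k"
  by (simp add: shear_def matrix_matrix_mult_def distrib_right sum.distrib if_distrib[of "\<lambda>x. x * _"] sum.delta cong: if_cong)

lemma diagm_mult: "(diagm d ** M) $ i $ k = d i * M $ i $ k"
  by (simp add: diagm_def matrix_matrix_mult_def if_distrib[of "\<lambda>x. x * _"] sum.delta cong: if_cong)

lemma shear_inverse:
  assumes "v j = 0"
  shows "shear v j ** shear (\<lambda>i. - v i) j = mat 1"
  using assms by (auto simp: vec_eq_iff shear_mult) (auto simp: shear_def mat_def)

text \<open>Conjugation by a diagonal matrix doubles the off-diagonal entries of a shear, and so
  does squaring it. A commutative multiplicative invariant cannot tell conjugates apart, hence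
  agrees on a shear and its square.\<close>

lemma shear_square:
  assumes "v j = 0"
  shows "shear v j ** shear v j =
    diagm (\<lambda>i. if i = j then 1 else 2) ** (shear v j ** diagm (\<lambda>i. if i = j then 1 else 1 / 2))"
  using assms by (auto simp: vec_eq_iff diagm_mult shear_mult) (auto simp: diagm_def shear_def)

lemma det_shear_mult:
  assumes "v j = 0"
  shows "det (shear v j ** M) = 0 \<longleftrightarrow> det M = 0"
proof -
  have "det (shear v j) * det (shear (\<lambda>i. - v i) j) = 1"
    by (metis assms det_I det_mul shear_inverse)
  then have "det (shear v j) \<noteq> 0" by auto
  then show ?thesis by (simp add: det_mul)
qed

text \<open>By \<open>shear_square\<close> the value equals its own square; being invertible, it is
  1.\<close>

lemma multiplicative_shear:
  fixes \<phi> :: "complex^'n::finite^'n \<Rightarrow> real"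
  assumes mult: "\<And>A B. \<phi> (A ** B) = \<phi> A * \<phi> B" and one: "\<phi> (mat 1) = 1" and v: "v j = 0"
  shows "\<phi> (shear v j) = 1"
proof -
  have "\<phi> (diagm (\<lambda>i. if i = j then 1 else 2)) * \<phi> (diagm (\<lambda>i. if i = j then 1 else 1 / 2)) = 1"
    unfolding mult[symmetric] one[symmetric]
    by (rule arg_cong[of _ _ \<phi>]) (auto simp: vec_eq_iff diagm_mult, auto simp: diagm_def mat_def)
  then have "\<phi> (shear v j) * \<phi> (shear v j) = \<phi> (shear v j)"
    using arg_cong[OF shear_square[of v j], of \<phi>] v by (simp add: mult mult_ac)
  moreover have "\<phi> (shear v j) * \<phi> (shear (\<lambda>i. - v i) j) = 1"
    by (metis mult one shear_inverse[of v j] v)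
  ultimately show ?thesis by auto
qed

text \<open>Column \<open>j\<close> is cleared by a shear, after a shear has moved a non-zero entry to the diagonal;
  such an entry is provided by a non-vanishing term of the Leibniz formula.\<close>

lemma multiplicative_eq_if_diagm:
  fixes \<phi> \<psi> :: "complex^'n::finite^'n \<Rightarrow> real"
  assumes \<phi>: "\<And>A B. \<phi> (A ** B) = \<phi> A * \<phi> B" "\<phi> (mat 1) = 1"
    and \<psi>: "\<And>A B. \<psi> (A ** B) = \<psi> A * \<psi> B" "\<psi> (mat 1) = 1"
    and diag: "\<And>d. \<phi> (diagm d) = \<psi> (diagm d)"
    and M: "det M \<noteq> 0"
  shows "\<phi> M = \<psi> M"
proof -
  have shear_1: "\<phi> (shear v j) = 1" "\<psi> (shear v j) = 1" if "v j = 0" for v j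
    by (rule multiplicative_shear, fact+)+
  have "\<phi> M = \<psi> M" if "det M \<noteq> 0" "\<And>i k. k \<in> K \<Longrightarrow> i \<noteq> k \<Longrightarrow> M $ i $ k = 0" for K and M :: "complex^'n^'n"
    using that
  \<comment> \<open>\<open>K\<close> collects the columns that are already zero off the
    diagonal.\<close>
  proof (induction "card (- K)" arbitrary: K M)
    case 0
    then have "K = UNIV" by auto
    with 0 have "M = diagm (\<lambda>i. M $ i $ i)" by (auto simp: vec_eq_iff diagm_def)
    then show ?case using diag by metis
  next
    case (Suc m)
    then have "- K \<noteq> {}" by auto
    then obtain j where j: "j \<notin> K" by auto
    have card: "m = card (- insert j K)"
    proof -
      have "- insert j K = - K - {j}" by auto
      then show ?thesis using Suc.hyps(2) j by (simp add: card_Diff_singleton)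
    qed
    have pivot: "\<phi> N = \<psi> N"
      if N: "det N \<noteq> 0" "\<And>i k. k \<in> K \<Longrightarrow> i \<noteq> k \<Longrightarrow> N $ i $ k = 0" "N $ j $ j \<noteq> 0" for N
    proof -
      define v where "v i = (if i = j then 0 else - (N $ i $ j / N $ j $ j))" for i
      have v: "v j = 0" by (simp add: v_def)
      have "\<phi> (shear v j ** N) = \<psi> (shear v j ** N)"
      proof (rule Suc.hyps(1)[OF card])
        show "det (shear v j ** N) \<noteq> 0" using N(1) v by (simp add: det_shear_mult)
        show "(shear v j ** N) $ i $ k = 0" if "k \<in> insert j K" "i \<noteq> k" for i k
        proof (cases "k = j")
          case False
          then have "N $ i $ k = 0" "N $ j $ k = 0" using that N(2)[of k] j by auto
          then show ?thesis by (simp add: shear_mult)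
        qed (use that N(3) in \<open>simp add: shear_mult v_def\<close>)
      qed
      then show ?thesis
        by (simp add: \<phi>(1) \<psi>(1) shear_1 v)
    qed
    show ?case
    proof (cases "M $ j $ j = 0")
      case False then show ?thesis using pivot Suc.prems by blast
    next
      case True
      obtain p where p: "p permutes UNIV" "(\<Prod>i\<in>UNIV. M $ i $ p i) \<noteq> 0"
        using Suc.prems(1) unfolding det_def by (metis (mono_tags, lifting) mem_Collect_eq mult_zero_right sum.neutral)
      have nz: "M $ i $ p i \<noteq> 0" for i using p(2) by auto
      obtain i where i: "p i = j" using p(1) by (metis permutes_surj surjE)
      \<comment> \<open>For \<open>i\<close> in \<open>K\<close> the only non-zero entry of column
        \<open>i\<close> is diagonal, which would force \<open>p i = i\<close>; but
        \<open>p i = j\<close> lies outside \<open>K\<close>. Hence row \<open>i\<close> vanishes in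
        all columns of \<open>K\<close>, and adding it to row \<open>j\<close> does not disturb
        them.\<close>
      have iK: "i \<notin> K"
      proof
        assume iK: "i \<in> K"
        obtain l where l: "p l = i" using p(1) by (metis permutes_surj surjE)
        then have "l = i" using Suc.prems(2)[OF iK, of l] nz[of l] by auto
        then show False using i l iK j by auto
      qed
      have ij: "i \<noteq> j" using True nz[of i] i by auto
      define v where "v l = (if l = j then 1 else 0 :: complex)" for l
      have v: "v i = 0" using ij by (simp add: v_def)
      have "\<phi> (shear v i ** M) = \<psi> (shear v i ** M)"
      proof (rule pivot)
        show "det (shear v i ** M) \<noteq> 0" using Suc.prems(1) v by (simp add: det_shear_mult)
        show "(shear v i ** M) $ l $ k = 0" if "k \<in> K" "l \<noteq> k" for l k
        proof -
          have "i \<noteq> k" using that iK by auto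
          then show ?thesis using that Suc.prems(2) by (simp add: shear_mult)
        qed
        show "(shear v i ** M) $ j $ j \<noteq> 0"
          using True nz[of i] i by (simp add: shear_mult v_def)
      qed
      then show ?thesis
        by (simp add: \<phi>(1) \<psi>(1) shear_1 v)
    qed
  qed
  from this[of M "{}"] M show ?thesis by auto
qed

section \<open>Real determinants of complex linear maps\<close>

definition real_matrix :: "(complex^'n::finite \<Rightarrow> complex^'n) \<Rightarrow> real^('n bit0)^('n bit0)" where
  "real_matrix L = matrix (from_C \<circ> L \<circ> to_C)"

lemma linear_matrix_vector_mult: "linear ((*v) (M :: complex^'n::finite^'n))"
  by (rule linearI) (simp add: matrix_vector_right_distrib, simp add: vec_eq_iff matrix_vector_mult_def scaleR_sum_right)

lemma real_matrix_mult: "real_matrix ((*v) (A ** B)) = real_matrix ((*v) A) ** real_matrix ((*v) B)"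
proof -
  have "from_C \<circ> (*v) (A ** B) \<circ> to_C = (from_C \<circ> (*v) A \<circ> to_C) \<circ> (from_C \<circ> (*v) B \<circ> to_C)"
    by (auto simp: fun_eq_iff matrix_vector_mul_assoc)
  then show ?thesis unfolding real_matrix_def
    by (metis matrix_compose linear_compose linear_to_C linear_from_C linear_matrix_vector_mult)
qed

lemma abs_det_real_matrix_isometry:
  assumes "linear L" "\<And>z. norm (L z) = norm z"
  shows "\<bar>det (real_matrix L)\<bar> = 1"
  unfolding real_matrix_def
  by (rule orthogonal_transformation_det)
    (auto simp: orthogonal_transformation norm_from_C norm_to_C assms
      intro!: linear_compose linear_from_C linear_to_C)

lemma diagm_vec_nth: "(diagm d *v z) $ i = d i * z $ i"
  by (simp add: diagm_def matrix_vector_mult_def if_distrib[of "\<lambda>x. x * _"] sum.delta cong: if_cong)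

lemma prod_Basis_vec: "(\<Prod>b\<in>(Basis :: (complex^'n::finite) set). F b) = (\<Prod>i\<in>UNIV. F (axis i 1) * F (axis i \<i>))"
proof -
  have B: "Basis = (\<lambda>(i, u). axis i u) ` (UNIV \<times> {1, \<i> :: complex})"
    by (auto simp: Basis_vec_def Basis_complex_def)
  have inj: "inj_on (\<lambda>(i, u). axis i u :: complex^'n) (UNIV \<times> {1, \<i>})"
    by (auto simp: inj_on_def axis_eq_axis)
  have "prod F Basis = prod (F \<circ> (\<lambda>(i, u). axis i u)) (UNIV \<times> {1, \<i>})"
    unfolding B by (rule prod.reindex[OF inj])
  also have "\<dots> = (\<Prod>(i, u)\<in>UNIV \<times> {1, \<i>}. F (axis i u))"
    by (simp add: case_prod_unfold)
  finally show ?thesis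
    by (simp add: prod.cartesian_product[symmetric] complex_eq_iff)
qed

text \<open>Polar decomposition entry by entry: the phases form an isometry, whose real determinant
  has absolute value 1, and the moduli scale the real basis vectors, two of which belong to each
  complex coordinate.\<close>

lemma abs_det_real_matrix_diagm: "\<bar>det (real_matrix ((*v) (diagm d)))\<bar> = (cmod (\<Prod>i\<in>UNIV. d i))\<^sup>2"
proof -
  define r where "r i = complex_of_real (cmod (d i))" for i
  define e where "e i = (if d i = 0 then 1 else d i / r i)" for i
  have "diagm d = diagm r ** diagm e"
    by (auto simp: vec_eq_iff diagm_mult) (auto simp: diagm_def r_def e_def)
  then have "\<bar>det (real_matrix ((*v) (diagm d)))\<bar>
      = \<bar>det (real_matrix ((*v) (diagm r)))\<bar> * \<bar>det (real_matrix ((*v) (diagm e)))\<bar>"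
    by (simp add: real_matrix_mult det_mul abs_mult)
  moreover have "\<bar>det (real_matrix ((*v) (diagm e)))\<bar> = 1"
  proof (rule abs_det_real_matrix_isometry[OF linear_matrix_vector_mult])
    have "cmod (e i) = 1" for i by (simp add: e_def r_def norm_divide)
    then show "norm (diagm e *v z) = norm z" for z
      by (simp add: norm_vec_def diagm_vec_nth norm_mult)
  qed
  moreover have "det (real_matrix ((*v) (diagm r))) = (\<Prod>i\<in>UNIV. (cmod (d i))\<^sup>2)"
  proof -
    \<comment> \<open>\<open>w b\<close> recovers the modulus belonging to the only coordinate in
      which the basis vector \<open>b\<close> is non-zero, without naming that coordinate.\<close>
    define w where "w b = (\<Sum>i\<in>UNIV. cmod (d i) * cmod (b $ i))" for b :: "complex^'a"
    have w_axis: "w (axis i u) = cmod (d i) * cmod u" for i u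
      by (simp add: w_def axis_def if_distrib sum.delta cong: if_cong)
    have "diagm r *v b = w b *\<^sub>R b" if "b \<in> Basis" for b
    proof -
      obtain i u where "u \<in> Basis" "b = axis i u"
        using \<open>b \<in> Basis\<close> by (auto simp: Basis_vec_def)
      then have b: "b = axis i u" "cmod u = 1" by auto
      then have "w b = cmod (d i)" by (simp add: w_axis)
      then show ?thesis
        by (auto simp: vec_eq_iff diagm_vec_nth r_def b axis_def scaleR_conv_of_real[where 'a = complex])
    qed
    then have nth: "real_matrix ((*v) (diagm r)) $ i $ j = w (basis_enum j) * (if i = j then 1 else 0)" for i j
      by (auto simp: real_matrix_def matrix_def to_C_basis_enum from_C_def basis_enum_Basis basis_enum_inner)
    have "det (real_matrix ((*v) (diagm r))) = (\<Prod>i\<in>UNIV. w (basis_enum i))"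
      by (subst det_diagonal) (auto simp: nth)
    also have "\<dots> = prod w Basis" by (rule prod.reindex_bij_betw[OF bij_basis_enum])
    also have "\<dots> = (\<Prod>i\<in>UNIV. (cmod (d i))\<^sup>2)"
      unfolding prod_Basis_vec by (simp add: w_axis power2_eq_square)
    finally show ?thesis .
  qed
  ultimately show ?thesis
    by (simp add: prod_norm[symmetric] prod_power_distrib abs_prod)
qed

text \<open>Both sides are multiplicative in the matrix of \<open>L\<close>, so comparing them on
  diagonal matrices is enough.\<close>

lemma abs_det_real_matrix:
  assumes L: "C_linear L" and nz: "det (matrix L) \<noteq> 0"
  shows "\<bar>det (real_matrix L)\<bar> = (cmod (det (matrix L)))\<^sup>2"
proof -
  have "\<bar>det (real_matrix ((*v) (matrix L)))\<bar> = (cmod (det (matrix L)))\<^sup>2"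
  proof (rule multiplicative_eq_if_diagm[OF _ _ _ _ _ nz])
    have "linear (\<lambda>z::complex^'a. z)" by (rule linear_ident)
    then show "\<bar>det (real_matrix ((*v) (mat 1 :: complex^'a^'a)))\<bar> = 1"
      by (intro abs_det_real_matrix_isometry linear_matrix_vector_mult) simp
    show "\<bar>det (real_matrix ((*v) (diagm d)))\<bar> = (cmod (det (diagm d)))\<^sup>2" for d :: "'a \<Rightarrow> complex"
      unfolding abs_det_real_matrix_diagm by (subst det_diagonal) (auto simp: diagm_def)
  qed (auto simp: real_matrix_mult det_mul abs_mult norm_mult power_mult_distrib)
  moreover have "(*v) (matrix L) = L"
    using L unfolding C_linear_def by (simp add: matrix_works fun_eq_iff)
  ultimately show ?thesis by simp
qed

text \<open>Change of variables in the form of the later mass estimate: on \<open>T\<close>,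
  \<open>h\<close> is the density obtained by pulling \<open>f\<close> back along \<open>g\<close>,
  with the squared modulus of the complex determinant as real Jacobian. Being an inequality, it
  tolerates overlaps in the image.\<close>

lemma nn_integral_holo_image_le:
  fixes g :: "complex^'n::finite \<Rightarrow> complex^'n" and f h :: "complex^'n \<Rightarrow> real"
  assumes hol: "\<And>k. holo_on T (\<lambda>z. g z $ k)"
    and nz: "\<And>z. z \<in> T \<Longrightarrow> det (matrix (frechet_derivative g (at z))) \<noteq> 0"
    and meas: "T \<in> sets borel" "g ` T \<in> sets borel" "f \<in> borel_measurable borel" "h \<in> borel_measurable borel"
    and nonneg: "\<And>z. 0 \<le> f z" "\<And>z. 0 \<le> h z"
    and eq: "\<And>z. z \<in> T \<Longrightarrow> (cmod (det (matrix (frechet_derivative g (at z)))))\<^sup>2 * f (g z) = h z"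
  shows "(\<integral>\<^sup>+z\<in>g ` T. ennreal (f z) \<partial>lborel) \<le> (\<integral>\<^sup>+z\<in>T. ennreal (h z) \<partial>lborel)"
\<comment> \<open>An infinite right-hand side leaves nothing to prove; otherwise \<open>h\<close> is
  integrable, as the real change of variables theorem demands.\<close>
proof (cases "(\<integral>\<^sup>+z\<in>T. ennreal (h z) \<partial>lborel) = \<infinity>")
  case False
  note [measurable] = meas
  define G where "G = from_C \<circ> g \<circ> to_C"
  define G' where "G' x = from_C \<circ> frechet_derivative g (at (to_C x)) \<circ> to_C" for x
  define S where "S = to_C -` T"
  have S_meas [measurable]: "S \<in> sets borel"
    using measurable_sets[OF borel_measurable_to_C meas(1)] by (simp add: S_def)
  have GS: "G ` S = to_C -` (g ` T)"
  proof
    show "to_C -` (g ` T) \<subseteq> G ` S"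
    proof
      fix x assume "x \<in> to_C -` (g ` T)"
      then obtain z where "z \<in> T" "to_C x = g z" by auto
      then have "x = G (from_C z)" "from_C z \<in> S"
        by (auto simp: G_def S_def) (metis from_C_to_C)
      then show "x \<in> G ` S" by blast
    qed
  qed (auto simp: G_def S_def)
  have GS_meas [measurable]: "G ` S \<in> sets borel"
    using measurable_sets[OF borel_measurable_to_C meas(2)] by (simp add: GS)
  have transfer: "(\<integral>\<^sup>+z\<in>Q. ennreal (k z) \<partial>lborel) = (\<integral>\<^sup>+x. ennreal (if x \<in> to_C -` Q then k (to_C x) else 0) \<partial>lborel)"
    if [measurable]: "Q \<in> sets borel" "k \<in> borel_measurable borel" for k :: "complex^'n \<Rightarrow> real" and Q
  proof -
    have "(\<integral>\<^sup>+z\<in>Q. ennreal (k z) \<partial>lborel) = (\<integral>\<^sup>+z\<in>Q. ennreal (k z) \<partial>distr lborel borel to_C)"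
      by (simp only: distr_to_C)
    also have "\<dots> = (\<integral>\<^sup>+x. ennreal (k (to_C x)) * indicator Q (to_C x) \<partial>lborel)"
      by (rule nn_integral_distr) measurable
    also have "\<dots> = (\<integral>\<^sup>+x. ennreal (if x \<in> to_C -` Q then k (to_C x) else 0) \<partial>lborel)"
      by (rule nn_integral_cong) (auto simp: indicator_def)
    finally show ?thesis .
  qed
  have nn: "0 \<le> (if x \<in> S then h (to_C x) else 0)" "0 \<le> (if x \<in> G ` S then f (to_C x) else 0)" for x
    using nonneg by auto
  have hS: "(\<lambda>x. if x \<in> S then h (to_C x) else 0) integrable_on UNIV"
    using False transfer[OF meas(1,4)] nn
    by (intro nn_integral_integrable_on) (auto simp: S_def[symmetric] top.not_eq_extremum)
  have eqS: "\<bar>det (matrix (G' x))\<bar> * f (to_C (G x)) = h (to_C x)" if "x \<in> S" for x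
  proof -
    have T: "to_C x \<in> T" using that by (simp add: S_def)
    have "matrix (G' x) = real_matrix (frechet_derivative g (at (to_C x)))"
      by (simp add: G'_def real_matrix_def)
    then show ?thesis
      using eq[OF T] abs_det_real_matrix[OF holo_on_vec_derivative(3)[OF hol T] nz[OF T]]
      by (simp add: G_def)
  qed
  have "(\<lambda>x. h (to_C x)) integrable_on S"
    using hS by (simp add: integrable_restrict_UNIV)
  then have int: "(\<lambda>x. \<bar>det (matrix (G' x))\<bar> * f (to_C (G x))) integrable_on S"
    by (rule integrable_eq) (simp add: eqS)
  have "(\<lambda>x. f (to_C x)) integrable_on (G ` S) \<and>
      integral (G ` S) (\<lambda>x. f (to_C x)) \<le> integral S (\<lambda>x. \<bar>det (matrix (G' x))\<bar> * f (to_C (G x)))"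
  proof (rule integral_on_image_ubound_nonneg[where f = "\<lambda>x. f (to_C x)" and g = G and g' = G', OF _ _ int])
    fix x assume "x \<in> S"
    then have T: "to_C x \<in> T" by (simp add: S_def)
    show "(G has_derivative G' x) (at x within S)"
      unfolding G_def G'_def
      by (intro diff_chain_within has_derivative_at_withinI[OF linear_imp_has_derivative]
          has_derivative_at_withinI[OF holo_on_vec_derivative(1)[OF hol T]] linear_to_C linear_from_C)
  qed (use nonneg in auto)
  then have fG: "(\<lambda>x. f (to_C x)) integrable_on (G ` S)"
    and le: "integral (G ` S) (\<lambda>x. f (to_C x)) \<le> integral S (\<lambda>x. h (to_C x))"
    using Henstock_Kurzweil_Integration.integral_cong[of S _ "\<lambda>x. h (to_C x)", OF eqS] by auto
  have "(\<integral>\<^sup>+z\<in>g ` T. ennreal (f z) \<partial>lborel) = (\<integral>\<^sup>+x. ennreal (if x \<in> G ` S then f (to_C x) else 0) \<partial>lborel)"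
    by (simp only: transfer[OF meas(2,3)] GS)
  also have "\<dots> = ennreal (integral (G ` S) (\<lambda>x. f (to_C x)))"
    using fG nn(2)
    by (intro nn_integral_has_integral_lborel) (auto simp: has_integral_restrict_UNIV)
  also have "\<dots> \<le> ennreal (integral S (\<lambda>x. h (to_C x)))"
    using le by (rule ennreal_leI)
  also have "\<dots> = (\<integral>\<^sup>+x. ennreal (if x \<in> S then h (to_C x) else 0) \<partial>lborel)"
    using \<open>(\<lambda>x. h (to_C x)) integrable_on S\<close> nn(1)
    by (intro nn_integral_has_integral_lborel[symmetric]) (auto simp: has_integral_restrict_UNIV)
  also have "\<dots> = (\<integral>\<^sup>+z\<in>T. ennreal (h z) \<partial>lborel)"
    by (simp only: transfer[OF meas(1,4)] S_def)
  finally show ?thesis .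
qed simp

section \<open>Charts and anticanonical sections\<close>

lemma C_linear_compose:
  assumes "C_linear f" "C_linear g"
  shows "matrix (g \<circ> f) = matrix g ** matrix f"
  using assms unfolding C_linear_def by (rule matrix_compose_gen)

lemma is_pullbackD:
  assumes "is_pullback A n f s t" "c \<in> A" "c' \<in> A" "p \<in> fst c" "f p \<in> fst c'"
  shows "s c' (f p) = jac c c' f p ^ n * t c p"
  by (rule assms(1)[unfolded is_pullback_def, rule_format, OF assms(2-5)])

locale atlas =
  fixes X :: "'a topology" and A :: "('a, 'n::finite) chart set"
  assumes atlas: "complex_atlas X A"
begin

lemma
  assumes c: "c \<in> A"
  shows openin_chart: "openin X (fst c)"
    and open_chart_image: "open (snd c ` fst c)"
    and homeo_chart: "homeomorphic_map (subtopology X (fst c)) (top_of_set (snd c ` fst c)) (snd c)"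
  using atlas c by (auto simp: complex_atlas_def)

lemma chart_subset: "c \<in> A \<Longrightarrow> fst c \<subseteq> topspace X"
  using openin_chart openin_subset by blast

lemma chart_point: "c \<in> A \<Longrightarrow> p \<in> fst c \<Longrightarrow> p \<in> topspace X"
  using chart_subset by blast

lemma exists_chart:
  assumes "p \<in> topspace X"
  obtains c where "c \<in> A" "p \<in> fst c"
  using assms atlas unfolding complex_atlas_def by blast

lemma inj_chart:
  assumes "c \<in> A"
  shows "inj_on (snd c) (fst c)"
  using homeomorphic_imp_injective_map[OF homeo_chart[OF assms]] chart_subset[OF assms]
  by (simp add: topspace_subtopology Int_absorb1)

lemma cinv_chart [simp]: "c \<in> A \<Longrightarrow> p \<in> fst c \<Longrightarrow> cinv c (snd c p) = p"
  unfolding cinv_def by (simp add: inj_chart)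

lemma chart_cinv [simp]: "z \<in> snd c ` fst c \<Longrightarrow> snd c (cinv c z) = z"
  unfolding cinv_def by (rule f_inv_into_f)

lemma cinv_in [simp]: "z \<in> snd c ` fst c \<Longrightarrow> cinv c z \<in> fst c"
  unfolding cinv_def by (rule inv_into_into)

lemma open_chart_image_of:
  assumes c: "c \<in> A" and W: "openin X W"
  shows "open (snd c ` (fst c \<inter> W))"
proof -
  have "openin (subtopology X (fst c)) (fst c \<inter> W)"
    using W openin_subtopology_Int2 by blast
  then have "openin (top_of_set (snd c ` fst c)) (snd c ` (fst c \<inter> W))"
    using homeomorphic_imp_open_map[OF homeo_chart[OF c]] unfolding open_map_def by blast
  then show ?thesis using open_chart_image[OF c] openin_open_trans by blast
qed

lemma openin_chart_vimage:
  assumes c: "c \<in> A" and Z: "open Z"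
  shows "openin X {p \<in> fst c. snd c p \<in> Z}"
proof -
  have "continuous_map (subtopology X (fst c)) (top_of_set (snd c ` fst c)) (snd c)"
    by (rule homeomorphic_imp_continuous_map[OF homeo_chart[OF c]])
  moreover have "openin (top_of_set (snd c ` fst c)) (snd c ` fst c \<inter> Z)"
    using Z by (rule openin_open_Int)
  ultimately have "openin (subtopology X (fst c)) {p \<in> topspace (subtopology X (fst c)). snd c p \<in> snd c ` fst c \<inter> Z}"
    unfolding continuous_map_def by blast
  moreover have "{p \<in> topspace (subtopology X (fst c)). snd c p \<in> snd c ` fst c \<inter> Z} = {p \<in> fst c. snd c p \<in> Z}"
    using chart_subset[OF c] by auto
  ultimately show ?thesis
    using openin_chart[OF c] openin_trans_full by metis
qed

text \<open>Coordinate changes are local representations of the identity. Treating the identity as a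
  holomorphic self-map puts transition functions and the action under one chain rule.\<close>

lemma holo_map_id: "holo_map X A (\<lambda>p. p)"
  using atlas unfolding holo_map_def complex_atlas_def by auto

lemma openin_holo_map_vimage:
  assumes "holo_map X A f" "openin X W"
  shows "openin X {p \<in> topspace X. f p \<in> W}"
  using assms unfolding holo_map_def continuous_map_def by blast

lemma open_local_rep_domain:
  assumes "holo_map X A f" "c \<in> A" "c' \<in> A"
  shows "open (snd c ` {p \<in> fst c. f p \<in> fst c'})"
proof -
  have "{p \<in> fst c. f p \<in> fst c'} = fst c \<inter> {p \<in> topspace X. f p \<in> fst c'}"
    using chart_subset[OF assms(2)] by auto
  then show ?thesis
    using open_chart_image_of[OF assms(2) openin_holo_map_vimage[OF assms(1) openin_chart[OF assms(3)]]] by simp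
qed

lemma local_rep_holo:
  assumes "holo_map X A f" "c \<in> A" "c' \<in> A"
  shows "holo_on (snd c ` {p \<in> fst c. f p \<in> fst c'}) (\<lambda>z. local_rep c c' f z $ j)"
  using assms unfolding holo_map_def chart_holo_def by blast

lemma
  assumes "holo_map X A f" "c \<in> A" "c' \<in> A" "p \<in> fst c" "f p \<in> fst c'"
  shows local_rep_has_derivative: "(local_rep c c' f has_derivative frechet_derivative (local_rep c c' f) (at (snd c p))) (at (snd c p))"
    and local_rep_C_linear: "C_linear (frechet_derivative (local_rep c c' f) (at (snd c p)))"
proof -
  have "snd c p \<in> snd c ` {p \<in> fst c. f p \<in> fst c'}" using assms by auto
  note D = holo_on_vec_derivative[OF local_rep_holo[OF assms(1-3)] this]
  show "(local_rep c c' f has_derivative frechet_derivative (local_rep c c' f) (at (snd c p))) (at (snd c p))"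
    "C_linear (frechet_derivative (local_rep c c' f) (at (snd c p)))"
    by (rule D(1), rule D(3))
qed

text \<open>\<open>h\<close> is a separate function that agrees with the composite on the space
  alone, because the laws of the action hold only for points of the space.\<close>

lemma jac_compose:
  assumes f: "holo_map X A f" and g: "holo_map X A g"
    and c: "c \<in> A" "c' \<in> A" "c'' \<in> A"
    and p: "p \<in> fst c" "f p \<in> fst c'" "g (f p) \<in> fst c''"
    and h: "\<And>q. q \<in> topspace X \<Longrightarrow> h q = g (f q)"
  shows "jac c c'' h p = jac c' c'' g (f p) * jac c c' f p"
proof -
  let ?F = "local_rep c c' f" and ?G = "local_rep c' c'' g"
  let ?F' = "frechet_derivative ?F (at (snd c p))" and ?G' = "frechet_derivative ?G (at (snd c' (f p)))"
  have Fp: "?F (snd c p) = snd c' (f p)" using c p by (simp add: local_rep_def)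
  have "(?G \<circ> ?F has_derivative ?G' \<circ> ?F') (at (snd c p))"
    using diff_chain_at[OF local_rep_has_derivative[OF f c(1,2) p(1,2)], of ?G ?G']
      local_rep_has_derivative[OF g c(2,3) p(2,3)] by (simp add: Fp)
  then have "(local_rep c c'' h has_derivative ?G' \<circ> ?F') (at (snd c p))"
  proof (rule has_derivative_transform_within_open)
    show "open (snd c ` {q \<in> fst c. f q \<in> fst c'})" by (rule open_local_rep_domain[OF f c(1,2)])
    show "snd c p \<in> snd c ` {q \<in> fst c. f q \<in> fst c'}" using p by auto
    fix z assume "z \<in> snd c ` {q \<in> fst c. f q \<in> fst c'}"
    then obtain q where q: "q \<in> fst c" "f q \<in> fst c'" "z = snd c q" by auto
    then show "(?G \<circ> ?F) z = local_rep c c'' h z"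
      using c chart_point[OF c(1) q(1)] by (simp add: local_rep_def h)
  qed
  then have "?G' \<circ> ?F' = frechet_derivative (local_rep c c'' h) (at (snd c p))"
    by (rule frechet_derivative_at)
  then have "jac c c'' h p = det (matrix (?G' \<circ> ?F'))" by (simp add: jac_def)
  also have "\<dots> = jac c' c'' g (f p) * jac c c' f p"
    using C_linear_compose[OF local_rep_C_linear[OF f c(1,2) p(1,2)] local_rep_C_linear[OF g c(2,3) p(2,3)]]
    by (simp add: det_mul jac_def)
  finally show ?thesis .
qed

lemma jac_id:
  assumes c: "c \<in> A" and p: "p \<in> fst c" and h: "\<And>q. q \<in> topspace X \<Longrightarrow> h q = q"
  shows "jac c c h p = 1"
proof -
  have "((\<lambda>z. z) has_derivative (\<lambda>z. z)) (at (snd c p))" by (rule has_derivative_ident)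
  then have "(local_rep c c h has_derivative (\<lambda>z. z)) (at (snd c p))"
  proof (rule has_derivative_transform_within_open[OF _ open_chart_image[OF c]])
    show "z = local_rep c c h z" if "z \<in> snd c ` fst c" for z
      using that c h[OF chart_point[OF c cinv_in[OF that]]] by (simp add: local_rep_def)
  qed (use p in auto)
  then have "(\<lambda>z. z) = frechet_derivative (local_rep c c h) (at (snd c p))"
    by (rule frechet_derivative_at)
  then have "jac c c h p = det (matrix (\<lambda>z::complex^'n. z))" by (simp add: jac_def)
  also have "matrix (\<lambda>z::complex^'n. z) = mat 1"
    by (simp add: matrix_def mat_def axis_def vec_eq_iff)
  finally show ?thesis by simp
qed

lemma jac_nonzero:
  assumes f: "holo_map X A f" and g: "holo_map X A g" and inv: "\<And>q. q \<in> topspace X \<Longrightarrow> g (f q) = q"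
    and c: "c \<in> A" "c' \<in> A" and p: "p \<in> fst c" "f p \<in> fst c'"
  shows "jac c c' f p \<noteq> 0"
proof -
  have gp: "g (f p) \<in> fst c" using p inv chart_point[OF c(1)] by simp
  have "jac c c (\<lambda>q. g (f q)) p = jac c' c g (f p) * jac c c' f p"
    by (rule jac_compose[OF f g c(1,2,1) p gp]) simp
  moreover have "jac c c (\<lambda>q. g (f q)) p = 1"
    by (rule jac_id[OF c(1) p(1) inv])
  ultimately show ?thesis by auto
qed

lemma transition_nonzero:
  assumes "c \<in> A" "c' \<in> A" "p \<in> fst c" "p \<in> fst c'"
  shows "jac c c' (\<lambda>q. q) p \<noteq> 0"
  by (rule jac_nonzero[OF holo_map_id holo_map_id _ assms]) simp

lemma section_transition:
  assumes "s \<in> antican_sections A m" "c \<in> A" "c' \<in> A" "p \<in> fst c" "p \<in> fst c'"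
  shows "s c' p = jac c c' (\<lambda>q. q) p ^ m * s c p"
proof -
  have "is_pullback A m (\<lambda>q. q) s s" using assms(1) by (simp add: antican_sections_def)
  then show ?thesis by (rule is_pullbackD[where f = "\<lambda>q. q", OF _ assms(2-5)])
qed

lemma section_zero_iff:
  assumes "s \<in> antican_sections A m" "c \<in> A" "c' \<in> A" "p \<in> fst c" "p \<in> fst c'"
  shows "s c' p = 0 \<longleftrightarrow> s c p = 0"
  using section_transition[OF assms] transition_nonzero[OF assms(2-5)] by simp

lemma section_holo:
  assumes "s \<in> antican_sections A m" "c \<in> A"
  shows "holo_on (snd c ` fst c) (\<lambda>z. s c (cinv c z))"
  using assms by (simp add: antican_sections_def)

lemma section_outside:
  assumes "s \<in> antican_sections A m" "c \<notin> A \<or> p \<notin> fst c"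
  shows "s c p = 0"
proof -
  have "\<forall>c p. c \<notin> A \<or> p \<notin> fst c \<longrightarrow> s c p = 0" using assms(1) by (simp add: antican_sections_def)
  then show ?thesis using assms(2) by blast
qed

lemma section_scale:
  assumes "s \<in> antican_sections A m"
  shows "sec_scale a s \<in> antican_sections A m"
proof -
  have "is_pullback A m (\<lambda>p. p) (sec_scale a s) (sec_scale a s)"
    unfolding is_pullback_def sec_scale_def
  proof (intro ballI impI)
    fix c c' p assume "c \<in> A" "c' \<in> A" "p \<in> fst c" "p \<in> fst c'"
    from section_transition[OF assms this]
    show "a * s c' p = jac c c' (\<lambda>p. p) p ^ m * (a * s c p)" by simp
  qed
  moreover have "holo_on (snd c ` fst c) (\<lambda>z. sec_scale a s c (cinv c z))" if "c \<in> A" for c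
    unfolding sec_scale_def by (intro holo_on_mult holo_on_const section_holo[OF assms that])
  moreover have "sec_scale a s c p = 0" if "c \<notin> A \<or> p \<notin> fst c" for c p
    unfolding sec_scale_def using section_outside[OF assms that] by simp
  ultimately show ?thesis by (simp add: antican_sections_def)
qed

text \<open>The interior of the zero set of a section is closed, by the identity theorem on a ball in a chart.\<close>

lemma section_identity:
  assumes conn: "connected_space X" and s: "s \<in> antican_sections A m"
    and W: "openin X W" "W \<noteq> {}" "\<And>c p. c \<in> A \<Longrightarrow> p \<in> fst c \<Longrightarrow> p \<in> W \<Longrightarrow> s c p = 0"
  shows "s = 0"
proof -
  define Z where "Z = X interior_of {p \<in> topspace X. \<forall>c\<in>A. p \<in> fst c \<longrightarrow> s c p = 0}"
  have opZ: "openin X Z" by (simp add: Z_def)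
  have sZ: "s c p = 0" if "p \<in> Z" "c \<in> A" "p \<in> fst c" for c p
    using that interior_of_subset[of X] unfolding Z_def by blast
  have ZI: "p \<in> Z" if "openin X T" "p \<in> T" "\<And>c q. c \<in> A \<Longrightarrow> q \<in> T \<Longrightarrow> q \<in> fst c \<Longrightarrow> s c q = 0" for p T
  proof -
    have "T \<subseteq> {p \<in> topspace X. \<forall>c\<in>A. p \<in> fst c \<longrightarrow> s c p = 0}"
      using that openin_subset[OF that(1)] by auto
    then show ?thesis unfolding Z_def using that(1,2) interior_of_maximal by blast
  qed
  have "W \<subseteq> Z" using ZI[OF W(1)] W(3) by blast
  then have ne: "Z \<noteq> {}" using W(2) by auto
  have "closedin X Z"
  proof -
    have "X closure_of Z \<subseteq> Z"
    proof
      fix p assume p: "p \<in> X closure_of Z"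
      then have "p \<in> topspace X" by (meson in_closure_of)
      then obtain c where c: "c \<in> A" "p \<in> fst c" by (rule exists_chart)
      obtain r where r: "r > 0" "ball (snd c p) r \<subseteq> snd c ` fst c"
        using open_chart_image[OF c(1)] c(2) by (meson imageI openE)
      let ?B = "ball (snd c p) r"
      let ?T = "{q \<in> fst c. snd c q \<in> ?B}"
      have T: "openin X ?T" "p \<in> ?T" using openin_chart_vimage[OF c(1) open_ball] c r by auto
      then obtain q where q: "q \<in> Z" "q \<in> ?T"
        using p by (meson in_closure_of)
      let ?V = "snd c ` (fst c \<inter> Z)"
      have V: "open ?V" by (rule open_chart_image_of[OF c(1) opZ])
      have zero: "s c (cinv c z) = 0" if "z \<in> ?B" for z
      proof (rule holo_on_ball_eq_0[of "snd c p" r "\<lambda>z. s c (cinv c z)" ?V "snd c q" z])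
        show "holo_on ?B (\<lambda>z. s c (cinv c z))"
          by (rule holo_on_subset[OF section_holo[OF s c(1)] r(2)])
        show "s c (cinv c z) = 0" if V: "z \<in> ?V" for z
        proof -
          obtain x where x: "z = snd c x" "x \<in> fst c" "x \<in> Z" using V by blast
          then show ?thesis using sZ[OF x(3) c(1) x(2)] c(1) by simp
        qed
        show "snd c q \<in> ?V" using q by blast
        show "snd c q \<in> ?B" using q by blast
      qed (rule V, rule that)
      have "s c' q' = 0" if "c' \<in> A" "q' \<in> ?T" "q' \<in> fst c'" for c' q'
      proof -
        have q': "q' \<in> fst c" "snd c q' \<in> ?B" using that(2) by blast+
        have "s c q' = 0" using zero[OF q'(2)] c(1) q'(1) by simp
        then show ?thesis using section_zero_iff[OF s c(1) that(1) q'(1) that(3)] by simp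
      qed
      then show "p \<in> Z" by (rule ZI[OF T])
    qed
    then show ?thesis using closure_of_eq[of X Z] closure_of_subset[OF openin_subset[OF opZ]] by blast
  qed
  then have Z: "Z = topspace X"
    using conn opZ ne unfolding connected_space_clopen_in by blast
  have "s c p = 0" for c p
    by (metis Z chart_point sZ section_outside[OF s])
  then show ?thesis by (simp add: fun_eq_iff)
qed

end

section \<open>Weight decomposition for an action of the multiplicative group\<close>

definition join :: "complex \<Rightarrow> complex^'n::finite \<Rightarrow> complex^('n option)" where
  "join t z = (\<chi> i. case i of None \<Rightarrow> t | Some j \<Rightarrow> z $ j)"

definition space_part :: "complex^('n::finite option) \<Rightarrow> complex^'n" where
  "space_part w = (\<chi> j. w $ Some j)"

lemma join_nth [simp]: "join t z $ None = t" "join t z $ Some j = z $ j"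
  by (simp_all add: join_def)

lemma space_part_nth [simp]: "space_part w $ j = w $ Some j"
  by (simp add: space_part_def)

lemma space_part_join [simp]: "space_part (join t z) = z"
  by (simp add: vec_eq_iff)

lemma join_space_part [simp]: "join (w $ None) (space_part w) = w"
  by (auto simp: vec_eq_iff join_def split: option.splits)

lemma continuous_on_join [continuous_intros]:
  assumes "continuous_on S f" "continuous_on S g"
  shows "continuous_on S (\<lambda>x. join (f x) (g x))"
  unfolding join_def
proof (rule continuous_on_vec_lambda)
  show "continuous_on S (\<lambda>x. case i of None \<Rightarrow> f x | Some j \<Rightarrow> g x $ j)" for i
    by (cases i) (auto intro!: continuous_intros assms)
qed

lemma holo_on_join: "holo_on S (\<lambda>z. join t z $ i)"
  by (cases i) (auto intro: holo_on_const holo_on_vec_nth)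

lemma continuous_on_space_part: "continuous_on S space_part"
  unfolding space_part_def by (intro continuous_intros)

text \<open>Moving the group parameter is moving along a complex line in the product, so holomorphy
  in \<open>t\<close> becomes a case of \<open>holo_on_line\<close>.\<close>

lemma join_line: "join t z = join 0 z + t *s axis None 1"
  by (auto simp: vec_eq_iff join_def axis_def split: option.splits)

lemma join_has_derivative: "(join t has_derivative join 0) (at z within S)"
proof -
  have lin: "linear (join 0 :: complex^'n::finite \<Rightarrow> _)"
    by (rule linearI) (auto simp: vec_eq_iff join_def split: option.splits)
  have "join t z = join t 0 + join 0 z" for z :: "complex^'n::finite"
    by (auto simp: vec_eq_iff join_def split: option.splits)
  then have eq: "join t = (\<lambda>z :: complex^'n::finite. join t 0 + join 0 z)" by (rule ext)
  show ?thesis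
    by (subst eq) (auto intro!: derivative_eq_intros linear_imp_has_derivative[OF lin])
qed

text \<open>The action is recorded pointwise on the space, with joint continuity in terms of
  neighbourhoods; this is the form in which the compact-open topology enters.
  \<open>\<rho> 0\<close> is an arbitrary value and is excluded throughout.\<close>

locale cstar_action = atlas X A for X :: "'a topology" and A :: "('a, 'n::finite) chart set" +
  fixes \<rho> :: "complex \<Rightarrow> 'a \<Rightarrow> 'a"
  assumes act_holo_map: "\<And>t. t \<noteq> 0 \<Longrightarrow> holo_map X A (\<rho> t)"
    and act_mult: "\<And>t u p. t \<noteq> 0 \<Longrightarrow> u \<noteq> 0 \<Longrightarrow> p \<in> topspace X \<Longrightarrow> \<rho> t (\<rho> u p) = \<rho> (t * u) p"
    and act_one: "\<And>p. p \<in> topspace X \<Longrightarrow> \<rho> 1 p = p"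
    and act_cont: "\<And>t p U. t \<noteq> 0 \<Longrightarrow> p \<in> topspace X \<Longrightarrow> openin X U \<Longrightarrow> \<rho> t p \<in> U \<Longrightarrow>
      \<exists>T W. open T \<and> t \<in> T \<and> openin X W \<and> p \<in> W \<and> (\<forall>u\<in>T. \<forall>q\<in>W. u \<noteq> 0 \<longrightarrow> \<rho> u q \<in> U)"
    and act_holo: "holo_action A \<rho>"
begin

lemma act_in: "t \<noteq> 0 \<Longrightarrow> p \<in> topspace X \<Longrightarrow> \<rho> t p \<in> topspace X"
  using act_holo_map unfolding holo_map_def continuous_map_def by blast

definition act_domain :: "('a, 'n) chart \<Rightarrow> ('a, 'n) chart \<Rightarrow> (complex^('n option)) set" where
  "act_domain c c' = {w. w $ None \<noteq> 0 \<and> space_part w \<in> snd c ` fst c \<and>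
     \<rho> (w $ None) (cinv c (space_part w)) \<in> fst c'}"

lemma act_domainD:
  assumes "w \<in> act_domain c c'" "c \<in> A"
  shows "w $ None \<noteq> 0" "space_part w \<in> snd c ` fst c" "cinv c (space_part w) \<in> fst c"
    "cinv c (space_part w) \<in> topspace X" "\<rho> (w $ None) (cinv c (space_part w)) \<in> fst c'"
proof -
  show 1: "w $ None \<noteq> 0" "space_part w \<in> snd c ` fst c" "\<rho> (w $ None) (cinv c (space_part w)) \<in> fst c'"
    using assms(1) unfolding act_domain_def by blast+
  show 2: "cinv c (space_part w) \<in> fst c" by (rule cinv_in[OF 1(2)])
  show "cinv c (space_part w) \<in> topspace X" by (rule chart_point[OF assms(2) 2])
qed

lemma open_None_space_part:
  assumes "open T" "open Z"
  shows "open {w :: complex^('n option). w $ None \<in> T \<and> space_part w \<in> Z}"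
proof -
  have "{w :: complex^('n option). w $ None \<in> T \<and> space_part w \<in> Z} = (\<lambda>w. w $ None) -` T \<inter> space_part -` Z"
    by auto
  then show ?thesis
    using assms by (auto intro!: open_Int open_vimage continuous_on_space_part continuous_intros)
qed

lemma open_act_domain:
  assumes c: "c \<in> A" "c' \<in> A"
  shows "open (act_domain c c')"
proof (subst open_subopen, intro ballI)
  fix w assume w: "w \<in> act_domain c c'"
  note D = act_domainD[OF w c(1)]
  obtain T W where TW: "open T" "w $ None \<in> T" "openin X W" "cinv c (space_part w) \<in> W"
    "\<And>u q. u \<in> T \<Longrightarrow> q \<in> W \<Longrightarrow> u \<noteq> 0 \<Longrightarrow> \<rho> u q \<in> fst c'"
    using act_cont[OF D(1,4) openin_chart[OF c(2)] D(5)] by blast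
  let ?Z = "snd c ` (fst c \<inter> W)"
  let ?N = "{w. w $ None \<in> T - {0} \<and> space_part w \<in> ?Z}"
  have "open ?N"
    by (intro open_None_space_part open_chart_image_of[OF c(1) TW(3)] open_delete TW(1))
  moreover have "space_part w \<in> ?Z"
    using D(2,3) TW(4) by (intro image_eqI[of _ _ "cinv c (space_part w)"]) simp_all
  then have "w \<in> ?N" using D(1) TW(2) by simp
  moreover have "?N \<subseteq> act_domain c c'"
  proof
    fix v assume v: "v \<in> ?N"
    then obtain q where q: "q \<in> fst c" "q \<in> W" "space_part v = snd c q" by blast
    then show "v \<in> act_domain c c'"
      using v TW(5)[of "v $ None" q] c(1) by (simp add: act_domain_def)
  qed
  ultimately show "\<exists>T. open T \<and> w \<in> T \<and> T \<subseteq> act_domain c c'" by blast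
qed

lemma act_local_rep_holo:
  assumes "c \<in> A" "c' \<in> A"
  shows "holo_on (act_domain c c') (\<lambda>w. local_rep c c' (\<rho> (w $ None)) (space_part w) $ k)"
proof -
  have "\<forall>c\<in>A. \<forall>c'\<in>A. \<forall>k. holo_on (act_domain c c') (\<lambda>w. local_rep c c' (\<rho> (w $ None)) (space_part w) $ k)"
    using act_holo unfolding holo_action_def act_domain_def space_part_def .
  then show ?thesis using assms by blast
qed

text \<open>The Jacobian of a single \<open>\<rho> t\<close> becomes a determinant of partial
  derivatives of the joint map in \<open>(t, z)\<close>, taken in the space directions
  \<open>Some k\<close>, so that joint holomorphy passes to the Jacobian.\<close>

lemma act_jac_eq:
  assumes c: "c \<in> A" "c' \<in> A" and w: "w \<in> act_domain c c'"
  shows "jac c c' (\<rho> (w $ None)) (cinv c (space_part w)) =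
    det (\<chi> i k. frechet_derivative (\<lambda>w. local_rep c c' (\<rho> (w $ None)) (space_part w) $ i) (at w) (axis (Some k) 1))"
proof -
  note D = act_domainD[OF w c(1)]
  let ?t = "w $ None" and ?z = "space_part w"
  let ?L = "local_rep c c' (\<rho> ?t)"
  let ?F = "\<lambda>i w. local_rep c c' (\<rho> (w $ None)) (space_part w) $ i"
  have "?z \<in> snd c ` {p \<in> fst c. \<rho> ?t p \<in> fst c'}"
    using D by (intro image_eqI[of _ _ "cinv c ?z"]) simp_all
  note L = holo_on_vec_derivative[OF local_rep_holo[OF act_holo_map[OF D(1)] c] this]
  have "frechet_derivative ?L (at ?z) (axis k 1) $ i = frechet_derivative (?F i) (at w) (axis (Some k) 1)" for i k
  proof -
    have "((\<lambda>z. ?F i (join ?t z)) has_derivative (\<lambda>v. frechet_derivative (?F i) (at w) (join 0 v))) (at ?z)"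
      by (rule has_derivative_compose[OF join_has_derivative])
        (simp add: holo_onD(1)[OF act_local_rep_holo[OF c] w])
    then have "((\<lambda>z. ?L z $ i) has_derivative (\<lambda>v. frechet_derivative (?F i) (at w) (join 0 v))) (at ?z)"
      by simp
    then have "(\<lambda>v. frechet_derivative (?F i) (at w) (join 0 v)) = frechet_derivative (\<lambda>z. ?L z $ i) (at ?z)"
      by (rule frechet_derivative_at)
    then have "frechet_derivative ?L (at ?z) (axis k 1) $ i = frechet_derivative (?F i) (at w) (join 0 (axis k 1))"
      unfolding L(2) by (simp add: fun_eq_iff)
    also have "join 0 (axis k 1) = (axis (Some k) 1 :: complex^('n option))"
      by (auto simp: vec_eq_iff join_def axis_def split: option.splits)
    finally show ?thesis .
  qed
  then have "matrix (frechet_derivative ?L (at ?z)) =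
      (\<chi> i k. frechet_derivative (?F i) (at w) (axis (Some k) 1))"
    by (simp add: matrix_def vec_eq_iff)
  then show ?thesis
    unfolding jac_def chart_cinv[OF D(2)] by simp
qed

lemma act_jac_holo:
  assumes c: "c \<in> A" "c' \<in> A"
  shows "holo_on (act_domain c c') (\<lambda>w. jac c c' (\<rho> (w $ None)) (cinv c (space_part w)))"
proof (rule holo_on_transform[OF _ open_act_domain[OF c]])
  show "holo_on (act_domain c c') (\<lambda>w. det (\<chi> i k. frechet_derivative
      (\<lambda>w. local_rep c c' (\<rho> (w $ None)) (space_part w) $ i) (at w) (axis (Some k) 1)))"
    by (rule holo_on_det) (simp add: holo_on_directional_derivative open_act_domain c act_local_rep_holo)
qed (rule act_jac_eq[OF c, symmetric])

lemma act_jac_nonzero: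
  assumes t: "t \<noteq> 0" and c: "c \<in> A" "c' \<in> A" and p: "p \<in> fst c" "\<rho> t p \<in> fst c'"
  shows "jac c c' (\<rho> t) p \<noteq> 0"
proof (rule jac_nonzero[OF act_holo_map[OF t] act_holo_map[of "inverse t"] _ c p])
  show "\<rho> (inverse t) (\<rho> t q) = q" if "q \<in> topspace X" for q
    using t that by (simp add: act_mult act_one)
qed (use t in simp)

lemma act_jac_mult:
  assumes "t \<noteq> 0" "u \<noteq> 0" "c \<in> A" "c' \<in> A" "c'' \<in> A" "p \<in> fst c" "\<rho> u p \<in> fst c'" "\<rho> t (\<rho> u p) \<in> fst c''"
  shows "jac c c'' (\<rho> (t * u)) p = jac c' c'' (\<rho> t) (\<rho> u p) * jac c c' (\<rho> u) p"
  by (rule jac_compose[OF act_holo_map[OF assms(2)] act_holo_map[OF assms(1)] assms(3-8)])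
    (simp add: act_mult assms)

lemma act_jac_chart:
  assumes "t \<noteq> 0" "c \<in> A" "c' \<in> A" "d \<in> A" "p \<in> fst c" "p \<in> fst c'" "\<rho> t p \<in> fst d"
  shows "jac c d (\<rho> t) p = jac c' d (\<rho> t) p * jac c c' (\<lambda>q. q) p"
  by (rule jac_compose[OF holo_map_id act_holo_map[OF assms(1)] assms(2-7)]) simp

section \<open>Pullback of sections along the action\<close>

definition pull :: "nat \<Rightarrow> ('a, 'n) antican_sec \<Rightarrow> complex \<Rightarrow> ('a, 'n) antican_sec" where
  "pull m s t c p = (let d = SOME d. d \<in> A \<and> \<rho> t p \<in> fst d in s d (\<rho> t p) / jac c d (\<rho> t) p ^ m)"

text \<open>The target chart chosen inside \<open>pull\<close> does not matter: a change of chart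
  multiplies numerator and denominator by the same \<open>m\<close>-th power.\<close>

lemma pull_eq:
  assumes s: "s \<in> antican_sections A m" and t: "t \<noteq> 0" and c: "c \<in> A" "c' \<in> A"
    and p: "p \<in> fst c" "\<rho> t p \<in> fst c'"
  shows "pull m s t c p = s c' (\<rho> t p) / jac c c' (\<rho> t) p ^ m"
proof -
  define d where "d = (SOME d. d \<in> A \<and> \<rho> t p \<in> fst d)"
  have "d \<in> A \<and> \<rho> t p \<in> fst d" unfolding d_def by (rule someI) (use c p in blast)
  then have d: "d \<in> A" "\<rho> t p \<in> fst d" by auto
  have "jac c d (\<rho> t) p = jac c' d (\<lambda>q. q) (\<rho> t p) * jac c c' (\<rho> t) p"
    by (rule jac_compose[OF act_holo_map[OF t] holo_map_id c d(1) p d(2)]) simp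
  moreover have "s d (\<rho> t p) = jac c' d (\<lambda>q. q) (\<rho> t p) ^ m * s c' (\<rho> t p)"
    by (rule section_transition[OF s c(2) d(1) p(2) d(2)])
  moreover have "jac c' d (\<lambda>q. q) (\<rho> t p) \<noteq> 0"
    by (rule transition_nonzero[OF c(2) d(1) p(2) d(2)])
  ultimately show ?thesis
    unfolding pull_def Let_def d_def[symmetric] by (simp add: power_mult_distrib)
qed

lemma pull_one:
  assumes s: "s \<in> antican_sections A m" and c: "c \<in> A" and p: "p \<in> fst c"
  shows "pull m s 1 c p = s c p"
proof -
  have 1: "\<rho> 1 p = p" by (rule act_one[OF chart_point[OF c p]])
  then show ?thesis
    using pull_eq[OF s _ c c p, of 1] jac_id[OF c p act_one] p by simp
qed

lemma pull_chart:
  assumes s: "s \<in> antican_sections A m" and t: "t \<noteq> 0" and c: "c \<in> A" "c' \<in> A"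
    and p: "p \<in> fst c" "p \<in> fst c'"
  shows "pull m s t c' p = jac c c' (\<lambda>q. q) p ^ m * pull m s t c p"
proof -
  obtain d where d: "d \<in> A" "\<rho> t p \<in> fst d"
    by (rule exists_chart[OF act_in[OF t chart_point[OF c(1) p(1)]]])
  show ?thesis
    using transition_nonzero[OF c p]
    by (simp add: pull_eq[OF s t c(1) d(1) p(1) d(2)] pull_eq[OF s t c(2) d(1) p(2) d(2)]
        act_jac_chart[OF t c d(1) p d(2)] power_mult_distrib)
qed

text \<open>Pulling back along \<open>\<rho> t\<close> and then along \<open>\<rho> u\<close> is
  pulling back along \<open>\<rho> (t * u)\<close>; the Jacobian power is the outer pullback in
  terms of coefficients.\<close>

lemma pull_mult:
  assumes s: "s \<in> antican_sections A m" and t: "t \<noteq> 0" "u \<noteq> 0" and c: "c \<in> A" "c' \<in> A"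
    and p: "p \<in> fst c" "\<rho> u p \<in> fst c'"
  shows "pull m s t c' (\<rho> u p) = jac c c' (\<rho> u) p ^ m * pull m s (t * u) c p"
proof -
  have pX: "p \<in> topspace X" by (rule chart_point[OF c(1) p(1)])
  have eq: "\<rho> t (\<rho> u p) = \<rho> (t * u) p" by (rule act_mult[OF t pX])
  have tu: "t * u \<noteq> 0" using t by simp
  obtain d where d: "d \<in> A" "\<rho> (t * u) p \<in> fst d"
    by (rule exists_chart[OF act_in[OF tu pX]])
  then have d': "\<rho> t (\<rho> u p) \<in> fst d" by (simp add: eq)
  show ?thesis
    using act_jac_nonzero[OF t(2) c p]
    by (simp add: pull_eq[OF s t(1) c(2) d(1) p(2) d'] pull_eq[OF s tu c(1) d(1) p(1) d(2)]
        act_jac_mult[OF t c d(1) p d'] power_mult_distrib eq)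
qed

lemma pull_holo:
  assumes s: "s \<in> antican_sections A m" and c: "c \<in> A"
  shows "holo_on {w. w $ None \<noteq> 0 \<and> space_part w \<in> snd c ` fst c}
    (\<lambda>w. pull m s (w $ None) c (cinv c (space_part w)))"
proof (rule holo_on_open_cover)
  fix w :: "complex^('n option)" assume "w \<in> {w. w $ None \<noteq> 0 \<and> space_part w \<in> snd c ` fst c}"
  then have w: "w $ None \<noteq> 0" "space_part w \<in> snd c ` fst c" by blast+
  obtain d where d: "d \<in> A" "\<rho> (w $ None) (cinv c (space_part w)) \<in> fst d"
    by (rule exists_chart[OF act_in[OF w(1) chart_point[OF c cinv_in[OF w(2)]]]])
  \<comment> \<open>Near \<open>w\<close> one target chart \<open>d\<close> serves all points, which
    frees the quotient from the choice inside \<open>pull\<close>.\<close>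
  have "holo_on (act_domain c d) (\<lambda>w. (\<lambda>z. s d (cinv d z)) (local_rep c d (\<rho> (w $ None)) (space_part w))
      / jac c d (\<rho> (w $ None)) (cinv c (space_part w)) ^ m)"
  proof (intro holo_on_divide holo_on_power act_jac_holo[OF c d(1)] holo_on_compose[OF section_holo[OF s d(1)]]
      act_local_rep_holo[OF c d(1)])
    show "(\<lambda>w. local_rep c d (\<rho> (w $ None)) (space_part w)) ` act_domain c d \<subseteq> snd d ` fst d"
    proof (rule image_subsetI)
      fix w assume w: "w \<in> act_domain c d"
      show "local_rep c d (\<rho> (w $ None)) (space_part w) \<in> snd d ` fst d"
        unfolding local_rep_def using act_domainD(5)[OF w c] by (rule imageI)
    qed
    show "jac c d (\<rho> (w $ None)) (cinv c (space_part w)) ^ m \<noteq> 0" if "w \<in> act_domain c d" for w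
      using act_jac_nonzero[OF act_domainD(1)[OF that c] c d(1) act_domainD(3,5)[OF that c]] by simp
  qed
  then have "holo_on (act_domain c d) (\<lambda>w. pull m s (w $ None) c (cinv c (space_part w)))"
  proof (rule holo_on_transform[OF _ open_act_domain[OF c d(1)]])
    fix w assume w: "w \<in> act_domain c d"
    note D = act_domainD[OF w c]
    show "(\<lambda>z. s d (cinv d z)) (local_rep c d (\<rho> (w $ None)) (space_part w))
      / jac c d (\<rho> (w $ None)) (cinv c (space_part w)) ^ m = pull m s (w $ None) c (cinv c (space_part w))"
      unfolding pull_eq[OF s D(1) c d(1) D(3,5)] local_rep_def
      by (simp add: cinv_chart[OF d(1) D(5)])
  qed
  moreover have "w \<in> act_domain c d" using w d by (simp add: act_domain_def)
  ultimately show "\<exists>U. w \<in> U \<and> holo_on U (\<lambda>w. pull m s (w $ None) c (cinv c (space_part w)))"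
    by blast
qed

lemma pull_holomorphic:
  assumes s: "s \<in> antican_sections A m" and c: "c \<in> A" and p: "p \<in> fst c"
  shows "(\<lambda>t. pull m s t c p) holomorphic_on - {0}"
proof -
  have "(\<lambda>t. (\<lambda>w. pull m s (w $ None) c (cinv c (space_part w))) (join 0 (snd c p) + t *s axis None 1))
      holomorphic_on - {0}"
    by (rule holo_on_line[OF pull_holo[OF s c]]) (use p in \<open>simp add: join_line[symmetric]\<close>)
  then show ?thesis
    using c p by (simp add: join_line[symmetric])
qed

text \<open>The Laurent coefficient of index \<open>k\<close> of the pullback as a function of the
  group parameter: the projection to weight \<open>k\<close>. The case distinction supplies the zero
  values that \<open>antican_sections\<close> prescribes outside the charts.\<close>

definition weight_part :: "nat \<Rightarrow> ('a, 'n) antican_sec \<Rightarrow> int \<Rightarrow> ('a, 'n) antican_sec" where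
  "weight_part m s k c p =
     (if c \<in> A \<and> p \<in> fst c then circle_mean (\<lambda>t. pull m s t c p * t powi (- k)) 1 else 0)"

text \<open>Pulling back along \<open>\<rho> u\<close> replaces \<open>t\<close> by
  \<open>u * t\<close>, that is, the unit circle by the circle through \<open>u\<close>. Since the
  mean does not depend on the radius, all that remains is the factor \<open>u powi k\<close> which
  compensates the monomial \<open>t powi (- k)\<close>.\<close>

lemma weight_part_transform:
  assumes s: "s \<in> antican_sections A m" and u: "u \<noteq> 0" and c: "c \<in> A" "c' \<in> A"
    and p: "p \<in> fst c" "\<rho> u p \<in> fst c'"
  shows "weight_part m s k c' (\<rho> u p) = jac c c' (\<rho> u) p ^ m * (u powi k * weight_part m s k c p)"
proof -
  have "circle_mean (\<lambda>t. pull m s t c' (\<rho> u p) * t powi (- k)) 1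
      = circle_mean (\<lambda>t. jac c c' (\<rho> u) p ^ m * u powi k * (pull m s (u * t) c p * (u * t) powi (- k))) 1"
    unfolding circle_mean_def
  proof (rule integral_cong)
    fix \<theta> :: real
    let ?t = "1 * cis (2 * pi * \<theta>)"
    have t: "?t \<noteq> 0" by simp
    have "u powi k * (u * ?t) powi (- k) = ?t powi (- k)"
      using u by (simp add: power_int_mult_distrib power_int_minus)
    then show "pull m s ?t c' (\<rho> u p) * ?t powi (- k) =
        jac c c' (\<rho> u) p ^ m * u powi k * (pull m s (u * ?t) c p * (u * ?t) powi (- k))"
      unfolding pull_mult[OF s t u c p] by (simp add: mult.commute mult.left_commute)
  qed
  also have "\<dots> = jac c c' (\<rho> u) p ^ m * u powi k * circle_mean (\<lambda>t. pull m s t c p * t powi (- k)) u"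
    by (simp only: circle_mean_mult_left) (simp add: circle_mean_def)
  also have "circle_mean (\<lambda>t. pull m s t c p * t powi (- k)) u = circle_mean (\<lambda>t. pull m s t c p * t powi (- k)) 1"
    by (rule circle_mean_eq[OF _ u]) (intro holomorphic_intros pull_holomorphic[OF s c(1) p(1)], simp)
  finally show ?thesis
    using c p by (simp add: weight_part_def)
qed

lemma weight_part_section:
  assumes s: "s \<in> antican_sections A m"
  shows "weight_part m s k \<in> antican_sections A m"
proof -
  have holo: "holo_on (snd c ` fst c) (\<lambda>z. weight_part m s k c (cinv c z))" if c: "c \<in> A" for c
  proof -
    let ?e = "\<lambda>\<theta>. cis (2 * pi * \<theta>)"
    let ?Q = "\<lambda>w. pull m s (w $ None) c (cinv c (space_part w))"
    have "holo_on (snd c ` fst c) (\<lambda>z. integral {0..1} (\<lambda>\<theta>. ?Q (join (?e \<theta>) z) * ?e \<theta> powi (- k)))"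
    proof (rule holo_on_integral[OF open_chart_image[OF c]])
      have "continuous_on (snd c ` fst c \<times> {0..1}) (\<lambda>q. ?Q (join (?e (snd q)) (fst q)) * ?e (snd q) powi (- k))"
      proof (intro continuous_intros)
        show "continuous_on (snd c ` fst c \<times> {0..1}) (\<lambda>q. ?Q (join (?e (snd q)) (fst q)))"
          by (rule continuous_on_compose2[OF holo_on_imp_continuous_on[OF pull_holo[OF s c]]])
            (auto intro!: continuous_intros)
      qed simp
      then show "continuous_on (snd c ` fst c \<times> {0..1}) (\<lambda>(z, \<theta>). ?Q (join (?e \<theta>) z) * ?e \<theta> powi (- k))"
        by (simp add: case_prod_unfold)
      show "holo_on (snd c ` fst c) (\<lambda>z. ?Q (join (?e \<theta>) z) * ?e \<theta> powi (- k))" for \<theta>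
        by (intro holo_on_mult holo_on_const holo_on_compose[OF pull_holo[OF s c]] holo_on_join) auto
    qed
    then show ?thesis
      by (rule holo_on_transform[OF _ open_chart_image[OF c]])
        (simp add: weight_part_def circle_mean_def c)
  qed
  have "is_pullback A m (\<lambda>p. p) (weight_part m s k) (weight_part m s k)"
    unfolding is_pullback_def
  proof (intro ballI impI)
    fix c c' p assume c: "c \<in> A" "c' \<in> A" "p \<in> fst c" "p \<in> fst c'"
    have "circle_mean (\<lambda>t. pull m s t c' p * t powi (- k)) 1
        = circle_mean (\<lambda>t. jac c c' (\<lambda>q. q) p ^ m * (pull m s t c p * t powi (- k))) 1"
      unfolding circle_mean_def
    proof (rule integral_cong)
      fix \<theta> :: real
      have "1 * cis (2 * pi * \<theta>) \<noteq> 0" by simp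
      from pull_chart[OF s this c]
      show "pull m s (1 * cis (2 * pi * \<theta>)) c' p * (1 * cis (2 * pi * \<theta>)) powi (- k) =
        jac c c' (\<lambda>q. q) p ^ m * (pull m s (1 * cis (2 * pi * \<theta>)) c p * (1 * cis (2 * pi * \<theta>)) powi (- k))"
        by simp
    qed
    then show "weight_part m s k c' p = jac c c' (\<lambda>p. p) p ^ m * weight_part m s k c p"
      using c by (simp add: weight_part_def circle_mean_mult_left)
  qed
  moreover have "\<forall>c p. c \<notin> A \<or> p \<notin> fst c \<longrightarrow> weight_part m s k c p = 0"
    by (simp add: weight_part_def)
  ultimately show ?thesis
    using holo by (simp add: antican_sections_def)
qed

text \<open>The zero section qualifies for every weight, so non-vanishing is stated separately where
  the weight has to be meaningful.\<close>

definition semi_invariant :: "nat \<Rightarrow> int \<Rightarrow> ('a, 'n) antican_sec \<Rightarrow> bool" where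
  "semi_invariant m k s \<longleftrightarrow> s \<in> antican_sections A m \<and>
     (\<forall>t. t \<noteq> 0 \<longrightarrow> is_pullback A m (\<rho> t) s (sec_scale (t powi k) s))"

lemma semi_invariantD:
  assumes "semi_invariant m k s" "t \<noteq> 0" "c \<in> A" "c' \<in> A" "p \<in> fst c" "\<rho> t p \<in> fst c'"
  shows "s c' (\<rho> t p) = jac c c' (\<rho> t) p ^ m * (t powi k * s c p)"
proof -
  have "is_pullback A m (\<rho> t) s (sec_scale (t powi k) s)"
    using assms(1,2) unfolding semi_invariant_def by blast
  from is_pullbackD[where f = "\<rho> t", OF this assms(3-6)] show ?thesis by (simp add: sec_scale_def)
qed

lemma semi_invariant_weight_part:
  assumes "s \<in> antican_sections A m"
  shows "semi_invariant m k (weight_part m s k)"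
  unfolding semi_invariant_def is_pullback_def sec_scale_def
  by (intro conjI allI ballI impI weight_part_section[OF assms] weight_part_transform[OF assms])

text \<open>If all weight parts vanished at \<open>p\<close>, uniqueness of Laurent coefficients
  would make the pullbacks vanish at \<open>p\<close> for every parameter, in particular for 1,
  where the pullback is \<open>s\<close> itself.\<close>

lemma exists_weight_part_nonzero:
  assumes s: "s \<in> antican_sections A m" and c: "c \<in> A" and p: "p \<in> fst c" and nz: "s c p \<noteq> 0"
  obtains k where "weight_part m s k c p \<noteq> 0"
proof (rule ccontr)
  assume "\<not> thesis"
  \<comment> \<open>\<open>laurent_unique\<close> tests against \<open>t powi k\<close>, which picks
    out weight \<open>- k\<close>.\<close>
  then have "weight_part m s (- k) c p = 0" for k using that by blast
  then have "circle_mean (\<lambda>t. pull m s t c p * t powi k) 1 = 0" for k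
    using c p by (simp add: weight_part_def)
  from laurent_unique[OF pull_holomorphic[OF s c p] this, of 1] show False
    using nz pull_one[OF s c p] by simp
qed

text \<open>If all weights were equal, every section would be scaled by the action, which would then fix every
  point.\<close>

lemma two_weights:
  assumes va: "antican_very_ample A m" and nontriv: "\<exists>t p. t \<noteq> 0 \<and> p \<in> topspace X \<and> \<rho> t p \<noteq> p"
  obtains k s k' s' where "semi_invariant m k s" "s \<noteq> 0" "semi_invariant m k' s'" "s' \<noteq> 0" "k \<noteq> k'"
proof (rule ccontr)
  assume contr: "\<not> thesis"
  note pairI = that
  obtain N s where a: "\<forall>i\<le>N::nat. s i \<in> antican_sections A m"
    and b: "\<forall>c\<in>A. \<forall>p\<in>fst c. \<exists>i\<le>N. s i c p \<noteq> 0"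
    and d: "\<forall>c\<in>A. \<forall>c'\<in>A. \<forall>p\<in>fst c. \<forall>q\<in>fst c'. p \<noteq> q \<longrightarrow>
        \<not> (\<exists>a. \<forall>i\<le>N. s i c' q = a * s i c p)"
    using va unfolding antican_very_ample_def by (elim exE conjE)
  note s = a[rule_format] and base = b[rule_format] and sep = d[rule_format]
  obtain t p where tp: "t \<noteq> 0" "p \<in> topspace X" "\<rho> t p \<noteq> p" using nontriv by blast
  obtain c where c: "c \<in> A" "p \<in> fst c" by (rule exists_chart[OF tp(2)])
  obtain c' where c': "c' \<in> A" "\<rho> t p \<in> fst c'" by (rule exists_chart[OF act_in[OF tp(1,2)]])
  obtain i0 where i0: "i0 \<le> N" "s i0 c p \<noteq> 0" using base[OF c] by blast
  obtain k0 where k0: "weight_part m (s i0) k0 c p \<noteq> 0"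
    by (rule exists_weight_part_nonzero[OF s[OF i0(1)] c i0(2)])
  \<comment> \<open>A non-zero part of another weight, together with the part of weight
    \<open>k0\<close>, would be a pair of the kind sought.\<close>
  have uniq: "weight_part m (s i) k c p = 0" if "i \<le> N" "k \<noteq> k0" for i k
  proof (rule ccontr)
    assume nz: "weight_part m (s i) k c p \<noteq> 0"
    have "weight_part m (s i) k \<noteq> 0" "weight_part m (s i0) k0 \<noteq> 0" using nz k0 by auto
    from pairI[OF semi_invariant_weight_part[OF s[OF that(1)]] this(1)
        semi_invariant_weight_part[OF s[OF i0(1)]] this(2) that(2)] show False
      using contr by blast
  qed
  have "s i c' (\<rho> t p) = (jac c c' (\<rho> t) p ^ m * t powi k0) * s i c p" if i: "i \<le> N" for i
  proof -
    define a where "a = weight_part m (s i) k0 c p"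
    \<comment> \<open>Subtracting the only surviving monomial leaves no Laurent coefficient, so the
      pullback at \<open>p\<close> is exactly that monomial.\<close>
    let ?F = "\<lambda>u. pull m (s i) u c p - a * u powi k0"
    have hol: "(\<lambda>u. pull m (s i) u c p) holomorphic_on - {0}" by (rule pull_holomorphic[OF s[OF i] c])
    have hF: "?F holomorphic_on - {0}" by (intro holomorphic_intros hol) auto
    have coeff: "circle_mean (\<lambda>u. ?F u * u powi k) 1 = 0" for k
    proof -
      have h: "(\<lambda>u. pull m (s i) u c p * u powi k) holomorphic_on - {0}" "(\<lambda>u. a * (u powi (k0 + k))) holomorphic_on - {0}"
        by (intro holomorphic_intros hol; simp)+
      have "circle_mean (\<lambda>u. ?F u * u powi k) 1
          = circle_mean (\<lambda>u. pull m (s i) u c p * u powi k - a * (u powi (k0 + k))) 1"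
        unfolding circle_mean_def by (rule integral_cong) (simp add: left_diff_distrib power_int_add)
      also have "\<dots> = weight_part m (s i) (- k) c p - a * (if k0 + k = 0 then 1 else 0)"
        using c by (simp add: circle_mean_diff[OF h] circle_mean_mult_left circle_mean_powi weight_part_def)
      also have "\<dots> = 0"
      proof (cases "k0 + k = 0")
        case True
        then have "- k = k0" by simp
        then show ?thesis by (simp add: a_def)
      qed (use uniq[OF i, of "- k"] in auto)
      finally show ?thesis .
    qed
    have F: "pull m (s i) u c p = a * u powi k0" if "u \<noteq> 0" for u
      using laurent_unique[OF hF coeff that] by simp
    have "s i c p = a" using F[of 1] pull_one[OF s[OF i] c] by simp
    moreover have "s i c' (\<rho> t p) = jac c c' (\<rho> t) p ^ m * pull m (s i) t c p"
      using pull_eq[OF s[OF i] tp(1) c(1) c'(1) c(2) c'(2)] act_jac_nonzero[OF tp(1) c(1) c'(1) c(2) c'(2)] by simp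
    ultimately show ?thesis using F[OF tp(1)] by simp
  qed
  \<comment> \<open>The proportionality factor does not depend on \<open>i\<close>, so the sections
    \<open>s i\<close> fail to separate \<open>p\<close> from \<open>\<rho> t p\<close>.\<close>
  then have "\<exists>a. \<forall>i\<le>N. s i c' (\<rho> t p) = a * s i c p" by (intro exI allI impI)
  moreover have "p \<noteq> \<rho> t p" using tp(3) by simp
  ultimately show False
    using sep[OF c(1) c'(1) c(2) c'(2)] by metis
qed

end

section \<open>Non-integrability of semi-invariant sections\<close>

context atlas
begin

text \<open>Serves two purposes: \<open>C = 0\<close> with equal sections gives the set where a
  section is non-zero, and the constants \<open>C i\<close> below give the complement of a compact
  set.\<close>

lemma openin_section_norm_less:
  assumes s: "s \<in> antican_sections A m" and s': "s' \<in> antican_sections A m"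
  shows "openin X {p \<in> topspace X. \<exists>c\<in>A. p \<in> fst c \<and> C * cmod (s' c p) < cmod (s c p)}" (is "openin X ?U")
proof (subst openin_subopen, intro ballI)
  fix p assume "p \<in> ?U"
  then obtain c where c: "c \<in> A" "p \<in> fst c" "C * cmod (s' c p) < cmod (s c p)" by blast
  let ?f = "\<lambda>z. cmod (s c (cinv c z)) - C * cmod (s' c (cinv c z))"
  let ?Z = "snd c ` fst c \<inter> ?f -` {0<..}"
  have "continuous_on (snd c ` fst c) ?f"
    by (intro continuous_intros holo_on_imp_continuous_on section_holo[OF s c(1)] section_holo[OF s' c(1)])
  then have "open ?Z"
    by (intro continuous_open_preimage open_chart_image[OF c(1)] open_greaterThan)
  then have "openin X {q \<in> fst c. snd c q \<in> ?Z}" by (rule openin_chart_vimage[OF c(1)])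
  moreover have "p \<in> {q \<in> fst c. snd c q \<in> ?Z}" using c by simp
  moreover have "{q \<in> fst c. snd c q \<in> ?Z} \<subseteq> ?U"
  proof
    fix q assume q: "q \<in> {q \<in> fst c. snd c q \<in> ?Z}"
    then have "q \<in> fst c" "?f (snd c q) > 0" by blast+
    then have "q \<in> fst c" "C * cmod (s' c q) < cmod (s c q)" using c(1) by simp_all
    then show "q \<in> ?U" using c(1) chart_point[OF c(1)] by blast
  qed
  ultimately show "\<exists>T. openin X T \<and> p \<in> T \<and> T \<subseteq> ?U" by blast
qed

lemma compactin_section_bound:
  assumes comp: "compact_space X" and I: "finite I" "\<And>i. i \<in> I \<Longrightarrow> s i \<in> antican_sections A m"
    and s': "s' \<in> antican_sections A m"
  shows "compactin X {p \<in> topspace X. \<forall>i\<in>I. \<forall>c\<in>A. p \<in> fst c \<longrightarrow> cmod (s i c p) \<le> C i * cmod (s' c p)}"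
    (is "compactin X ?K")
proof (rule closedin_compact_space[OF comp])
  let ?V = "\<lambda>i. {p \<in> topspace X. \<exists>c\<in>A. p \<in> fst c \<and> C i * cmod (s' c p) < cmod (s i c p)}"
  have "openin X (\<Union>i\<in>I. ?V i)"
    by (rule openin_Union) (use openin_section_norm_less[OF I(2) s'] in blast)
  moreover have "topspace X - ?K = (\<Union>i\<in>I. ?V i)"
    unfolding not_le[symmetric] by blast
  ultimately show "closedin X ?K"
    unfolding closedin_def by (metis (no_types, lifting) mem_Collect_eq subsetI)
qed

end

lemma compactin_finite_subcover:
  assumes "compactin X K" "\<And>q. q \<in> Q \<Longrightarrow> openin X (N q)" "K \<subseteq> (\<Union>q\<in>Q. N q)"
  obtains Q' where "finite Q'" "Q' \<subseteq> Q" "K \<subseteq> (\<Union>q\<in>Q'. N q)"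
proof -
  have "\<exists>F. finite F \<and> F \<subseteq> N ` Q \<and> K \<subseteq> \<Union>F"
    by (rule compactinD[OF assms(1)]) (use assms(2,3) in auto)
  then obtain F where F: "finite F" "F \<subseteq> N ` Q" "K \<subseteq> \<Union>F" by blast
  obtain Q' where "Q' \<subseteq> Q" "finite Q'" "F = N ` Q'" by (rule finite_subset_image[OF F(1,2), THEN exE]) blast
  then show thesis using that F(3) by blast
qed

lemma sum_bound_imp_zero_ennreal:
  fixes x M :: ennreal
  assumes "M < \<infinity>" "\<And>n :: nat. of_nat n * x \<le> M"
  shows "x = 0"
proof (rule ccontr)
  assume "x \<noteq> 0"
  have "x \<le> M" using assms(2)[of 1] by simp
  then have x: "x = ennreal (enn2real x)" and M: "M = ennreal (enn2real M)"
    using assms(1) by (auto simp: less_top)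
  have "enn2real x > 0"
    using \<open>x \<noteq> 0\<close> x by (metis enn2real_nonneg ennreal_0 less_le)
  then obtain n :: nat where n: "enn2real M < real n * enn2real x"
    using reals_Archimedean3 by blast
  have "ennreal (real n * enn2real x) = of_nat n * x"
    using x by (metis ennreal_mult ennreal_of_nat_eq_real_of_nat enn2real_nonneg of_nat_0_le_iff)
  also have "\<dots> \<le> ennreal (enn2real M)" using assms(2) M by simp
  finally show False using n by (simp add: ennreal_le_iff)
qed

lemma nn_integral_open_pos:
  fixes f :: "'b::euclidean_space \<Rightarrow> ennreal"
  assumes "open U" "U \<noteq> {}" "f \<in> borel_measurable borel" "\<And>z. z \<in> U \<Longrightarrow> f z > 0"
  shows "(\<integral>\<^sup>+z\<in>U. f z \<partial>lborel) \<noteq> 0"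
proof
  have U: "U \<in> sets borel" using assms(1) by simp
  assume "(\<integral>\<^sup>+z\<in>U. f z \<partial>lborel) = 0"
  then have "AE z in lborel. f z * indicator U z = 0"
    using assms(3) U by (subst (asm) nn_integral_0_iff_AE) auto
  then have "AE z in lborel. z \<notin> U"
    by eventually_elim (use assms(4) in \<open>force simp: indicator_def split: if_splits\<close>)
  then have "U \<in> null_sets lborel"
    using U by (subst (asm) AE_iff_null_sets[symmetric]) auto
  then have "negligible U"
    by (simp add: negligible_iff_null_sets null_sets_completionI)
  then show False using assms(1,2) open_not_negligible by blast
qed

lemma power_powi_commute: "(x ^ j) powi n = (x powi n) ^ j" for x :: "'b::field"
  by (simp add: power_int_def power_mult[symmetric] mult.commute power_inverse)

lemma inverse_power_powi: "inverse (x ^ j) powi n = inverse ((x powi n) ^ j)" for x :: "'b::field"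
  by (simp add: power_int_inverse power_powi_commute)

context cstar_action
begin

text \<open>For semi-invariant sections \<open>s\<^sub>a\<close>, \<open>s\<^sub>b\<close> of \<open>-mK\<close> the functions \<open>|s\<^sub>a s\<^sub>b|\<^sup>-\<^sup>1\<^sup>/\<^sup>m\<close> in the charts are the densities
  of a measure on \<open>X\<close>, which the action rescales.\<close>

definition pair_density :: "nat \<Rightarrow> ('a, 'n) antican_sec \<Rightarrow> ('a, 'n) antican_sec \<Rightarrow> ('a, 'n) chart \<Rightarrow> complex^'n \<Rightarrow> real" where
  "pair_density m a b c z = (if z \<in> snd c ` fst c
     then cmod (a c (cinv c z)) powr (- 1 / m) * cmod (b c (cinv c z)) powr (- 1 / m) else 0)"

lemma pair_density_nonneg: "0 \<le> pair_density m a b c z"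
  by (simp add: pair_density_def)

lemma section_norm_measurable:
  assumes "s \<in> antican_sections A m" "c \<in> A"
  shows "(\<lambda>z. if z \<in> snd c ` fst c then cmod (s c (cinv c z)) powr e else 0) \<in> borel_measurable borel"
proof -
  have "(\<lambda>z. if z \<in> snd c ` fst c then cmod (s c (cinv c z)) else 0) \<in> borel_measurable borel"
    by (intro borel_measurable_continuous_on_if borel_open open_chart_image[OF assms(2)] continuous_intros
        holo_on_imp_continuous_on[OF section_holo[OF assms]])
  then have "(\<lambda>z. (if z \<in> snd c ` fst c then cmod (s c (cinv c z)) else 0) powr e) \<in> borel_measurable borel"
    by measurable
  then show ?thesis by (rule measurable_cong[THEN iffD1, rotated]) simp
qed

lemma pair_density_measurable:
  assumes "a \<in> antican_sections A m" "b \<in> antican_sections A m" "c \<in> A"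
  shows "pair_density m a b c \<in> borel_measurable borel"
proof -
  have "pair_density m a b c = (\<lambda>z.
      (if z \<in> snd c ` fst c then cmod (a c (cinv c z)) powr (- 1 / m) else 0) *
      (if z \<in> snd c ` fst c then cmod (b c (cinv c z)) powr (- 1 / m) else 0))"
    by (auto simp: pair_density_def fun_eq_iff)
  then show ?thesis
    using section_norm_measurable[OF assms(1,3)] section_norm_measurable[OF assms(2,3)] by simp
qed

text \<open>Each section contributes the inverse modulus of the Jacobian, as the power
  \<open>m\<close> and the exponent \<open>- 1 / m\<close> cancel; two sections thus cancel exactly
  the real Jacobian. At zeros of the sections both sides are 0 by the convention for
  \<open>0 powr\<close>.\<close>

lemma pair_density_transform:
  assumes a: "semi_invariant m ka a" and b: "semi_invariant m kb b" and m: "m \<ge> 1" and t: "t \<noteq> 0"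
    and c: "c \<in> A" "c' \<in> A" and p: "p \<in> fst c" "\<rho> t p \<in> fst c'"
  shows "(cmod (jac c c' (\<rho> t) p))\<^sup>2 * pair_density m a b c' (snd c' (\<rho> t p))
    = cmod (t powi (ka + kb)) powr (- 1 / m) * pair_density m a b c (snd c p)"
proof -
  let ?J = "cmod (jac c c' (\<rho> t) p)"
  have J: "?J > 0" using act_jac_nonzero[OF t c p] by simp
  have E: "(?J ^ m) powr (- 1 / m) = 1 / ?J"
    using J m by (simp add: powr_realpow[symmetric] powr_powr powr_minus_divide)
  have D: "pair_density m a b c' (snd c' (\<rho> t p)) = cmod (a c' (\<rho> t p)) powr (- 1 / m) * cmod (b c' (\<rho> t p)) powr (- 1 / m)"
    "pair_density m a b c (snd c p) = cmod (a c p) powr (- 1 / m) * cmod (b c p) powr (- 1 / m)"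
    using c p by (simp_all add: pair_density_def)
  have "cmod (a c' (\<rho> t p)) powr (- 1 / m) = 1 / ?J * (cmod (t powi ka) powr (- 1 / m) * cmod (a c p) powr (- 1 / m))"
    "cmod (b c' (\<rho> t p)) powr (- 1 / m) = 1 / ?J * (cmod (t powi kb) powr (- 1 / m) * cmod (b c p) powr (- 1 / m))"
    unfolding semi_invariantD[OF a t c p] semi_invariantD[OF b t c p] norm_mult norm_power powr_mult E by simp_all
  then show ?thesis
    unfolding D using J t
    by (simp add: power_int_add norm_mult powr_mult power2_eq_square)
qed

text \<open>The sets \<open>\<rho> (\<tau> ^ j) U\<close> are pairwise disjoint, of measure bounded below, and stay in a compact set
  away from the zeros of \<open>a\<close>.\<close>

lemma no_integrable_semi_invariant:
  assumes comp: "compact_space X" and conn: "connected_space X" and m: "m \<ge> 1"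
    and I: "finite I" "\<And>i. i \<in> I \<Longrightarrow> semi_invariant m (k i) (s i)"
    and base: "\<And>c p. c \<in> A \<Longrightarrow> p \<in> fst c \<Longrightarrow> \<exists>i\<in>I. s i c p \<noteq> 0"
    and ab: "a \<in> I" "b \<in> I" "s a \<noteq> 0" "s b \<noteq> 0"
    and \<tau>: "\<tau> \<noteq> 0" "\<And>i. i \<in> I \<Longrightarrow> cmod (\<tau> powi k i) \<le> cmod (\<tau> powi k a)"
      "cmod (\<tau> powi k b) < cmod (\<tau> powi k a)" "cmod (\<tau> powi (k a + k b)) \<le> 1"
    and int: "\<And>c p. c \<in> A \<Longrightarrow> p \<in> fst c \<Longrightarrow> \<exists>S. open S \<and> snd c p \<in> S \<and> S \<subseteq> snd c ` fst c \<and>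
      (\<integral>\<^sup>+z\<in>S. ennreal (cmod (s b c (cinv c z)) powr (- 1 / m)) \<partial>lborel) < \<infinity>"
  shows False
proof -
  have sec: "s i \<in> antican_sections A m" if "i \<in> I" for i
    using I(2)[OF that] unfolding semi_invariant_def by blast
  note sa = sec[OF ab(1)] and sb = sec[OF ab(2)]
  let ?d = "pair_density m (s a) (s b)"
  note meas = pair_density_measurable[OF sa sb]

  \<comment> \<open>A point where neither section vanishes: otherwise \<open>s b\<close> would
    vanish on the non-empty open set where \<open>s a\<close> does not, hence everywhere.\<close>
  obtain c0 p0 where c0: "c0 \<in> A" "p0 \<in> fst c0" "s a c0 p0 \<noteq> 0" "s b c0 p0 \<noteq> 0"
  proof (rule ccontr)
    assume contr: "\<not> thesis"
    note I = that
    let ?W = "{p \<in> topspace X. \<exists>c\<in>A. p \<in> fst c \<and> 0 * cmod (s a c p) < cmod (s a c p)}"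
    have "s b = 0"
    proof (rule section_identity[OF conn sb openin_section_norm_less[OF sa sa]])
      show "?W \<noteq> {}"
      proof -
        obtain c p where cp: "s a c p \<noteq> 0" using ab(3) by (auto simp: fun_eq_iff)
        then have "c \<in> A" "p \<in> fst c" using section_outside[OF sa] by blast+
        then show ?thesis using cp chart_point[of c p] by force
      qed
      fix c p assume c: "c \<in> A" "p \<in> fst c" and "p \<in> ?W"
      then obtain c' where c': "c' \<in> A" "p \<in> fst c'" "s a c' p \<noteq> 0" by auto
      then have "s a c p \<noteq> 0" using section_zero_iff[OF sa c(1) c'(1) c(2) c'(2)] by simp
      then show "s b c p = 0" using I[OF c] contr by blast
    qed
    then show False using ab(4) by simp
  qed

  define f where "f i z = cmod (s i c0 (cinv c0 z))" for i z
  \<comment> \<open>One step by \<open>\<tau>\<close> multiplies the ratio |s b| / |s a| by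
    \<open>\<kappa>\<close>. The bound \<open>\<beta>\<close> is the ratio at the base point times
    the midpoint of \<open>\<kappa>\<close> and 1, so that this ratio lies strictly between
    \<open>\<beta>\<close> and \<open>\<beta> / \<kappa>\<close>; the 1 in \<open>C i\<close> makes
    the remaining inequalities strict.\<close>
  define \<kappa> where "\<kappa> = cmod (\<tau> powi k b) / cmod (\<tau> powi k a)"
  define \<beta> where "\<beta> = f b (snd c0 p0) / f a (snd c0 p0) * (1 + \<kappa>) / 2"
  define C where "C i = f i (snd c0 p0) / f a (snd c0 p0) + 1" for i
  have fp: "f a (snd c0 p0) > 0" "f b (snd c0 p0) > 0" using c0 by (simp_all add: f_def)
  have \<tau>k: "cmod (\<tau> powi n) > 0" for n using \<tau>(1) by simp
  have \<kappa>: "0 < \<kappa>" "\<kappa> < 1" unfolding \<kappa>_def using \<tau>(3) \<tau>k[of "k a"] \<tau>k[of "k b"] by (simp_all add: field_simps)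
  have \<beta>: "\<beta> > 0" unfolding \<beta>_def using fp \<kappa> by simp
  let ?dom = "snd c0 ` fst c0"
  define U where "U = {z \<in> ?dom. 0 < f a z \<and> 0 < f b z \<and> \<beta> * f a z < f b z \<and> \<kappa> * f b z < \<beta> * f a z \<and>
    (\<forall>i\<in>I. f i z < C i * f a z)}"
  have Ud: "U \<subseteq> ?dom" by (auto simp: U_def)
  have contf: "continuous_on ?dom (f i)" if "i \<in> I" for i
    unfolding f_def by (intro continuous_intros holo_on_imp_continuous_on section_holo[OF sec[OF that] c0(1)])
  have opU: "open U"
  proof -
    have pos: "open (?dom \<inter> g -` {0<..})" if "continuous_on ?dom g" for g :: "complex^'n \<Rightarrow> real"
      using that by (intro continuous_open_preimage open_chart_image[OF c0(1)] open_greaterThan)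
    have eq: "U = (?dom \<inter> f a -` {0<..}) \<inter> (?dom \<inter> f b -` {0<..}) \<inter> (?dom \<inter> (\<lambda>z. f b z - \<beta> * f a z) -` {0<..})
        \<inter> (?dom \<inter> (\<lambda>z. \<beta> * f a z - \<kappa> * f b z) -` {0<..}) \<inter> (\<Inter>i\<in>I. ?dom \<inter> (\<lambda>z. C i * f a z - f i z) -` {0<..})"
      unfolding U_def using ab(1) by auto
    show ?thesis
      by (subst eq) (intro open_Int open_INT ballI I(1) pos continuous_intros contf ab(1,2); assumption)
  qed
  have z0: "snd c0 p0 \<in> U"
  proof -
    have eq: "\<beta> * f a (snd c0 p0) = f b (snd c0 p0) * ((1 + \<kappa>) / 2)"
      unfolding \<beta>_def using fp by simp
    have "f b (snd c0 p0) * ((1 + \<kappa>) / 2) < f b (snd c0 p0) * 1"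
      using fp \<kappa> by (intro mult_strict_left_mono) auto
    then have "\<beta> * f a (snd c0 p0) < f b (snd c0 p0)" unfolding eq by simp
    moreover have "f b (snd c0 p0) * \<kappa> < f b (snd c0 p0) * ((1 + \<kappa>) / 2)"
      using fp \<kappa> by (intro mult_strict_left_mono) auto
    then have "\<kappa> * f b (snd c0 p0) < \<beta> * f a (snd c0 p0)" unfolding eq by (simp only: mult.commute[of \<kappa>])
    moreover have "f i (snd c0 p0) < C i * f a (snd c0 p0)" for i
      unfolding C_def using fp by (simp add: field_simps)
    ultimately show ?thesis
      unfolding U_def using c0(2) fp by blast
  qed

  \<comment> \<open>The bounds by \<open>s a\<close> survive every step because no weight in the
    family grows faster along \<open>\<tau>\<close> than that of \<open>a\<close>. On
    \<open>K\<close> a zero of \<open>s a\<close> would be a common zero of the whole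
    family.\<close>
  define K where "K = {p \<in> topspace X. \<forall>i\<in>I. \<forall>c\<in>A. p \<in> fst c \<longrightarrow> cmod (s i c p) \<le> C i * cmod (s a c p)}"
  have K: "compactin X K"
    unfolding K_def by (rule compactin_section_bound[OF comp I(1) sec sa])
  have orbit_K: "\<rho> (\<tau> ^ j) (cinv c0 u) \<in> K" if u: "u \<in> U" for u j
  proof -
    have t: "\<tau> ^ j \<noteq> 0" using \<tau>(1) by simp
    have q: "cinv c0 u \<in> fst c0" using u Ud by auto
    have "cmod (s i c (\<rho> (\<tau> ^ j) (cinv c0 u))) \<le> C i * cmod (s a c (\<rho> (\<tau> ^ j) (cinv c0 u)))"
      if i: "i \<in> I" and c: "c \<in> A" "\<rho> (\<tau> ^ j) (cinv c0 u) \<in> fst c" for i c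
    proof -
      have "f i u \<le> C i * f a u" using u i by (force simp: U_def)
      moreover have "cmod ((\<tau> ^ j) powi k i) \<le> cmod ((\<tau> ^ j) powi k a)"
        using \<tau>(2)[OF i] unfolding power_powi_commute norm_power by (intro power_mono) auto
      ultimately have "cmod ((\<tau> ^ j) powi k i) * f i u \<le> cmod ((\<tau> ^ j) powi k a) * (C i * f a u)"
        by (intro mult_mono) (auto simp: f_def)
      then have "cmod (jac c0 c (\<rho> (\<tau> ^ j)) (cinv c0 u)) ^ m * (cmod ((\<tau> ^ j) powi k i) * f i u)
          \<le> cmod (jac c0 c (\<rho> (\<tau> ^ j)) (cinv c0 u)) ^ m * (cmod ((\<tau> ^ j) powi k a) * (C i * f a u))"
        by (intro mult_left_mono) auto
      then show ?thesis
        unfolding semi_invariantD[OF I(2)[OF i] t c0(1) c(1) q c(2)] semi_invariantD[OF I(2)[OF ab(1)] t c0(1) c(1) q c(2)]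
        by (simp add: norm_mult norm_power f_def mult_ac)
    qed
    then show ?thesis
      unfolding K_def using act_in[OF t chart_point[OF c0(1) q]] by blast
  qed

  \<comment> \<open>Pieces of charts with finite mass. Near a point of \<open>K\<close> the factor
    of \<open>s a\<close> is bounded, so the assumed integrability for \<open>s b\<close> provides
    such a piece.\<close>
  define Q where "Q = {(c, S). c \<in> A \<and> open S \<and> S \<subseteq> snd c ` fst c \<and> (\<integral>\<^sup>+z\<in>S. ennreal (?d c z) \<partial>lborel) < \<infinity>}"
  have Q: "\<exists>q\<in>Q. p \<in> fst (fst q) \<and> snd (fst q) p \<in> snd q" if p: "p \<in> K" for p
  proof -
    have pX: "p \<in> topspace X" using p by (simp add: K_def)
    obtain c where c: "c \<in> A" "p \<in> fst c" by (rule exists_chart[OF pX])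
    have nz: "s a c p \<noteq> 0"
    proof
      assume 0: "s a c p = 0"
      obtain i where i: "i \<in> I" "s i c p \<noteq> 0" using base[OF c] by blast
      have "cmod (s i c p) \<le> C i * cmod (s a c p)" using p i(1) c unfolding K_def by blast
      then show False using i(2) 0 by simp
    qed
    obtain S where S: "open S" "snd c p \<in> S" "S \<subseteq> snd c ` fst c"
      "(\<integral>\<^sup>+z\<in>S. ennreal (cmod (s b c (cinv c z)) powr (- 1 / m)) \<partial>lborel) < \<infinity>"
      using int[OF c] by blast
    define \<delta> where "\<delta> = cmod (s a c p) / 2"
    have \<delta>: "\<delta> > 0" using nz by (simp add: \<delta>_def)
    define S' where "S' = S \<inter> (snd c ` fst c \<inter> (\<lambda>z. cmod (s a c (cinv c z))) -` {\<delta><..})"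
    have "open S'"
      unfolding S'_def
      by (intro open_Int S(1) continuous_open_preimage open_chart_image[OF c(1)] open_greaterThan continuous_intros
          holo_on_imp_continuous_on section_holo[OF sa c(1)])
    moreover have "snd c p \<in> S'" using S(2) c \<delta> nz by (simp add: S'_def \<delta>_def)
    moreover have "(\<integral>\<^sup>+z\<in>S'. ennreal (?d c z) \<partial>lborel) < \<infinity>"
    proof -
      let ?b = "\<lambda>z. if z \<in> snd c ` fst c then cmod (s b c (cinv c z)) powr (- 1 / m) else 0"
      have [measurable]: "?b \<in> borel_measurable borel" "S \<in> sets borel"
        using section_norm_measurable[OF sb c(1)] S(1) by auto
      have "(\<integral>\<^sup>+z\<in>S'. ennreal (?d c z) \<partial>lborel) \<le> (\<integral>\<^sup>+z. ennreal (\<delta> powr (- 1 / m)) * (ennreal (?b z) * indicator S z) \<partial>lborel)"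
      proof (rule nn_integral_mono)
        fix z
        show "ennreal (?d c z) * indicator S' z \<le> ennreal (\<delta> powr (- 1 / m)) * (ennreal (?b z) * indicator S z)"
        proof (cases "z \<in> S'")
          case True
          then have z: "z \<in> S" "z \<in> snd c ` fst c" "\<delta> < cmod (s a c (cinv c z))" by (auto simp: S'_def)
          have "cmod (s a c (cinv c z)) powr (- 1 / m) \<le> \<delta> powr (- 1 / m)"
            using z(3) \<delta> m by (intro powr_mono2') auto
          then have "?d c z \<le> \<delta> powr (- 1 / m) * ?b z"
            using z(2) by (simp add: pair_density_def mult_right_mono)
          then show ?thesis using True z by (simp add: ennreal_mult'[symmetric] ennreal_leI)
        qed simp
      qed
      also have "\<dots> = ennreal (\<delta> powr (- 1 / m)) * (\<integral>\<^sup>+z\<in>S. ennreal (?b z) \<partial>lborel)"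
        by (rule nn_integral_cmult) measurable
      also have "(\<integral>\<^sup>+z\<in>S. ennreal (?b z) \<partial>lborel) = (\<integral>\<^sup>+z\<in>S. ennreal (cmod (s b c (cinv c z)) powr (- 1 / m)) \<partial>lborel)"
        by (rule nn_integral_cong) (use S(3) in \<open>auto simp: indicator_def\<close>)
      also have "ennreal (\<delta> powr (- 1 / m)) * \<dots> < \<infinity>"
        using S(4) by (simp add: ennreal_mult_less_top)
      finally show ?thesis .
    qed
    ultimately have "(c, S') \<in> Q" using c(1) by (auto simp: Q_def S'_def)
    then show ?thesis using c(2) \<open>snd c p \<in> S'\<close> by force
  qed
  let ?N = "\<lambda>q. {p \<in> fst (fst q). snd (fst q) p \<in> snd q}"
  obtain Q' where Q': "finite Q'" "Q' \<subseteq> Q" "K \<subseteq> (\<Union>q\<in>Q'. ?N q)"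
  proof (rule compactin_finite_subcover[OF K])
    show "openin X (?N q)" if "q \<in> Q" for q
      using that openin_chart_vimage by (auto simp: Q_def)
    show "K \<subseteq> (\<Union>q\<in>Q. ?N q)" using Q by blast
  qed

  \<comment> \<open>\<open>R j\<close> undoes \<open>j\<close> steps. \<open>V j q\<close> is the
    part of the \<open>j\<close>-th translate of \<open>U\<close> seen in the piece
    \<open>q\<close>, and \<open>g j q\<close> carries it back into \<open>U\<close>.\<close>
  define R where "R j = inverse (\<tau> ^ j)" for j :: nat
  define V where "V j q = {z \<in> snd q. \<rho> (R j) (cinv (fst q) z) \<in> fst c0 \<and> snd c0 (\<rho> (R j) (cinv (fst q) z)) \<in> U}"
    for j and q :: "('a, 'n) chart \<times> (complex^'n) set"
  define g where "g j q = local_rep (fst q) c0 (\<rho> (R j))" for j and q :: "('a, 'n) chart \<times> (complex^'n) set"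
  have R: "R j \<noteq> 0" "R j * \<tau> ^ j = 1" "\<tau> ^ j * R j = 1" for j using \<tau>(1) by (simp_all add: R_def)
  have qA: "fst q \<in> A" "open (snd q)" "snd q \<subseteq> snd (fst q) ` fst (fst q)"
    "(\<integral>\<^sup>+z\<in>snd q. ennreal (?d (fst q) z) \<partial>lborel) < \<infinity>" if "q \<in> Q'" for q
  proof -
    have "q \<in> Q" using that Q'(2) by blast
    then show "fst q \<in> A" "open (snd q)" "snd q \<subseteq> snd (fst q) ` fst (fst q)"
      "(\<integral>\<^sup>+z\<in>snd q. ennreal (?d (fst q) z) \<partial>lborel) < \<infinity>"
      unfolding Q_def case_prod_unfold by blast+
  qed
  have opV: "open (V j q)" if q: "q \<in> Q'" for j q
  proof -
    have "openin X {p \<in> topspace X. \<rho> (R j) p \<in> {p \<in> fst c0. snd c0 p \<in> U}}"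
      by (rule openin_holo_map_vimage[OF act_holo_map[OF R(1)] openin_chart_vimage[OF c0(1) opU]])
    then have "open (snd (fst q) ` (fst (fst q) \<inter> {p \<in> topspace X. \<rho> (R j) p \<in> {p \<in> fst c0. snd c0 p \<in> U}}) \<inter> snd q)"
      (is "open ?O") by (intro open_Int open_chart_image_of[OF qA(1)[OF q]] qA(2)[OF q])
    also have "?O = V j q"
    proof
      show "?O \<subseteq> V j q" using qA(1)[OF q] by (auto simp: V_def)
      show "V j q \<subseteq> ?O"
      proof
        fix z assume z: "z \<in> V j q"
        then have zd: "z \<in> snd (fst q) ` fst (fst q)" using qA(3)[OF q] by (auto simp: V_def)
        have "cinv (fst q) z \<in> fst (fst q) \<inter> {p \<in> topspace X. \<rho> (R j) p \<in> {p \<in> fst c0. snd c0 p \<in> U}}"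
          using z cinv_in[OF zd] chart_point[OF qA(1)[OF q] cinv_in[OF zd]] by (simp add: V_def)
        then have "snd (fst q) (cinv (fst q) z)
            \<in> snd (fst q) ` (fst (fst q) \<inter> {p \<in> topspace X. \<rho> (R j) p \<in> {p \<in> fst c0. snd c0 p \<in> U}})"
          by (rule imageI)
        moreover have "z \<in> snd q" using z by (simp add: V_def)
        ultimately show "z \<in> ?O" unfolding chart_cinv[OF zd] by blast
      qed
    qed
    finally show ?thesis .
  qed
  have Vd: "z \<in> snd (fst q) ` fst (fst q)" "cinv (fst q) z \<in> fst (fst q)" "\<rho> (R j) (cinv (fst q) z) \<in> fst c0"
    "g j q z \<in> U" "cinv c0 (g j q z) = \<rho> (R j) (cinv (fst q) z)"
    if "z \<in> V j q" "q \<in> Q'" for z j q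
  proof -
    have "z \<in> snd q" using that(1) by (simp add: V_def)
    then show 1: "z \<in> snd (fst q) ` fst (fst q)" using qA(3)[OF that(2)] by blast
    show "cinv (fst q) z \<in> fst (fst q)" by (rule cinv_in[OF 1])
    show 2: "\<rho> (R j) (cinv (fst q) z) \<in> fst c0" "g j q z \<in> U" using that(1) by (simp_all add: V_def g_def local_rep_def)
    show "cinv c0 (g j q z) = \<rho> (R j) (cinv (fst q) z)" unfolding g_def local_rep_def by (rule cinv_chart[OF c0(1) 2(1)])
  qed
  have image: "g j q ` V j q = {u \<in> U. \<rho> (\<tau> ^ j) (cinv c0 u) \<in> ?N q}" if q: "q \<in> Q'" for j q
  proof
    show "g j q ` V j q \<subseteq> {u \<in> U. \<rho> (\<tau> ^ j) (cinv c0 u) \<in> ?N q}"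
    proof (rule image_subsetI)
      fix z assume z: "z \<in> V j q"
      note D = Vd[OF z q]
      have "\<rho> (\<tau> ^ j) (cinv c0 (g j q z)) = cinv (fst q) z"
        unfolding D(5) using chart_point[OF qA(1)[OF q] D(2)] \<tau>(1) by (simp add: act_mult R act_one)
      moreover have "snd (fst q) (cinv (fst q) z) \<in> snd q" using z chart_cinv[OF D(1)] by (simp add: V_def)
      ultimately show "g j q z \<in> {u \<in> U. \<rho> (\<tau> ^ j) (cinv c0 u) \<in> ?N q}" using D(2,4) by simp
    qed
    show "{u \<in> U. \<rho> (\<tau> ^ j) (cinv c0 u) \<in> ?N q} \<subseteq> g j q ` V j q"
    proof
      fix u assume "u \<in> {u \<in> U. \<rho> (\<tau> ^ j) (cinv c0 u) \<in> ?N q}"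
      then have u: "u \<in> U" "\<rho> (\<tau> ^ j) (cinv c0 u) \<in> fst (fst q)" "snd (fst q) (\<rho> (\<tau> ^ j) (cinv c0 u)) \<in> snd q"
        by blast+
      have ud: "u \<in> ?dom" using u(1) Ud by blast
      let ?z = "snd (fst q) (\<rho> (\<tau> ^ j) (cinv c0 u))"
      have "\<rho> (R j) (cinv (fst q) ?z) = cinv c0 u"
        unfolding cinv_chart[OF qA(1)[OF q] u(2)]
        using chart_point[OF c0(1) cinv_in[OF ud]] \<tau>(1) by (simp add: act_mult R act_one)
      then have "?z \<in> V j q" "u = g j q ?z"
        using u cinv_in[OF ud] chart_cinv[OF ud] by (simp_all add: V_def g_def local_rep_def)
      then show "u \<in> g j q ` V j q" by blast
    qed
  qed
  have op_image: "open (g j q ` V j q)" if q: "q \<in> Q'" for j q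
  proof -
    have "openin X {p \<in> topspace X. \<rho> (\<tau> ^ j) p \<in> ?N q}"
      using \<tau>(1) by (intro openin_holo_map_vimage act_holo_map openin_chart_vimage qA[OF q]) simp
    then have "open (snd c0 ` (fst c0 \<inter> {p \<in> topspace X. \<rho> (\<tau> ^ j) p \<in> ?N q}) \<inter> U)" (is "open ?O")
      by (intro open_Int open_chart_image_of[OF c0(1)] opU)
    also have "?O = g j q ` V j q"
      unfolding image[OF q]
    proof
      show "?O \<subseteq> {u \<in> U. \<rho> (\<tau> ^ j) (cinv c0 u) \<in> ?N q}" using c0(1) by auto
      show "{u \<in> U. \<rho> (\<tau> ^ j) (cinv c0 u) \<in> ?N q} \<subseteq> ?O"
      proof
        fix u assume u: "u \<in> {u \<in> U. \<rho> (\<tau> ^ j) (cinv c0 u) \<in> ?N q}"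
        then have ud: "u \<in> ?dom" using Ud by blast
        have "cinv c0 u \<in> fst c0 \<inter> {p \<in> topspace X. \<rho> (\<tau> ^ j) p \<in> ?N q}"
          using u chart_point[OF c0(1) cinv_in[OF ud]] cinv_in[OF ud] by simp
        then have "snd c0 (cinv c0 u) \<in> snd c0 ` (fst c0 \<inter> {p \<in> topspace X. \<rho> (\<tau> ^ j) p \<in> ?N q})"
          by (rule imageI)
        then show "u \<in> ?O" unfolding chart_cinv[OF ud] using u by blast
      qed
    qed
    finally show ?thesis .
  qed
  have cover: "U \<subseteq> (\<Union>q\<in>Q'. g j q ` V j q)" for j
  proof
    fix u assume u: "u \<in> U"
    then obtain q where q: "q \<in> Q'" "\<rho> (\<tau> ^ j) (cinv c0 u) \<in> ?N q"
      using orbit_K[OF u, of j] Q'(3) by blast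
    then have "u \<in> g j q ` V j q" unfolding image[OF q(1)] using u by blast
    then show "u \<in> (\<Union>q\<in>Q'. g j q ` V j q)" using q(1) by blast
  qed

  \<comment> \<open>Moving back by \<open>R j\<close> does not increase mass, because
    \<open>\<tau> powi (k a + k b)\<close> has modulus at most 1; the translates are therefore at
    least as heavy as \<open>U\<close>.\<close>
  have mass: "(\<integral>\<^sup>+z\<in>g j q ` V j q. ennreal (?d c0 z) \<partial>lborel) \<le> (\<integral>\<^sup>+z\<in>V j q. ennreal (?d (fst q) z) \<partial>lborel)"
    if q: "q \<in> Q'" for j q
  proof -
    define h where "h z = cmod (R j powi (k a + k b)) powr (- 1 / m) * ?d (fst q) z" for z
    have J: "det (matrix (frechet_derivative (g j q) (at z))) = jac (fst q) c0 (\<rho> (R j)) (cinv (fst q) z)"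
      if "z \<in> V j q" for z
      unfolding jac_def g_def chart_cinv[OF Vd(1)[OF that q]] ..
    have "(\<integral>\<^sup>+z\<in>g j q ` V j q. ennreal (?d c0 z) \<partial>lborel) \<le> (\<integral>\<^sup>+z\<in>V j q. ennreal (h z) \<partial>lborel)"
    proof (rule nn_integral_holo_image_le)
      show "holo_on (V j q) (\<lambda>z. g j q z $ i)" for i
        unfolding g_def
      proof (rule holo_on_subset[OF local_rep_holo[OF act_holo_map[OF R(1)] qA(1)[OF q] c0(1)]], rule subsetI)
        fix z assume z: "z \<in> V j q"
        show "z \<in> snd (fst q) ` {p \<in> fst (fst q). \<rho> (R j) p \<in> fst c0}"
          using imageI[of "cinv (fst q) z" "{p \<in> fst (fst q). \<rho> (R j) p \<in> fst c0}" "snd (fst q)"] Vd(2,3)[OF z q]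
          unfolding chart_cinv[OF Vd(1)[OF z q]] by blast
      qed
      fix z assume z: "z \<in> V j q"
      note D = Vd[OF z q]
      show "det (matrix (frechet_derivative (g j q) (at z))) \<noteq> 0"
        unfolding J[OF z] by (rule act_jac_nonzero[OF R(1) qA(1)[OF q] c0(1) D(2,3)])
      have "(cmod (jac (fst q) c0 (\<rho> (R j)) (cinv (fst q) z)))\<^sup>2 * ?d c0 (snd c0 (\<rho> (R j) (cinv (fst q) z)))
        = cmod (R j powi (k a + k b)) powr (- 1 / m) * ?d (fst q) (snd (fst q) (cinv (fst q) z))"
        by (rule pair_density_transform[OF I(2)[OF ab(1)] I(2)[OF ab(2)] m R(1) qA(1)[OF q] c0(1) D(2,3)])
      then show "(cmod (det (matrix (frechet_derivative (g j q) (at z)))))\<^sup>2 * ?d c0 (g j q z) = h z"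
        unfolding J[OF z] h_def chart_cinv[OF D(1)] by (simp add: g_def local_rep_def)
    next
      show "h \<in> borel_measurable borel"
        unfolding h_def using meas[OF qA(1)[OF q]] by simp
    qed (use opV[OF q] op_image[OF q] meas[OF c0(1)] in \<open>auto simp: h_def pair_density_nonneg\<close>)
    also have "\<dots> \<le> (\<integral>\<^sup>+z\<in>V j q. ennreal (?d (fst q) z) \<partial>lborel)"
    proof (intro nn_integral_mono mult_right_mono ennreal_leI)
      fix z
      have "cmod (R j powi (k a + k b)) = inverse (cmod (\<tau> powi (k a + k b)) ^ j)"
        by (simp only: R_def inverse_power_powi norm_inverse norm_power)
      moreover have "cmod (\<tau> powi (k a + k b)) ^ j \<le> 1" using \<tau>(4) by (simp add: power_le_one)
      ultimately have "1 \<le> cmod (R j powi (k a + k b))" using \<tau>k[of "k a + k b"] by (simp add: one_le_inverse)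
      then have "cmod (R j powi (k a + k b)) powr (- 1 / m) \<le> 1" using powr_mono[of "- 1 / m" 0 "cmod (R j powi (k a + k b))"] R(1) by simp
      then show "h z \<le> ?d (fst q) z"
        unfolding h_def by (intro mult_left_le_one_le pair_density_nonneg powr_ge_zero)
    qed auto
    finally show ?thesis .
  qed

  \<comment> \<open>On the \<open>j\<close>-th translate the ratio |s b| / |s a| lies strictly
    between \<open>\<beta> * \<kappa> ^ j\<close> and that value divided by \<open>\<kappa>\<close>;
    these intervals are disjoint for different \<open>j\<close>.\<close>
  have disj: "disjoint_family (\<lambda>j. V j q)" if q: "q \<in> Q'" for q
  proof -
    have bounds: "\<beta> * \<kappa> ^ j * cmod (s a (fst q) (cinv (fst q) z)) < cmod (s b (fst q) (cinv (fst q) z))"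
      "\<kappa> * cmod (s b (fst q) (cinv (fst q) z)) < \<beta> * \<kappa> ^ j * cmod (s a (fst q) (cinv (fst q) z))"
      if z: "z \<in> V j q" for j z
    proof -
      note D = Vd[OF z q]
      let ?p = "cinv (fst q) z"
      let ?J = "cmod (jac (fst q) c0 (\<rho> (R j)) ?p) ^ m"
      have J: "?J > 0" using act_jac_nonzero[OF R(1) qA(1)[OF q] c0(1) D(2,3)] by simp
      have norm_R: "cmod (R j powi n) = inverse (cmod (\<tau> powi n) ^ j)" for n
        by (simp only: R_def inverse_power_powi norm_inverse norm_power)
      have fi: "f i (g j q z) = ?J * (inverse (cmod (\<tau> powi k i) ^ j) * cmod (s i (fst q) ?p))" if "i \<in> I" for i
        unfolding f_def D(5) semi_invariantD[OF I(2)[OF that] R(1) qA(1)[OF q] c0(1) D(2,3)]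
        by (simp add: norm_mult norm_power norm_R)
      \<comment> \<open>Expressing the weight of \<open>a\<close> through that of \<open>b\<close>
        exposes the common factor \<open>w\<close>, which cancels from both inequalities.\<close>
      have \<kappa>j: "inverse (cmod (\<tau> powi k a) ^ j) = \<kappa> ^ j * inverse (cmod (\<tau> powi k b) ^ j)"
        unfolding \<kappa>_def using \<tau>k[of "k a"] \<tau>k[of "k b"] by (simp add: power_divide field_simps)
      define w where "w = ?J * inverse (cmod (\<tau> powi k b) ^ j)"
      have w: "w > 0" unfolding w_def using J \<tau>k[of "k b"] by simp
      have "f a (g j q z) = w * (\<kappa> ^ j * cmod (s a (fst q) ?p))" "f b (g j q z) = w * cmod (s b (fst q) ?p)"
        unfolding fi[OF ab(1)] fi[OF ab(2)] \<kappa>j w_def by (simp_all add: mult_ac)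
      moreover have "\<beta> * f a (g j q z) < f b (g j q z)" "\<kappa> * f b (g j q z) < \<beta> * f a (g j q z)"
        using D(4) by (auto simp: U_def)
      ultimately have "w * (\<beta> * \<kappa> ^ j * cmod (s a (fst q) ?p)) < w * cmod (s b (fst q) ?p)"
        "w * (\<kappa> * cmod (s b (fst q) ?p)) < w * (\<beta> * \<kappa> ^ j * cmod (s a (fst q) ?p))"
        by (simp_all add: mult_ac)
      then show "\<beta> * \<kappa> ^ j * cmod (s a (fst q) ?p) < cmod (s b (fst q) ?p)"
        "\<kappa> * cmod (s b (fst q) ?p) < \<beta> * \<kappa> ^ j * cmod (s a (fst q) ?p)"
        using w by (simp_all only: mult_less_cancel_left_pos)
    qed
    have no: False if "z \<in> V j q" "z \<in> V j' q" "j < j'" for z j j'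
    proof -
      let ?a = "cmod (s a (fst q) (cinv (fst q) z))" and ?b = "cmod (s b (fst q) (cinv (fst q) z))"
      have "\<kappa> * ?b < \<beta> * \<kappa> ^ j' * ?a" by (rule bounds(2)[OF that(2)])
      \<comment> \<open>\<open>Suc j \<le> j'\<close> supplies the extra factor
        \<open>\<kappa>\<close> that closes the chain.\<close>
      also have "\<dots> \<le> \<beta> * \<kappa> ^ Suc j * ?a"
        using \<beta> \<kappa> that(3) by (intro mult_right_mono mult_left_mono power_decreasing) auto
      also have "\<dots> = \<kappa> * (\<beta> * \<kappa> ^ j * ?a)" by simp
      also have "\<dots> < \<kappa> * ?b" using bounds(1)[OF that(1)] \<kappa>(1) by (rule mult_strict_left_mono)
      finally show False .
    qed
    show ?thesis
      unfolding disjoint_family_on_def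
      using no by (metis disjoint_iff nat_neq_iff)
  qed

  define M where "M = (\<Sum>q\<in>Q'. \<integral>\<^sup>+z\<in>snd q. ennreal (?d (fst q) z) \<partial>lborel)"
  have M: "M < \<infinity>" unfolding M_def using Q'(1) qA(4) by (auto simp: less_top)
  let ?\<mu> = "\<lambda>c. density lborel (\<lambda>z. ennreal (?d c z))"
  have \<mu>: "emeasure (?\<mu> c) B = (\<integral>\<^sup>+z\<in>B. ennreal (?d c z) \<partial>lborel)" if "c \<in> A" "B \<in> sets borel" for c B
    using meas[OF that(1)] that(2) by (intro emeasure_density) auto
  define x where "x = (\<integral>\<^sup>+z\<in>U. ennreal (?d c0 z) \<partial>lborel)"
  have step: "x \<le> (\<Sum>q\<in>Q'. emeasure (?\<mu> (fst q)) (V j q))" for j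
  proof -
    have "x = emeasure (?\<mu> c0) U" unfolding x_def using \<mu>[OF c0(1)] opU by simp
    also have "\<dots> \<le> emeasure (?\<mu> c0) (\<Union>q\<in>Q'. g j q ` V j q)"
    proof (rule emeasure_mono[OF cover])
      have "open (\<Union>q\<in>Q'. g j q ` V j q)" by (intro open_UN ballI op_image)
      then show "(\<Union>q\<in>Q'. g j q ` V j q) \<in> sets (?\<mu> c0)" by simp
    qed
    also have "\<dots> \<le> (\<Sum>q\<in>Q'. emeasure (?\<mu> c0) (g j q ` V j q))"
      by (rule emeasure_subadditive_finite[OF Q'(1)]) (use op_image in \<open>simp add: image_subset_iff\<close>)
    also have "\<dots> \<le> (\<Sum>q\<in>Q'. emeasure (?\<mu> (fst q)) (V j q))"
    proof (rule sum_mono)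
      fix q assume q: "q \<in> Q'"
      show "emeasure (?\<mu> c0) (g j q ` V j q) \<le> emeasure (?\<mu> (fst q)) (V j q)"
        using mass[OF q, of j] \<mu>[OF c0(1) borel_open[OF op_image[OF q]]] \<mu>[OF qA(1)[OF q] borel_open[OF opV[OF q]]]
        by simp
    qed
    finally show ?thesis .
  qed
  \<comment> \<open>For each \<open>q\<close> the sets \<open>V j q\<close> are disjoint inside one
    piece of finite mass, so \<open>J\<close> copies of the mass \<open>x\<close> of
    \<open>U\<close> fit below a bound that does not involve \<open>J\<close>.\<close>
  have "of_nat J * x \<le> M" for J :: nat
  proof -
    have "of_nat J * x = (\<Sum>j<J. x)" by simp
    also have "\<dots> \<le> (\<Sum>j<J. \<Sum>q\<in>Q'. emeasure (?\<mu> (fst q)) (V j q))" by (intro sum_mono step)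
    also have "\<dots> = (\<Sum>q\<in>Q'. \<Sum>j<J. emeasure (?\<mu> (fst q)) (V j q))" by (rule sum.swap)
    also have "\<dots> \<le> M"
      unfolding M_def
    proof (rule sum_mono)
      fix q assume q: "q \<in> Q'"
      have "(\<Sum>j<J. emeasure (?\<mu> (fst q)) (V j q)) = emeasure (?\<mu> (fst q)) (\<Union>j<J. V j q)"
        using opV[OF q] disj[OF q] by (intro sum_emeasure) (auto simp: disjoint_family_on_def)
      also have "\<dots> \<le> emeasure (?\<mu> (fst q)) (snd q)"
        using qA(2)[OF q] by (intro emeasure_mono) (auto simp: V_def)
      also have "\<dots> = (\<integral>\<^sup>+z\<in>snd q. ennreal (?d (fst q) z) \<partial>lborel)"
        using \<mu>[OF qA(1)[OF q]] qA(2)[OF q] by simp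
      finally show "(\<Sum>j<J. emeasure (?\<mu> (fst q)) (V j q)) \<le> (\<integral>\<^sup>+z\<in>snd q. ennreal (?d (fst q) z) \<partial>lborel)" .
    qed
    finally show ?thesis .
  qed
  then have "x = 0" by (rule sum_bound_imp_zero_ennreal[OF M])
  moreover have "x \<noteq> 0"
    unfolding x_def
  proof (rule nn_integral_open_pos[OF opU])
    show "U \<noteq> {}" using z0 by blast
    show "(\<lambda>z. ennreal (?d c0 z)) \<in> borel_measurable borel" using meas[OF c0(1)] by simp
    show "0 < ennreal (?d c0 z)" if "z \<in> U" for z
      using that Ud by (auto simp: U_def f_def pair_density_def)
  qed
  ultimately show False by blast
qed

end

section \<open>The log canonical threshold\<close>

text \<open>Any finite \<open>F\<close> spanning the line of \<open>s\<close> consists of multiples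
  of \<open>s\<close>, not all zero, so the sum in \<open>lc_system\<close> is a positive constant
  times the squared modulus of \<open>s\<close>, whatever \<open>F\<close> is.\<close>

lemma lc_system_integrable:
  assumes lc: "lc_system A (q / m) (sec.span {s})" and s: "s \<noteq> 0" and q: "q > 1/2" and m: "m > 0"
    and c: "c \<in> A" "p \<in> fst c"
  shows "\<exists>S. open S \<and> snd c p \<in> S \<and> S \<subseteq> snd c ` fst c \<and>
    (\<integral>\<^sup>+z\<in>S. ennreal (cmod (s c (cinv c z)) powr (- 1 / m)) \<partial>lborel) < \<infinity>"
proof -
  obtain F where F: "finite F" "sec.span F = sec.span {s}" and
    int: "\<forall>\<epsilon>. 0 < \<epsilon> \<and> \<epsilon> < 1 \<longrightarrow> (\<forall>c\<in>A. \<forall>p\<in>fst c. \<exists>S. open S \<and> snd c p \<in> S \<and> S \<subseteq> snd c ` fst c \<and>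
        set_integrable lborel S
          (\<lambda>z. (\<Sum>s\<in>F. (cmod (s c (cinv c z)))\<^sup>2) powr (- ((1 - \<epsilon>) * (q / m)))))"
    using lc unfolding lc_system_def by (elim exE conjE)
  have "\<forall>x\<in>F. \<exists>a. x = sec_scale a s"
    using sec.span_base[of _ F] unfolding F(2) sec.span_singleton by blast
  then obtain a where a: "\<And>x. x \<in> F \<Longrightarrow> x = sec_scale (a x) s" by metis
  define G where "G = (\<Sum>x\<in>F. (cmod (a x))\<^sup>2)"
  have G: "G > 0"
  proof (rule ccontr)
    assume "\<not> G > 0"
    moreover have "G \<ge> 0" unfolding G_def by (simp add: sum_nonneg)
    ultimately have "\<forall>x\<in>F. a x = 0"
      using F(1) by (simp add: G_def sum_nonneg_eq_0_iff)
    then have "F \<subseteq> {0}" using a by (force simp: sec_scale_def fun_eq_iff)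
    then have "sec.span F \<subseteq> sec.span {0}" by (rule sec.span_mono)
    then have "s \<in> sec.span {0}" using sec.span_base[of s "{s}"] unfolding F(2) by blast
    then show False using s by (simp add: sec.span_singleton sec_scale_def fun_eq_iff)
  qed
  have sum: "(\<Sum>x\<in>F. (cmod (x c (cinv c z)))\<^sup>2) = G * (cmod (s c (cinv c z)))\<^sup>2" for z
    unfolding G_def sum_distrib_right
    by (rule sum.cong[OF refl], subst a) (auto simp: sec_scale_def norm_mult power_mult_distrib)
  \<comment> \<open>Chosen to make \<open>(1 - \<epsilon>) * q\<close> equal to 1/2; its positivity
    is where \<open>q > 1/2\<close> enters.\<close>
  define \<epsilon> where "\<epsilon> = 1 - 1 / (2 * q)"
  have \<epsilon>: "0 < \<epsilon> \<and> \<epsilon> < 1" and exponent: "- ((1 - \<epsilon>) * (q / m)) = - 1 / (2 * m)"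
    using q by (simp_all add: \<epsilon>_def field_simps)
  obtain S where S: "open S" "snd c p \<in> S" "S \<subseteq> snd c ` fst c" and
    "set_integrable lborel S (\<lambda>z. (\<Sum>x\<in>F. (cmod (x c (cinv c z)))\<^sup>2) powr (- ((1 - \<epsilon>) * (q / m))))"
    using int[rule_format, OF \<epsilon> c] by blast
  then have *: "integrable lborel (\<lambda>z. indicator S z * (G * (cmod (s c (cinv c z)))\<^sup>2) powr (- 1 / (2 * m)))"
    unfolding set_integrable_def sum exponent by simp
  let ?f = "\<lambda>z. ennreal (cmod (s c (cinv c z)) powr (- 1 / m)) * indicator S z"
  let ?h = "\<lambda>z. indicator S z * (G * (cmod (s c (cinv c z)))\<^sup>2) powr (- 1 / (2 * m))"
  have eq: "?f z = ennreal (G powr (1 / (2 * m))) * ennreal (norm (?h z))" for z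
  proof -
    have "((cmod (s c (cinv c z)))\<^sup>2) powr (- 1 / (2 * m)) = cmod (s c (cinv c z)) powr (- 1 / m)"
    proof (cases "s c (cinv c z) = 0")
      case False
      then have "(cmod (s c (cinv c z)))\<^sup>2 = cmod (s c (cinv c z)) powr 2" by simp
      then show ?thesis using m by (simp only: powr_powr) simp
    qed simp
    moreover have "G powr (1 / (2 * m)) * G powr (- 1 / (2 * m)) = 1"
      using G by (simp add: powr_add[symmetric])
    ultimately show ?thesis
      using G by (cases "z \<in> S") (simp_all add: powr_mult ennreal_mult'[symmetric] mult.assoc[symmetric])
  qed
  have "(\<integral>\<^sup>+z. ?f z \<partial>lborel) = ennreal (G powr (1 / (2 * m))) * (\<integral>\<^sup>+z. ennreal (norm (?h z)) \<partial>lborel)"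
    unfolding eq using * by (intro nn_integral_cmult) auto
  also have "\<dots> < \<infinity>"
    using * unfolding integrable_iff_bounded by (simp add: ennreal_mult_less_top)
  finally show ?thesis using S by blast
qed

context cstar_action
begin

text \<open>A semi-invariant section spans an invariant line, which the definition of
  \<open>lct\<close> then tests with \<open>n = m\<close>.\<close>

lemma invariant_system_span:
  assumes s: "semi_invariant m k s" and nz: "s \<noteq> 0"
  shows "invariant_system A (\<rho> ` (- {0})) m (sec.span {s})"
  unfolding invariant_system_def
proof (intro conjI ballI)
  have sm: "s \<in> antican_sections A m" using s unfolding semi_invariant_def by blast
  show "sec.span {s} \<subseteq> antican_sections A m"
    unfolding sec.span_singleton using section_scale[OF sm] by blast
  show "sec.subspace (sec.span {s})" by (rule sec.subspace_span)
  show "sec.span {s} \<noteq> {0}" using sec.span_base[of s "{s}"] nz by blast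
  fix g x assume "g \<in> \<rho> ` (- {0})" "x \<in> sec.span {s}"
  then obtain t a where t: "g = \<rho> t" "t \<noteq> 0" and x: "x = sec_scale a s"
    unfolding sec.span_singleton by blast
  have "is_pullback A m g x (sec_scale (a * t powi k) s)"
    unfolding is_pullback_def x t(1)
  proof (intro ballI impI)
    fix c c' p assume c: "c \<in> A" "c' \<in> A" "p \<in> fst c" "\<rho> t p \<in> fst c'"
    show "sec_scale a s c' (\<rho> t p) = jac c c' (\<rho> t) p ^ m * sec_scale (a * t powi k) s c p"
      unfolding sec_scale_def semi_invariantD[OF s t(2) c] by (simp add: mult_ac)
  qed
  then show "\<exists>t\<in>sec.span {s}. is_pullback A m g x t"
    unfolding sec.span_singleton by blast
qed

theorem lct_le_half:
  assumes comp: "compact_space X" and conn: "connected_space X" and m: "m \<ge> 1"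
    and va: "antican_very_ample A m" and nontriv: "\<exists>t p. t \<noteq> 0 \<and> p \<in> topspace X \<and> \<rho> t p \<noteq> p"
  shows "lct A (\<rho> ` (- {0})) \<le> 1/2"
  unfolding lct_def
proof (rule Sup_least)
  fix x :: ereal
  assume "x \<in> {ereal (of_rat q) | q :: rat. \<forall>n\<ge>1. \<forall>W.
     invariant_system A (\<rho> ` (- {0})) n W \<longrightarrow> lc_system A (of_rat q / real n) W}"
  then obtain q :: rat where x: "x = ereal (of_rat q)"
    and lc: "\<And>n W. n \<ge> 1 \<Longrightarrow> invariant_system A (\<rho> ` (- {0})) n W \<Longrightarrow> lc_system A (of_rat q / real n) W"
    by blast
  have "\<not> (of_rat q :: real) > 1/2"
  proof
    assume q: "(of_rat q :: real) > 1/2"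
    have int: "\<exists>S. open S \<and> snd c p \<in> S \<and> S \<subseteq> snd c ` fst c \<and>
      (\<integral>\<^sup>+z\<in>S. ennreal (cmod (s c (cinv c z)) powr (- 1 / m)) \<partial>lborel) < \<infinity>"
      if "semi_invariant m k s" "s \<noteq> 0" "c \<in> A" "p \<in> fst c" for k s c p
      by (rule lc_system_integrable[OF lc[OF m invariant_system_span[OF that(1,2)]] that(2) q _ that(3,4)])
        (use m in simp)
    obtain k1 s1 k2 s2 where two: "semi_invariant m k1 s1" "s1 \<noteq> 0" "semi_invariant m k2 s2" "s2 \<noteq> 0" "k1 \<noteq> k2"
      by (rule two_weights[OF va nontriv])
    \<comment> \<open>All candidates for the family; compactness of the space will select finitely
      many of them without common zeros.\<close>
    define Z where "Z = {i :: int \<times> ('a, 'n) antican_sec. semi_invariant m (fst i) (snd i) \<and> snd i \<noteq> 0}"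
    have Z: "semi_invariant m (fst i) (snd i)" "snd i \<noteq> 0" "snd i \<in> antican_sections A m" if "i \<in> Z" for i
      using that unfolding Z_def semi_invariant_def by blast+
    let ?N = "\<lambda>i :: int \<times> ('a, 'n) antican_sec. {p \<in> topspace X. \<exists>c\<in>A. p \<in> fst c \<and> 0 * cmod (snd i c p) < cmod (snd i c p)}"
    have "compactin X (topspace X)" using comp by (simp add: compact_space_def)
    then obtain I0 where I0: "finite I0" "I0 \<subseteq> Z" "topspace X \<subseteq> (\<Union>i\<in>I0. ?N i)"
    proof (rule compactin_finite_subcover)
      show "openin X (?N i)" if "i \<in> Z" for i
        by (rule openin_section_norm_less[OF Z(3)[OF that] Z(3)[OF that]])
      show "topspace X \<subseteq> (\<Union>i\<in>Z. ?N i)"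
      proof
        fix p assume p: "p \<in> topspace X"
        obtain c where c: "c \<in> A" "p \<in> fst c" by (rule exists_chart[OF p])
        obtain N s' where s': "\<forall>i\<le>N::nat. s' i \<in> antican_sections A m"
          and base: "\<forall>c\<in>A. \<forall>p\<in>fst c. \<exists>i\<le>N. s' i c p \<noteq> 0"
          using va unfolding antican_very_ample_def by (elim exE conjE)
        obtain i where "i \<le> N" "s' i c p \<noteq> 0" using base c by blast
        then obtain s where s: "s \<in> antican_sections A m" "s c p \<noteq> 0" using s' by blast
        obtain k where k: "weight_part m s k c p \<noteq> 0" by (rule exists_weight_part_nonzero[OF s(1) c s(2)])
        then have "weight_part m s k \<noteq> 0" by auto
        then have "(k, weight_part m s k) \<in> Z"
          using semi_invariant_weight_part[OF s(1)] by (simp add: Z_def)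
        moreover have "p \<in> ?N (k, weight_part m s k)" using p c k by auto
        ultimately show "p \<in> (\<Union>i\<in>Z. ?N i)" by blast
      qed
    qed
    \<comment> \<open>The two sections of different weights are added so that the extreme weights of
      the family differ.\<close>
    define I where "I = I0 \<union> {(k1, s1), (k2, s2)}"
    have I: "finite I" "I \<subseteq> Z" using I0 two by (auto simp: I_def Z_def)
    have base: "\<exists>i\<in>I. snd i c p \<noteq> 0" if c: "c \<in> A" "p \<in> fst c" for c p
    proof -
      have "p \<in> topspace X" by (rule chart_point[OF c])
      then obtain i c' where i: "i \<in> I0" "c' \<in> A" "p \<in> fst c'" "snd i c' p \<noteq> 0" using I0(3) by fastforce
      then have "i \<in> Z" using I0(2) by blast
      then have "snd i c p \<noteq> 0" using section_zero_iff[OF Z(3) c(1) i(2) c(2) i(3)] i(4) by simp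
      then show ?thesis using i(1) unfolding I_def by blast
    qed
    let ?W = "fst ` I"
    have W: "finite ?W" "k1 \<in> ?W" "k2 \<in> ?W" using I(1) by (auto simp: I_def image_iff)
    obtain a where a: "a \<in> I" "fst a = Max ?W"
      using Max_in[OF W(1)] W(2) by (metis empty_iff imageE)
    obtain b where b: "b \<in> I" "fst b = Min ?W"
      using Min_in[OF W(1)] W(2) by (metis empty_iff imageE)
    have bounds: "fst b \<le> fst i" "fst i \<le> fst a" if "i \<in> I" for i
      using that W(1) by (simp_all add: a b)
    have "fst b \<noteq> fst a"
    proof
      assume "fst b = fst a"
      then have "k1 = fst a" "k2 = fst a"
        using bounds[of "(k1, s1)"] bounds[of "(k2, s2)"] by (auto simp: I_def)
      then show False using two(5) by simp
    qed
    then have ba: "fst b < fst a" using bounds[OF a(1)] by simp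
    have aZ: "a \<in> Z" and bZ: "b \<in> Z" using a b I(2) by blast+
    have norm2: "cmod (2 powi n) = 2 powi n" for n by (simp add: norm_power_int)
    have half: "cmod ((1/2) powi n) = 2 powi (- n)" for n
      by (simp add: norm_power_int norm_divide power_int_minus power_int_divide_distrib inverse_eq_divide)
    have mono: "(2::real) powi k \<le> 2 powi l" if "k \<le> l" for k l
      using that by (intro power_int_increasing) auto
    have smono: "(2::real) powi k < 2 powi l" if "k < l" for k l
      using that by (intro power_int_strict_increasing) auto

    show False
    \<comment> \<open>\<open>\<tau> = 2\<close> makes the largest weight dominate and
      \<open>\<tau> = 1/2\<close> the smallest. The sign of the sum of the extreme weights decides
      for which of the two the measure does not shrink.\<close>
    proof (cases "fst a + fst b \<le> 0")
      case True
      show False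
      proof (rule no_integrable_semi_invariant[where I = I and k = fst and s = snd and a = a and b = b and \<tau> = 2,
            OF comp conn m I(1) _ base a(1) b(1) Z(2)[OF aZ] Z(2)[OF bZ]])
        show "semi_invariant m (fst i) (snd i)" if "i \<in> I" for i using Z(1) that I(2) by blast
        show "cmod (2 powi (fst a + fst b)) \<le> 1" using mono[OF True] by (simp add: norm2)
        show "\<exists>S. open S \<and> snd c p \<in> S \<and> S \<subseteq> snd c ` fst c \<and>
          (\<integral>\<^sup>+z\<in>S. ennreal (cmod (snd b c (cinv c z)) powr (- 1 / m)) \<partial>lborel) < \<infinity>"
          if "c \<in> A" "p \<in> fst c" for c p
          by (rule int[OF Z(1)[OF bZ] Z(2)[OF bZ] that])
      qed (use bounds ba in \<open>auto simp: norm2 intro!: mono smono\<close>)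
    next
      case False
      show False
      proof (rule no_integrable_semi_invariant[where I = I and k = fst and s = snd and a = b and b = a and \<tau> = "1/2",
            OF comp conn m I(1) _ base b(1) a(1) Z(2)[OF bZ] Z(2)[OF aZ]])
        show "semi_invariant m (fst i) (snd i)" if "i \<in> I" for i using Z(1) that I(2) by blast
        show "cmod ((1/2) powi (fst b + fst a)) \<le> 1"
          using mono[of "- (fst b + fst a)" 0] False by (simp only: half) simp
        show "\<exists>S. open S \<and> snd c p \<in> S \<and> S \<subseteq> snd c ` fst c \<and>
          (\<integral>\<^sup>+z\<in>S. ennreal (cmod (snd a c (cinv c z)) powr (- 1 / m)) \<partial>lborel) < \<infinity>"
          if "c \<in> A" "p \<in> fst c" for c p
          by (rule int[OF Z(1)[OF aZ] Z(2)[OF aZ] that])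
      qed (use bounds ba in \<open>auto simp only: half intro!: mono smono\<close>, auto)
    qed
  qed
  then show "x \<le> 1/2"
    by (simp add: x one_ereal_def numeral_eq_ereal divide_ereal_def)
qed

end

section \<open>From the identity component to an action\<close>

lemma Aut_top_topspace: "topspace (Aut_top X A) \<subseteq> Aut X A"
  unfolding Aut_top_def topology_generated_by_topspace by blast

lemma Aut0_subset: "Aut0 X A \<subseteq> Aut X A"
  unfolding Aut0_def
  by (rule order_trans[OF connected_component_of_subset_topspace Aut_top_topspace])

text \<open>Joint continuity comes from the compact-open topology: parameters near \<open>t\<close>
  still send a whole compact neighbourhood of \<open>p\<close> into \<open>U\<close>.\<close>

lemma cstar_action_Aut0:
  assumes X: "complex_atlas X A" "compact_space X" "Hausdorff_space X"
    and iso: "\<rho> \<in> iso Cstar (Aut0_group X A)"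
    and homeo: "homeomorphic_map (top_of_set (- {0})) (subtopology (Aut_top X A) (Aut0 X A)) \<rho>"
    and holo: "holo_action A \<rho>"
  shows "cstar_action X A \<rho>"
proof -
  have hom: "\<rho> \<in> hom Cstar (Aut0_group X A)" using iso by (simp add: iso_def)
  have in_Aut0: "\<rho> t \<in> Aut0 X A" if "t \<noteq> 0" for t
    using hom that by (auto simp: hom_def Cstar_def Aut0_group_def)
  have in_Aut: "\<rho> t \<in> Aut X A" if "t \<noteq> 0" for t using in_Aut0[OF that] Aut0_subset by blast
  have Bij: "\<rho> t \<in> Bij (topspace X)" and hm: "holo_map X A (\<rho> t)" if "t \<noteq> 0" for t
    using in_Aut[OF that] by (auto simp: Aut_def)
  have in_X: "\<rho> t p \<in> topspace X" if "t \<noteq> 0" "p \<in> topspace X" for t p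
    using hm[OF that(1)] that(2) unfolding holo_map_def continuous_map_def by blast
  have mult: "\<rho> t (\<rho> u p) = \<rho> (t * u) p" if "t \<noteq> 0" "u \<noteq> 0" "p \<in> topspace X" for t u p
  proof -
    have "\<rho> (t * u) = \<rho> t \<otimes>\<^bsub>BijGroup (topspace X)\<^esub> \<rho> u"
      using hom that by (auto simp: hom_def Cstar_def Aut0_group_def)
    then show ?thesis using Bij that by (simp add: BijGroup_def compose_def)
  qed
  \<comment> \<open>\<open>hom\<close> gives multiplicativity only; \<open>\<rho> 1\<close> is
    idempotent and injective, hence the identity on the space.\<close>
  have one: "\<rho> 1 p = p" if p: "p \<in> topspace X" for p
  proof -
    have "\<rho> 1 (\<rho> 1 p) = \<rho> 1 p" using mult[of 1 1 p] p by simp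
    moreover have "inj_on (\<rho> 1) (topspace X)" using Bij[of 1] by (simp add: Bij_def bij_betw_def)
    ultimately show ?thesis using in_X[of 1 p] p by (simp add: inj_on_def)
  qed
  have cont: "\<exists>T W. open T \<and> t \<in> T \<and> openin X W \<and> p \<in> W \<and> (\<forall>u\<in>T. \<forall>q\<in>W. u \<noteq> 0 \<longrightarrow> \<rho> u q \<in> U)"
    if t: "t \<noteq> 0" and p: "p \<in> topspace X" and U: "openin X U" "\<rho> t p \<in> U" for t p U
  proof -
    define N where "N = {q \<in> topspace X. \<rho> t q \<in> U}"
    have N: "openin X N" "p \<in> N"
      unfolding N_def using hm[OF t] U p unfolding holo_map_def continuous_map_def by blast+
    \<comment> \<open>Regularity separates \<open>p\<close> from the complement of \<open>N\<close>
      by \<open>W\<close> and \<open>W'\<close>; the complement \<open>K\<close> of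
      \<open>W'\<close> is closed, hence compact, and lies between \<open>W\<close> and
      \<open>N\<close>.\<close>
    have "regular_space X" by (rule compact_Hausdorff_imp_regular_space[OF X(2,3)])
    moreover have "closedin X (topspace X - N)" using N(1) by blast
    moreover have "p \<in> topspace X - (topspace X - N)" using p N(2) by blast
    ultimately obtain W W' where W: "openin X W" "openin X W'" "p \<in> W" "topspace X - N \<subseteq> W'" "disjnt W W'"
      unfolding regular_space_def by meson
    define K where "K = topspace X - W'"
    have K: "compactin X K" unfolding K_def by (rule closedin_compact_space[OF X(2)]) (use W(2) in blast)
    have WK: "W \<subseteq> K" and KN: "K \<subseteq> N"
      using W openin_subset[OF W(1)] by (auto simp: K_def disjnt_def)
    let ?G = "{f \<in> Aut X A. f ` K \<subseteq> U}"
    have "openin (Aut_top X A) ?G"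
      unfolding Aut_top_def openin_topology_generated_by_iff
      by (rule generate_topology_on.Basis) (use K U(1) in blast)
    then have "openin (subtopology (Aut_top X A) (Aut0 X A)) (Aut0 X A \<inter> ?G)"
      by (rule openin_subtopology_Int2)
    moreover have "continuous_map (top_of_set (- {0})) (subtopology (Aut_top X A) (Aut0 X A)) \<rho>"
      by (rule homeomorphic_imp_continuous_map[OF homeo])
    ultimately have "openin (top_of_set (- {0})) {u \<in> topspace (top_of_set (- {0})). \<rho> u \<in> Aut0 X A \<inter> ?G}"
      unfolding continuous_map_def by blast
    then have T: "open {u \<in> - {0}. \<rho> u \<in> Aut0 X A \<inter> ?G}" (is "open ?T")
      by (simp add: openin_open_eq open_Compl)
    have "\<rho> t ` K \<subseteq> U" using KN unfolding N_def by blast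
    then have "t \<in> ?T" using t in_Aut0[OF t] in_Aut[OF t] by simp
    moreover have "\<rho> u q \<in> U" if "u \<in> ?T" "q \<in> W" for u q using that WK by blast
    ultimately show ?thesis using T W(1,3) by blast
  qed
  show ?thesis
    by unfold_locales (fact X(1) hm mult one cont holo)+
qed

theorem theorem0p3:
  fixes V :: "'a topology" and A :: "('a, 3) chart set"
  assumes "family_Va V A"
  shows "lct A (Aut0 V A) \<le> 1/2"
proof -
  have "fano_manifold V A" "Aut0_is_Cstar V A"
    using assms unfolding family_Va_def mukai_threefold_def prime_fano_threefold_def by blast+
  then obtain m \<rho> where ccm: "compact_complex_manifold V A" and m: "m \<ge> 1" "antican_very_ample A m"
    and \<rho>: "\<rho> \<in> iso Cstar (Aut0_group V A)"
      "homeomorphic_map (top_of_set (- {0})) (subtopology (Aut_top V A) (Aut0 V A)) \<rho>" "holo_action A \<rho>"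
    unfolding fano_manifold_def antican_ample_def Aut0_is_Cstar_def by blast
  have V: "complex_atlas V A" "compact_space V" "Hausdorff_space V" "connected_space V"
    using ccm unfolding compact_complex_manifold_def by blast+
  interpret cstar_action V A \<rho>
    by (rule cstar_action_Aut0[OF V(1-3) \<rho>])
  have bij: "bij_betw \<rho> (- {0}) (Aut0 V A)"
    using \<rho>(1) by (simp add: iso_def Cstar_def Aut0_group_def)
  \<comment> \<open>A trivial action would make \<open>\<rho> 1\<close> and \<open>\<rho> 2\<close>
    agree on the space, hence coincide as extensional functions, against the injectivity of
    \<open>\<rho>\<close>.\<close>
  have "\<exists>t p. t \<noteq> 0 \<and> p \<in> topspace V \<and> \<rho> t p \<noteq> p"
  proof (rule ccontr)
    assume contr: "\<nexists>t p. t \<noteq> 0 \<and> p \<in> topspace V \<and> \<rho> t p \<noteq> p"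
    have "\<rho> t \<in> extensional (topspace V)" if "t \<noteq> 0" for t
      using bij_betwE[OF bij] that Aut0_subset by (fastforce simp: Aut_def Bij_def)
    moreover have "\<rho> t p = p" if "t \<noteq> 0" "p \<in> topspace V" for t p
      using contr that by blast
    ultimately have "\<rho> 2 = \<rho> 1"
      by (intro extensionalityI[of _ "topspace V"]) simp_all
    then have "(2::complex) = 1"
      by (rule inj_onD[OF bij_betw_imp_inj_on[OF bij]]) simp_all
    then show False by simp
  qed
  from lct_le_half[OF V(2,4) m this] show ?thesis
    using bij_betw_imp_surj_on[OF bij] by simp
qed

end
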